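(* Let $T>0$, $N\ge 1$, $0=s_0<t_1<s_1<t_2<\dots<s_N<t_{N+1}=T$, $h\in C^1([0,T];\mathbb{R})$, $\beta\in\mathbb{R}$, $H(t)=\int_0^t h(\tau)\,d\tau$ and $H_0=\min_{t\in[0,T]}H(t)$. Suppose that there is $\delta>0$ such that the following hold. 1. $f_i\in C((s_i,t_{i+1}]\times[-\delta,\delta],\mathbb{R})$ for $i=0,1,\dots,N$, and $I_i\in C([-\delta,\delta],\mathbb{R})$ for $i=1,\dots,N$. 2. $f_i(t,u)=-f_i(t,-u)$ for all $(t,u)\in(s_i,t_{i+1}]\times[-\delta,\delta]$, $i=0,\dots,N$. 3. With $F_i(t,u)=\int_0^u f_i(t,s)\,ds$: $F_i(t,u)\ge 0$ and $uf_i(t,u)-2F_i(t,u)<0$ for all $0<|u|\le\delta$ and $t\in(s_i,t_{i+1}]$, $i=0,\dots,N$. 4. $\lim_{|u|\to0}\inf_{t\in(s_i,t_{i+1}]}\frac{F_i(t,u)}{|u|^2}=+\infty$, $i=0,\dots,N$. 5. There exist constants $a_1>0$ and $1<\theta_1<2$ such that $|f_i(t,u)|\le a_1|u|^{\theta_1-1}$ for all $(t,u)\in(s_i,t_{i+1}]\times[-\delta,\delta]$, $i=0,\dots,N$. 6. There exists a constant $a_*$ with $0<a_*<\frac{a_1}{\theta_1}$ such that $F_i(t,u)\ge a_*|u|^{\theta_1}$ for all $t\in(s_i,t_{i+1}]$, $u\in[-\delta,\delta]$, $i=0,\dots,N$. 7. $I_i(u)=-I_i(-u)$ for all $u\in[-\delta,\delta]$,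 $i=1,\dots,N$. 8. There exist constants $a_2>0$ and $1<\theta_2<2$ such that $|I_i(u)|\le a_2(|u|^{\theta_2-1}+1)$ for all $u\in[-\delta,\delta]$, $i=1,\dots,N$. 9. $I_i(u)\ge0$ for all $u\in[0,\delta]$, $i=1,\dots,N$, and $2\sum_{i=1}^N\int_0^u e^{H(t_i)}I_i(t)\,dt\ge\sum_{i=1}^N e^{H(t_i)}I_i(u)u$ for all $u\in[-\delta,\delta]$. 10. $\frac{2e^{H_0}}{T^2}>\beta$. Then the system $$\begin{cases}u^{(4)}(t)+2h(t)u'''(t)+\left(h^2(t)+h'(t)+\beta e^{-H(t)}\right)u''(t)=f_i(t,u(t)),& t\in(s_i,t_{i+1}],\ i=0,\dots,N,\\ u^{(4)}(t)+2h(t)u'''(t)+\left(h^2(t)+h'(t)+\beta e^{-H(t)}\right)u''(t)=0,& t\in(t_i,s_i],\ i=1,\dots,N,\\ u''(t_i^+)=u''(t_i^-),\quad u''(s_i^+)=u''(s_i^-),\quad u'''(s_i^+)=u'''(s_i^-),& i=1,\dots,N,\\ \Delta u'''(t_i)=I_i(u(t_i)),& i=1,\dots,N,\\ u(0)=u'(0)=u(T)=u'(T)=0\end{cases}$$ possesses infinitely many distinct (weak) solutions whose $L^\infty$-norms are less than $\frac{\delta}{2}$.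
   Context: Here $\Delta u'''(t_i)=u'''(t_i^+)-u'''(t_i^-)$ with $u'''(t_i^\pm)=\lim_{t\to t_i^\pm}u'''(t)$. Let $E=H_0^2(0,T)$, the space of $u:(0,T)\to\mathbb{R}$ such that $u,u'$ are absolutely continuous, $u''\in L^2(0,T)$ and $u(0)=u(T)=u'(0)=u'(T)=0$. Solutions are understood in the weak sense: $u\in E$ with $\|u\|_\infty\le\delta$ (so that all terms are defined) is a weak solution if for every $v\in E$ $$\int_0^T e^{H(t)}u''v''\,dt-\beta\int_0^T u'v'\,dt-\sum_{i=0}^N\int_{s_i}^{t_{i+1}}e^{H(t)}f_i(t,u)v\,dt-\sum_{i=1}^N e^{H(t_i)}I_i(u(t_i))v(t_i)=0.$$ Also $\|u\|_\infty=\max_{t\in[0,T]}|u(t)|$. *)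

theory Defs
  imports "HOL-Analysis.Analysis"
begin

definition C1_on :: "real set \<Rightarrow> (real \<Rightarrow> real) \<Rightarrow> bool" where
  "C1_on S h \<longleftrightarrow>
     (\<exists>h'. (\<forall>x\<in>S. (h has_real_derivative h' x) (at x within S)) \<and> continuous_on S h')"

(* The oriented integral from 0 to x; it is minus the integral over [x, 0] for x < 0. *)
definition primitive :: "(real \<Rightarrow> real) \<Rightarrow> real \<Rightarrow> real" where
  "primitive g x = (LBINT r=0..x. g r)"

(* A division is a finite family of closed intervals with pairwise disjoint interiors. *)
definition absolutely_continuous_fun_on :: "real set \<Rightarrow> (real \<Rightarrow> real) \<Rightarrow> bool" where
  "absolutely_continuous_fun_on S g \<longleftrightarrow>
     (\<forall>\<epsilon>>0. \<exists>\<eta>>0. \<forall>\<D>. \<D> division_of \<Union>\<D> \<and> \<Union>\<D> \<subseteq> S \<and> (\<Sum>K\<in>\<D>. measure lborel K) < \<eta>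
        \<longrightarrow> (\<Sum>K\<in>\<D>. \<bar>g (Sup K) - g (Inf K)\<bar>) < \<epsilon>)"

definition L2_on :: "real set \<Rightarrow> (real \<Rightarrow> real) \<Rightarrow> bool" where
  "L2_on S g \<longleftrightarrow> set_borel_measurable lebesgue S g \<and> set_integrable lebesgue S (\<lambda>x. (g x)\<^sup>2)"

(* One-sided derivatives at the end points of [0, T]; an unspecified value where the derivative
   does not exist. *)
definition D1 :: "real \<Rightarrow> (real \<Rightarrow> real) \<Rightarrow> real \<Rightarrow> real" where
  "D1 T u x = vector_derivative u (at x within {0..T})"

definition D2 :: "real \<Rightarrow> (real \<Rightarrow> real) \<Rightarrow> real \<Rightarrow> real" where
  "D2 T u = D1 T (D1 T u)"

(* The functions are taken on the closed interval, where the boundary values make sense. They are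
   extended by 0 to the real line, so that equality in H20 T is equality of functions on [0, T].
   An absolutely continuous u whose (a.e.) derivative is absolutely continuous is C^1, so u is
   differentiable everywhere; u'' exists almost everywhere. The two differentiability clauses
   follow from absolute continuity and are written out so that D1 and D2 are visibly genuine
   derivatives. *)
definition H20 :: "real \<Rightarrow> (real \<Rightarrow> real) set" where
  "H20 T = {u.
     absolutely_continuous_fun_on {0..T} u \<and>
     u differentiable_on {0..T} \<and>
     absolutely_continuous_fun_on {0..T} (D1 T u) \<and>
     (AE x in lebesgue. x \<in> {0..T} \<longrightarrow> D1 T u differentiable (at x within {0..T})) \<and>
     L2_on {0..T} (D2 T u) \<and>
     u 0 = 0 \<and> u T = 0 \<and> D1 T u 0 = 0 \<and> D1 T u T = 0 \<and>
     (\<forall>x. x \<notin> {0..T} \<longrightarrow> u x = 0)}"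

definition sup_norm :: "real \<Rightarrow> (real \<Rightarrow> real) \<Rightarrow> real" where
  "sup_norm T u = (SUP x\<in>{0..T}. \<bar>u x\<bar>)"

(* Weak solutions of the impulsive problem
     u'''' + 2 h u''' + (h^2 + h' + \<beta> e^(-H)) u'' = f_i(x, u)   on (s_i, t_(i+1)],  0 \<le> i \<le> N,
     u'''' + 2 h u''' + (h^2 + h' + \<beta> e^(-H)) u'' = 0           on (t_i, s_i],      1 \<le> i \<le> N,
     u''(t_i+) = u''(t_i-),  u''(s_i+) = u''(s_i-),  u'''(s_i+) = u'''(s_i-),
     u'''(t_i+) - u'''(t_i-) = I_i(u(t_i)),                       1 \<le> i \<le> N,
     u(0) = u'(0) = u(T) = u'(T) = 0,
   with H = primitive h. The equation multiplied by e^H reads (e^H u'')'' + \<beta> u'' = e^H f_i(x, u)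
   (resp. = 0); the bound by \<delta> ensures that all terms are defined, since f_i and I_i are given
   only for |u| \<le> \<delta>. *)
definition weak_solution ::
  "real \<Rightarrow> nat \<Rightarrow> (nat \<Rightarrow> real) \<Rightarrow> (nat \<Rightarrow> real) \<Rightarrow> (real \<Rightarrow> real) \<Rightarrow> real \<Rightarrow> real \<Rightarrow>
   (nat \<Rightarrow> real \<Rightarrow> real \<Rightarrow> real) \<Rightarrow> (nat \<Rightarrow> real \<Rightarrow> real) \<Rightarrow> (real \<Rightarrow> real) \<Rightarrow> bool" where
  "weak_solution T N s t h \<beta> \<delta> f I u \<longleftrightarrow>
     u \<in> H20 T \<and> sup_norm T u \<le> \<delta> \<and>
     (\<forall>v\<in>H20 T.
        (LINT x:{0..T}|lebesgue. exp (primitive h x) * D2 T u x * D2 T v x)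
        - \<beta> * (LINT x:{0..T}|lebesgue. D1 T u x * D1 T v x)
        - (\<Sum>i=0..N. LINT x:{s i<..t (i+1)}|lebesgue. exp (primitive h x) * f i x (u x) * v x)
        - (\<Sum>i=1..N. exp (primitive h (t i)) * I i (u (t i)) * v (t i)) = 0)"

end

theory Submission
  imports Defs "HOL-Library.Z2" "HOL-Complex_Analysis.Great_Picard"
begin

text \<open>
  Weak solutions are the critical points of an even functional \<open>\<Phi>(z) = B(z, z) / 2 - \<Psi>(z)\<close>, where
  \<open>B(z, z)\<close> is the integral of \<open>e\<^sup>H (u'')\<^sup>2\<close>, \<open>z = u''\<close>, and the gradient of \<open>\<Psi>\<close> is a compact map \<open>A\<close>.
  If there were only finitely many small solutions, 0 would be the only fixed point of \<open>A\<close> in some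
  ball. Because \<open>F\<^sub>i\<close> grows at least like \<open>\<bar>u\<bar>\<close> to the power \<open>\<theta>1 < 2\<close>, \<open>\<Phi>\<close> is negative on small spheres of
  every dimension. Explicit Euler steps \<open>z - \<tau>(z - A z)\<close> for the gradient flow are odd and continuous, and
  compactness (Palais--Smale) lets them push such a sphere below a level \<open>-c\<close> that does not depend
  on its dimension. In the ball, \<open>\<Psi> \<ge> c\<close> keeps \<open>u\<close> away from 0 uniformly, so its values on a finite grid
  cannot all vanish, which contradicts the Borsuk--Ulam theorem for spheres of large dimension.
  The Borsuk--Ulam theorem is obtained from Ky Fan's count of alternating simplices modulo 2.
\<close>

section \<open>Cochains modulo 2 and the Borsuk--Ulam theorem\<close>

text \<open>The unknown is the continuous curvature z = u'', not a Sobolev function. The gradient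
  map returns (load moment - \<beta> u - affine function) divided by the weight, which is
  continuous, so its fixed points lie in this smaller space and no Hilbert space has to be built.
  The price is that the energy seminorm \<open>nrm\<close> is not complete there. Only values of the
  gradient map are passed to the limit, and these converge in the sup norm, because a deflection
  depends compactly on its curvature. The main obstacle is that everything happens in a ball, which
  a descent might leave. Between the radii r / 4 and r the gradient is at least \<nu>1, so moving
  outwards costs a definite amount of energy, and a cutoff stops the points before they can pay for
  the whole way. The level -c is read off from this cost, which is why it does not depend on the
  dimension. Euler steps make oddness and continuity of the deformation immediate. The spheres are
  spanned by polynomials with double zeros at both ends: a nonzero polynomial cannot vanish on the
  interval where the force acts.\<close>

declare add_bit_eq_xor [simp del] mult_bit_eq_and [simp del]

lemma bit_add_self [simp]: "a + a = (0::bit)" "a + (a + b) = (b::bit)"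
  by (cases a; cases b; simp add: add_bit_eq_xor)+

text \<open>Over \<open>bit\<close> a boundary carries no signs, so the faces form a plain list.
  Repeated vertices are allowed, and degenerate simplices need no separate treatment.\<close>

primrec faces :: "'a list \<Rightarrow> 'a list list" where
  "faces [] = []"
| "faces (x # xs) = xs # map ((#) x) (faces xs)"

text \<open>Maps from lists to \<open>bit\<close> serve as cochains modulo 2 on ordered simplices; the list \<open>[]\<close> is the
  empty simplex of the augmented complex. Subdivision acts on cochains, dually to chains.\<close>

definition coboundary :: "('a list \<Rightarrow> bit) \<Rightarrow> 'a list \<Rightarrow> bit" where
  "coboundary \<phi> \<sigma> = sum_list (map \<phi> (faces \<sigma>))"

lemma coboundary_Nil [simp]: "coboundary \<phi> [] = 0"
  by (simp add: coboundary_def)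

lemma coboundary_Cons [simp]:
  "coboundary \<phi> (x # xs) = \<phi> xs + coboundary (\<lambda>\<tau>. \<phi> (x # \<tau>)) xs"
  by (simp add: coboundary_def comp_def)

lemma coboundary_add:
  "coboundary (\<lambda>\<tau>. \<phi> \<tau> + \<psi> \<tau>) \<sigma> = coboundary \<phi> \<sigma> + coboundary \<psi> \<sigma>"
  by (simp add: coboundary_def sum_list_addf)

lemma coboundary_coboundary [simp]: "coboundary (coboundary \<phi>) \<sigma> = 0"
  by (induction \<sigma> arbitrary: \<phi>) (simp_all add: coboundary_add)

lemma coboundary_map: "coboundary \<phi> (map g \<sigma>) = coboundary (\<lambda>\<tau>. \<phi> (map g \<tau>)) \<sigma>"
  by (induction \<sigma> arbitrary: \<phi>) simp_all

lemma length_faces: "\<tau> \<in> set (faces \<sigma>) \<Longrightarrow> Suc (length \<tau>) = length \<sigma>"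
  by (induction \<sigma> arbitrary: \<tau>) auto

lemma set_faces: "\<tau> \<in> set (faces \<sigma>) \<Longrightarrow> set \<tau> \<subseteq> set \<sigma>"
  by (induction \<sigma> arbitrary: \<tau>) fastforce+

text \<open>A Leibniz rule: every entry of \<sigma> lies in exactly one of the two sublists, so
  deleting it changes that sublist only.\<close>

lemma coboundary_filter:
  "coboundary (\<lambda>\<tau>. F (filter P \<tau>) (filter (\<lambda>x. \<not> P x) \<tau>)) \<sigma> =
     coboundary (\<lambda>\<tau>. F \<tau> (filter (\<lambda>x. \<not> P x) \<sigma>)) (filter P \<sigma>)
     + coboundary (F (filter P \<sigma>)) (filter (\<lambda>x. \<not> P x) \<sigma>)"
proof (induction \<sigma> arbitrary: F)
  case (Cons x \<sigma>)
  then show ?case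
    using Cons.IH[of "\<lambda>ts. F (x # ts)"] Cons.IH[of "\<lambda>ts rs. F ts (x # rs)"]
    by (cases "P x") (simp_all add: algebra_simps)
qed simp

section \<open>Barycentric subdivision acting on cochains\<close>

definition barycentre :: "'a::real_vector list \<Rightarrow> 'a" where
  "barycentre \<sigma> = (1 / real (length \<sigma>)) *\<^sub>R sum_list \<sigma>"

text \<open>The transpose of the chain map that sends a simplex to the cone, with its barycentre as
  apex, over its subdivided boundary.\<close>

function subdiv :: "('a::real_vector list \<Rightarrow> bit) \<Rightarrow> 'a list \<Rightarrow> bit" where
  "subdiv \<phi> \<sigma> = (if \<sigma> = [] then \<phi> []
     else sum_list (map (subdiv (\<lambda>\<rho>. \<phi> (barycentre \<sigma> # \<rho>))) (faces \<sigma>)))"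
  by auto
termination
  by (relation "Wellfounded.measure (\<lambda>(\<phi>, \<sigma>). length \<sigma>)") (auto dest: length_faces)

declare subdiv.simps [simp del]

lemma subdiv_Nil [simp]: "subdiv \<phi> [] = \<phi> []"
  by (simp add: subdiv.simps)

lemma subdiv_rec:
  "\<sigma> \<noteq> [] \<Longrightarrow> subdiv \<phi> \<sigma> = coboundary (subdiv (\<lambda>\<rho>. \<phi> (barycentre \<sigma> # \<rho>))) \<sigma>"
  by (subst subdiv.simps) (simp add: coboundary_def)

lemma coboundary_cong:
  "(\<And>\<tau>. \<tau> \<in> set (faces \<sigma>) \<Longrightarrow> \<phi> \<tau> = \<psi> \<tau>) \<Longrightarrow> coboundary \<phi> \<sigma> = coboundary \<psi> \<sigma>"
  by (auto simp: coboundary_def intro!: arg_cong[where f = sum_list])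

lemma subdiv_add: "subdiv (\<lambda>\<tau>. \<phi> \<tau> + \<psi> \<tau>) \<sigma> = subdiv \<phi> \<sigma> + subdiv \<psi> \<sigma>"
proof (induction "length \<sigma>" arbitrary: \<sigma> \<phi> \<psi> rule: less_induct)
  case less
  show ?case
  proof (cases "\<sigma> = []")
    case False
    have "subdiv (\<lambda>\<rho>. \<phi> (barycentre \<sigma> # \<rho>) + \<psi> (barycentre \<sigma> # \<rho>)) \<tau> =
        subdiv (\<lambda>\<rho>. \<phi> (barycentre \<sigma> # \<rho>)) \<tau> + subdiv (\<lambda>\<rho>. \<psi> (barycentre \<sigma> # \<rho>)) \<tau>"
      if "\<tau> \<in> set (faces \<sigma>)" for \<tau>
      using less length_faces[OF that] by simp
    then show ?thesis
      using False by (simp add: subdiv_rec coboundary_add cong: coboundary_cong)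
  qed simp
qed

text \<open>Subdivision is a chain map. Splitting off the apex gives the wanted term and, by
  induction on the faces, a double coboundary, which vanishes.\<close>

lemma subdiv_coboundary: "subdiv (coboundary \<phi>) \<sigma> = coboundary (subdiv \<phi>) \<sigma>"
proof (induction "length \<sigma>" arbitrary: \<sigma> \<phi> rule: less_induct)
  case less
  show ?case
  proof (cases "\<sigma> = []")
    case False
    let ?b = "barycentre \<sigma>"
    have "subdiv (coboundary \<phi>) \<sigma> =
        coboundary (subdiv (\<lambda>\<rho>. \<phi> \<rho> + coboundary (\<lambda>\<tau>. \<phi> (?b # \<tau>)) \<rho>)) \<sigma>"
      using False by (simp add: subdiv_rec)
    also have "\<dots> = coboundary (subdiv \<phi>) \<sigma>
        + coboundary (subdiv (coboundary (\<lambda>\<tau>. \<phi> (?b # \<tau>)))) \<sigma>"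
      by (simp only: coboundary_add[symmetric] subdiv_add[symmetric])
    also have "coboundary (subdiv (coboundary (\<lambda>\<tau>. \<phi> (?b # \<tau>)))) \<sigma> =
        coboundary (coboundary (subdiv (\<lambda>\<tau>. \<phi> (?b # \<tau>)))) \<sigma>"
      by (intro coboundary_cong less) (auto dest: length_faces)
    finally show ?thesis by simp
  qed simp
qed

lemma barycentre_uminus: "barycentre (map uminus \<sigma>) = - barycentre \<sigma>"
proof -
  have "sum_list (map uminus \<sigma>) = - sum_list \<sigma>"
    by (induction \<sigma>) simp_all
  then show ?thesis by (simp add: barycentre_def)
qed

text \<open>Barycentres are odd, so the antipodal symmetry of a labelling survives on the small
  simplices.\<close>

lemma subdiv_uminus: "subdiv \<phi> (map uminus \<sigma>) = subdiv (\<lambda>\<tau>. \<phi> (map uminus \<tau>)) \<sigma>"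
proof (induction "length \<sigma>" arbitrary: \<sigma> \<phi> rule: less_induct)
  case less
  show ?case
  proof (cases "\<sigma> = []")
    case False
    have "subdiv (\<lambda>\<rho>. \<phi> (- barycentre \<sigma> # \<rho>)) (map uminus \<tau>) =
        subdiv (\<lambda>\<rho>. \<phi> (- barycentre \<sigma> # map uminus \<rho>)) \<tau>"
      if "\<tau> \<in> set (faces \<sigma>)" for \<tau>
      using less length_faces[OF that] by simp
    then show ?thesis
      using False
      by (simp add: subdiv_rec coboundary_map barycentre_uminus cong: coboundary_cong)
  qed simp
qed

definition mesh_le :: "'a::metric_space list \<Rightarrow> real \<Rightarrow> bool" where
  "mesh_le \<sigma> d \<longleftrightarrow> (\<forall>x\<in>set \<sigma>. \<forall>y\<in>set \<sigma>. dist x y \<le> d)"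

lemma barycentre_in_hull: "\<sigma> \<noteq> [] \<Longrightarrow> barycentre \<sigma> \<in> convex hull (set \<sigma>)"
proof -
  assume "\<sigma> \<noteq> []"
  have "barycentre \<sigma> = (\<Sum>i<length \<sigma>. (1 / real (length \<sigma>)) *\<^sub>R (\<sigma> ! i))"
    by (simp add: barycentre_def sum_list_sum_nth scaleR_sum_right atLeast0LessThan)
  also have "\<dots> \<in> convex hull (set \<sigma>)"
    using \<open>\<sigma> \<noteq> []\<close> by (intro convex_sum) (auto intro: hull_inc)
  finally show ?thesis .
qed

text \<open>The summand of \<open>v\<close> itself vanishes, which leaves the factor (k - 1) / k for
  k vertices. It grows with k, so m / (m + 1) serves all faces at once.\<close>

lemma dist_barycentre_le:
  fixes \<sigma> :: "'a::real_normed_vector list"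
  assumes "mesh_le \<sigma> d" "v \<in> set \<sigma>" "length \<sigma> \<le> Suc m"
  shows "dist (barycentre \<sigma>) v \<le> real m / real (Suc m) * d"
proof -
  let ?k = "length \<sigma>"
  have k: "?k > 0" using assms(2) by (cases \<sigma>) auto
  obtain j where j: "j < ?k" "v = \<sigma> ! j"
    using assms(2) by (metis in_set_conv_nth)
  have d: "0 \<le> d" using assms(1,2) by (force simp: mesh_le_def)
  have "barycentre \<sigma> - v = (1 / real ?k) *\<^sub>R (\<Sum>i<?k. \<sigma> ! i - v)"
    using k by (simp add: barycentre_def sum_list_sum_nth atLeast0LessThan sum_subtractf
        scaleR_diff_right) (simp add: scaleR_conv_of_real sum_constant_scaleR)
  also have "(\<Sum>i<?k. \<sigma> ! i - v) = (\<Sum>i\<in>{..<?k} - {j}. \<sigma> ! i - v)"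
    using j by (intro sum.mono_neutral_right) auto
  finally have "dist (barycentre \<sigma>) v = norm (\<Sum>i\<in>{..<?k} - {j}. \<sigma> ! i - v) / real ?k"
    by (simp add: dist_norm)
  also have "norm (\<Sum>i\<in>{..<?k} - {j}. \<sigma> ! i - v) \<le> (\<Sum>i\<in>{..<?k} - {j}. d)"
    using assms(1,2) by (intro sum_norm_le) (auto simp: mesh_le_def dist_norm)
  also have "\<dots> = (real ?k - 1) * d"
    using j k by (simp add: of_nat_diff)
  finally have "dist (barycentre \<sigma>) v \<le> (real ?k - 1) / real ?k * d"
    using k by (simp add: divide_right_mono)
  also have "\<dots> \<le> real m / real (Suc m) * d"
    using k assms(3) d by (intro mult_right_mono) (auto simp: field_simps)
  finally show ?thesis .
qed

text \<open>Dual form of two facts: the simplices of the subdivision stay in the hull of \<sigma>,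
  and their diameters shrink by m / (m + 1). The set of these simplices is never formed; two
  cochains that agree on all candidates have equal subdivisions.\<close>

lemma subdiv_local:
  fixes \<sigma> :: "'a::real_normed_vector list"
  assumes "mesh_le \<sigma> d" "length \<sigma> \<le> Suc m"
    and "\<And>\<tau>. set \<tau> \<subseteq> convex hull (set \<sigma>) \<Longrightarrow> length \<tau> = length \<sigma> \<Longrightarrow>
           mesh_le \<tau> (real m / real (Suc m) * d) \<Longrightarrow> \<phi> \<tau> = \<psi> \<tau>"
  shows "subdiv \<phi> \<sigma> = subdiv \<psi> \<sigma>"
  using assms
proof (induction "length \<sigma>" arbitrary: \<sigma> \<phi> \<psi> rule: less_induct)
  case less
  show ?case
  proof (cases "\<sigma> = []")
    case True
    then show ?thesis using less.prems(3)[of "[]"] by (simp add: mesh_le_def)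
  next
    case False
    let ?b = "barycentre \<sigma>" and ?q = "real m / real (Suc m) * d"
    \<comment> \<open>A ball is convex, so the estimate for the vertices extends to the hull, which
      contains all vertices of the subdivided faces. Hence adding the apex keeps the mesh
      bound.\<close>
    have hull: "convex hull (set \<sigma>) \<subseteq> cball ?b ?q"
      using dist_barycentre_le[OF less.prems(1) _ less.prems(2)]
      by (intro hull_minimal) auto
    have q: "0 \<le> ?q"
      using hull barycentre_in_hull[OF False] by auto
    have "subdiv (\<lambda>\<rho>. \<phi> (?b # \<rho>)) \<tau> = subdiv (\<lambda>\<rho>. \<psi> (?b # \<rho>)) \<tau>"
      if \<tau>: "\<tau> \<in> set (faces \<sigma>)" for \<tau>
    proof (rule less.hyps)
      show "length \<tau> < length \<sigma>" "length \<tau> \<le> Suc m"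
        using length_faces[OF \<tau>] less.prems(2) by auto
      show "mesh_le \<tau> d"
        using set_faces[OF \<tau>] less.prems(1) by (auto simp: mesh_le_def)
      fix \<rho> assume \<rho>: "set \<rho> \<subseteq> convex hull (set \<tau>)" "length \<rho> = length \<tau>" "mesh_le \<rho> ?q"
      have "set \<rho> \<subseteq> convex hull (set \<sigma>)"
        using \<rho>(1) hull_mono[OF set_faces[OF \<tau>]] by blast
      moreover have "mesh_le (?b # \<rho>) ?q"
        using calculation hull \<rho>(3) q by (force simp: mesh_le_def dist_commute)
      ultimately show "\<phi> (?b # \<rho>) = \<psi> (?b # \<rho>)"
        using \<rho>(2) length_faces[OF \<tau>] barycentre_in_hull[OF False]
        by (intro less.prems(3)) auto
    qed
    then show ?thesis
      using False by (simp add: subdiv_rec cong: coboundary_cong)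
  qed
qed

lemma subdiv_funpow_local:
  fixes \<sigma> :: "'a::real_normed_vector list"
  assumes "mesh_le \<sigma> d" "length \<sigma> \<le> Suc m"
    and "\<And>\<tau>. set \<tau> \<subseteq> convex hull (set \<sigma>) \<Longrightarrow> length \<tau> = length \<sigma> \<Longrightarrow>
           mesh_le \<tau> ((real m / real (Suc m)) ^ N * d) \<Longrightarrow> \<phi> \<tau> = \<psi> \<tau>"
  shows "(subdiv ^^ N) \<phi> \<sigma> = (subdiv ^^ N) \<psi> \<sigma>"
  using assms
proof (induction N arbitrary: \<sigma> d)
  case 0
  then show ?case by (auto intro: hull_inc)
next
  case (Suc N)
  have "subdiv ((subdiv ^^ N) \<phi>) \<sigma> = subdiv ((subdiv ^^ N) \<psi>) \<sigma>"
  proof (rule subdiv_local[OF Suc.prems(1,2)])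
    fix \<tau> assume \<tau>: "set \<tau> \<subseteq> convex hull (set \<sigma>)" "length \<tau> = length \<sigma>"
      "mesh_le \<tau> (real m / real (Suc m) * d)"
    show "(subdiv ^^ N) \<phi> \<tau> = (subdiv ^^ N) \<psi> \<tau>"
    proof (rule Suc.IH[OF \<tau>(3)])
      show "length \<tau> \<le> Suc m" using \<tau>(2) Suc.prems(2) by simp
      fix \<rho> assume \<rho>: "set \<rho> \<subseteq> convex hull (set \<tau>)" "length \<rho> = length \<tau>"
        "mesh_le \<rho> ((real m / real (Suc m)) ^ N * (real m / real (Suc m) * d))"
      have "convex hull (set \<tau>) \<subseteq> convex hull (set \<sigma>)"
        using \<tau>(1) by (simp add: hull_minimal)
      then show "\<phi> \<rho> = \<psi> \<rho>"
        using \<rho> \<tau>(2) by (intro Suc.prems(3)) (auto simp: mult_ac)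
    qed
  qed
  then show ?case by simp
qed

lemma subdiv_funpow_coboundary:
  "(subdiv ^^ N) (coboundary \<phi>) \<sigma> = coboundary ((subdiv ^^ N) \<phi>) \<sigma>"
proof (induction N arbitrary: \<sigma>)
  case (Suc N)
  then have "(subdiv ^^ N) (coboundary \<phi>) = coboundary ((subdiv ^^ N) \<phi>)" by blast
  then show ?case by (simp add: subdiv_coboundary)
qed simp

lemma subdiv_funpow_add:
  "(subdiv ^^ N) (\<lambda>\<tau>. \<phi> \<tau> + \<psi> \<tau>) \<sigma> = (subdiv ^^ N) \<phi> \<sigma> + (subdiv ^^ N) \<psi> \<sigma>"
proof (induction N arbitrary: \<sigma>)
  case (Suc N)
  then have "(subdiv ^^ N) (\<lambda>\<tau>. \<phi> \<tau> + \<psi> \<tau>) = (\<lambda>\<sigma>. (subdiv ^^ N) \<phi> \<sigma> + (subdiv ^^ N) \<psi> \<sigma>)" by blast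
  then show ?case by (simp add: subdiv_add)
qed simp

lemma subdiv_funpow_uminus:
  "(subdiv ^^ N) \<phi> (map uminus \<sigma>) = (subdiv ^^ N) (\<lambda>\<tau>. \<phi> (map uminus \<tau>)) \<sigma>"
proof (induction N arbitrary: \<sigma>)
  case (Suc N)
  then have "(\<lambda>\<sigma>. (subdiv ^^ N) \<phi> (map uminus \<sigma>)) = (subdiv ^^ N) (\<lambda>\<tau>. \<phi> (map uminus \<tau>))" by blast
  then show ?case by (simp add: subdiv_uminus)
qed simp

text \<open>Evaluation of a cochain on the chain \<open>c\<^sub>j\<close>, where \<open>c\<^sub>0 = e\<^sub>0\<close> and \<open>c\<^sub>j\<^sub>+\<^sub>1\<close> is the cone over the sum of
  \<open>c\<^sub>j\<close> and its antipode with apex \<open>e\<^sub>j\<^sub>+\<^sub>1\<close>: half of the boundary of the cross polytope.\<close>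

primrec hemisphere :: "(nat \<Rightarrow> 'a::real_vector) \<Rightarrow> nat \<Rightarrow> ('a list \<Rightarrow> bit) \<Rightarrow> bit" where
  "hemisphere e 0 \<phi> = \<phi> [e 0]"
| "hemisphere e (Suc j) \<phi> = hemisphere e j (\<lambda>\<tau>. \<phi> (e (Suc j) # \<tau>))
     + hemisphere e j (\<lambda>\<tau>. \<phi> (e (Suc j) # map uminus \<tau>))"

lemma hemisphere_add:
  "hemisphere e j (\<lambda>\<tau>. \<phi> \<tau> + \<psi> \<tau>) = hemisphere e j \<phi> + hemisphere e j \<psi>"
  by (induction j arbitrary: \<phi> \<psi>) (simp_all add: algebra_simps)

text \<open>The boundary of the hemisphere of dimension j + 1 is the sphere of dimension j: in a
  cone over a cycle, the contributions of the boundary of the base cancel in pairs.\<close>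

lemma hemisphere_coboundary:
  "hemisphere e (Suc j) (coboundary \<phi>) =
     hemisphere e j \<phi> + hemisphere e j (\<lambda>\<tau>. \<phi> (map uminus \<tau>))"
proof (induction j arbitrary: \<phi>)
  case (Suc j)
  let ?\<phi> = "\<lambda>\<tau>. \<phi> (e (Suc (Suc j)) # \<tau>)"
  have [simp]: "map uminus (map uminus \<tau>) = \<tau>" for \<tau> :: "'a list"
    by (induction \<tau>) auto
  have "hemisphere e (Suc (Suc j)) (coboundary \<phi>) =
      hemisphere e (Suc j) (\<lambda>\<tau>. \<phi> \<tau> + coboundary ?\<phi> \<tau>)
      + hemisphere e (Suc j) (\<lambda>\<tau>. \<phi> (map uminus \<tau>) + coboundary (\<lambda>\<rho>. ?\<phi> (map uminus \<rho>)) \<tau>)"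
    by (subst hemisphere.simps) (simp only: coboundary_Cons coboundary_map)
  also have "\<dots> = hemisphere e (Suc j) \<phi> + hemisphere e (Suc j) (\<lambda>\<tau>. \<phi> (map uminus \<tau>))"
    by (simp only: hemisphere_add[of e "Suc j"] Suc.IH) (simp add: algebra_simps)
  finally show ?case .
qed (simp add: algebra_simps)

text \<open>The descending order matches \<open>hemisphere\<close>, where each cone puts its new
  apex in front.\<close>

definition orthant :: "(nat \<Rightarrow> 'a::real_vector) \<Rightarrow> nat \<Rightarrow> nat set \<Rightarrow> 'a list" where
  "orthant e j S = map (\<lambda>i. if i \<in> S then e i else - e i) (rev [0..<Suc j])"

lemma set_orthant: "set (orthant e j S) = (\<lambda>i. if i \<in> S then e i else - e i) ` {..j}"
  by (simp add: orthant_def atLeast0LessThan lessThan_Suc_atMost del: upt_Suc)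

text \<open>All simplices of the hemisphere are orthants; passing to the antipodal base replaces the
  sign set by its complement.\<close>

lemma hemisphere_cong:
  "(\<And>S. \<phi> (orthant e j S) = \<psi> (orthant e j S)) \<Longrightarrow> hemisphere e j \<phi> = hemisphere e j \<psi>"
proof (induction j arbitrary: \<phi> \<psi>)
  case 0
  then show ?case using 0[of "{0}"] by (simp add: orthant_def)
next
  case (Suc j)
  have 1: "e (Suc j) # orthant e j S = orthant e (Suc j) (insert (Suc j) S)" for S
    by (simp add: orthant_def)
  have 2: "e (Suc j) # map uminus (orthant e j S) = orthant e (Suc j) (insert (Suc j) (- S))" for S
    by (simp add: orthant_def)
  show ?case
    unfolding hemisphere.simps
    by (intro arg_cong2[where f = "(+)"] Suc.IH) (simp_all only: 1 2 Suc.prems)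
qed

section \<open>Signed labels and Ky Fan's parity count\<close>

definition flip :: "nat \<times> bool \<Rightarrow> nat \<times> bool" where
  "flip l = (fst l, \<not> snd l)"

lemma fst_flip [simp]: "fst (flip l) = fst l" and snd_flip [simp]: "snd (flip l) = (\<not> snd l)"
  by (simp_all add: flip_def)

text \<open>\<open>alternating n ls = 1\<close> iff the labels, sorted by index, have pairwise distinct indices below
  \<open>n\<close> and alternating signs, the first of them positive (Ky Fan).\<close>

primrec alternating :: "nat \<Rightarrow> (nat \<times> bool) list \<Rightarrow> bit" where
  "alternating 0 ls = of_bool (ls = [])"
| "alternating (Suc n) ls =
     (case filter (\<lambda>l. fst l = n) ls of
        [] \<Rightarrow> alternating n (filter (\<lambda>l. fst l \<noteq> n) ls)
      | [l] \<Rightarrow> of_bool (snd l = even (length (filter (\<lambda>l. fst l \<noteq> n) ls)))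
                 * alternating n (filter (\<lambda>l. fst l \<noteq> n) ls)
      | _ \<Rightarrow> 0)"

text \<open>Pigeonhole: with more labels than indices, some index repeats or is out of range. In top
  dimension this makes the count zero.\<close>

lemma alternating_eq_0: "n < length ls \<Longrightarrow> alternating n ls = 0"
proof (induction n arbitrary: ls)
  case (Suc n)
  have "length (filter (\<lambda>l. fst l = n) ls) + length (filter (\<lambda>l. fst l \<noteq> n) ls) = length ls"
    by (rule sum_length_filter_compl)
  then show ?case
    using Suc by (auto split: list.split)
qed simp

lemma coboundary_mult: "coboundary (\<lambda>\<tau>. c * \<phi> \<tau>) \<sigma> = c * coboundary \<phi> \<sigma>"
  by (simp add: coboundary_def sum_list_const_mult)

lemma coboundary_zero [simp]: "coboundary (\<lambda>\<tau>. 0) \<sigma> = 0"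
  by (simp add: coboundary_def)

text \<open>The local step of Ky Fan's lemma: without complementary labels, the facets that
  alternate starting with plus are counted, modulo 2, by whether the simplex itself alternates
  starting with plus or with minus. The induction splits off the labels of the largest index, which
  all coincide because complementary pairs are excluded.\<close>

lemma coboundary_alternating:
  assumes "\<And>l. l \<in> set ls \<Longrightarrow> fst l < n" "\<And>l. l \<in> set ls \<Longrightarrow> flip l \<notin> set ls"
  shows "coboundary (alternating n) ls = alternating n ls + alternating n (map flip ls)"
  using assms
proof (induction n arbitrary: ls)
  case 0
  then show ?case by (cases ls) auto
next
  case (Suc n)
  let ?P = "\<lambda>l::nat \<times> bool. fst l = n"
  define F :: "(nat \<times> bool) list \<Rightarrow> (nat \<times> bool) list \<Rightarrow> bit"
    where "F = (\<lambda>ts rs. (case ts of [] \<Rightarrow> alternating n rs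
      | [l] \<Rightarrow> of_bool (snd l = even (length rs)) * alternating n rs | _ \<Rightarrow> 0))"
  have alt: "alternating (Suc n) = (\<lambda>ls. F (filter ?P ls) (filter (\<lambda>l. \<not> ?P l) ls))"
    by (simp add: F_def fun_eq_iff)
  define ts rs where "ts = filter ?P ls" and "rs = filter (\<lambda>l. \<not> ?P l) ls"
  have flip_ts: "filter ?P (map flip ls) = map flip ts"
    and flip_rs: "filter (\<lambda>l. \<not> ?P l) (map flip ls) = map flip rs"
    by (simp_all add: ts_def rs_def filter_map comp_def)
  have IH: "coboundary (alternating n) rs = alternating n rs + alternating n (map flip rs)"
    using Suc.prems by (intro Suc.IH) (force simp: rs_def)+
  have cob: "coboundary (alternating (Suc n)) ls = coboundary (\<lambda>\<tau>. F \<tau> rs) ts + coboundary (F ts) rs"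
    unfolding alt ts_def rs_def by (rule coboundary_filter)
  have rhs: "alternating (Suc n) ls + alternating (Suc n) (map flip ls) =
      F ts rs + F (map flip ts) (map flip rs)"
    unfolding alt flip_ts flip_rs by (simp add: ts_def rs_def)
  have same: "l = l'" if "l \<in> set ts" "l' \<in> set ts" for l l'
  proof (rule ccontr)
    assume "l \<noteq> l'"
    then have "l' = flip l"
      using that by (auto simp: ts_def flip_def prod_eq_iff)
    then show False
      using Suc.prems(2)[of l] that by (auto simp: ts_def)
  qed
  show ?case
  proof (cases ts)
    case Nil
    then show ?thesis unfolding cob rhs by (simp add: F_def IH)
  next
    case (Cons l ts')
    show ?thesis
    proof (cases ts')
      case Nil
      \<comment> \<open>Deleting an entry of \<open>rs\<close> changes the parity of its length and
        so negates the sign condition on \<open>l\<close>. With the induction hypothesis, exactly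
        one of the two terms on the right remains.\<close>
      have "coboundary (F ts) rs = of_bool (snd l \<noteq> even (length rs)) * coboundary (alternating n) rs"
        unfolding coboundary_mult[symmetric]
        by (rule coboundary_cong) (auto simp: F_def Cons Nil dest!: length_faces[symmetric])
      then show ?thesis
        unfolding cob rhs by (auto simp: Cons Nil F_def IH)
    next
      case (Cons l' ts'')
      then have "l' = l" using same[of l' l] \<open>ts = l # ts'\<close> by auto
      \<comment> \<open>If the top label occurs twice, deleting either copy leaves the same list,
        and the two contributions cancel modulo 2. If it occurs more often, a repetition survives
        every deletion.\<close>
      then have "coboundary (\<lambda>\<tau>. F \<tau> rs) ts = 0"
        using Cons \<open>ts = l # ts'\<close> by (cases ts'') (auto simp: F_def)
      moreover have "F ts = (\<lambda>_. 0)" "F (map flip ts) = (\<lambda>_. 0)"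
        using Cons \<open>ts = l # ts'\<close> by (auto simp: F_def)
      ultimately show ?thesis unfolding cob rhs by simp
    qed
  qed
qed

text \<open>For independent vectors this is the unit sphere of the l1 norm in their span; in general
  it is a linear image of that sphere.\<close>

definition cross_sphere :: "(nat \<Rightarrow> 'a::real_vector) \<Rightarrow> nat \<Rightarrow> 'a set" where
  "cross_sphere e n = (\<Union>S\<in>Pow {..n}. convex hull (set (orthant e n S)))"

lemma compact_cross_sphere: "compact (cross_sphere (e :: nat \<Rightarrow> 'a::real_normed_vector) n)"
  unfolding cross_sphere_def
  by (intro compact_UN) (auto intro!: finite_imp_compact_convex_hull)

lemma orthant_Int: "orthant e n S = orthant e n (S \<inter> {..n})"
  by (auto simp: orthant_def)

lemma hull_orthant_subset: 
  assumes "j \<le> n"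
  shows "convex hull (set (orthant e j S)) \<subseteq> cross_sphere e n"
proof -
  have "set (orthant e j S) \<subseteq> set (orthant e n S)"
    using assms unfolding set_orthant by (intro image_mono) auto
  then have "convex hull (set (orthant e j S)) \<subseteq> convex hull (set (orthant e n S))"
    by (rule hull_mono)
  also have "\<dots> = convex hull (set (orthant e n (S \<inter> {..n})))"
    using orthant_Int by metis
  also have "\<dots> \<subseteq> cross_sphere e n"
    unfolding cross_sphere_def by (rule UN_upper) simp
  finally show ?thesis .
qed

text \<open>The signs of the orthant are absorbed into the coefficients. Their normalisation later
  excludes the zero polynomial.\<close>

lemma cross_sphereE:
  assumes "x \<in> cross_sphere e n"
  obtains c where "x = (\<Sum>i\<le>n. c i *\<^sub>R e i)" "(\<Sum>i\<le>n. \<bar>c i\<bar>) = 1"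
proof -
  obtain S where x: "x \<in> convex hull ((\<lambda>i. if i \<in> S then e i else - e i) ` {..n})"
    using assms by (auto simp: cross_sphere_def set_orthant)
  let ?v = "\<lambda>i. if i \<in> S then e i else - e i"
  define K where "K = {\<Sum>i\<le>n. u i *\<^sub>R ?v i |u. (\<forall>i\<le>n. 0 \<le> u i) \<and> sum u {..n} = 1}"
  have "convex K"
  proof (rule convexI)
    fix x y and a b :: real
    assume "x \<in> K" "y \<in> K" and ab: "0 \<le> a" "0 \<le> b" "a + b = 1"
    then obtain u w where u: "x = (\<Sum>i\<le>n. u i *\<^sub>R ?v i)" "\<forall>i\<le>n. 0 \<le> u i" "sum u {..n} = 1"
      and w: "y = (\<Sum>i\<le>n. w i *\<^sub>R ?v i)" "\<forall>i\<le>n. 0 \<le> w i" "sum w {..n} = 1"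
      by (auto simp: K_def)
    have "a *\<^sub>R x + b *\<^sub>R y = (\<Sum>i\<le>n. (a * u i + b * w i) *\<^sub>R ?v i)"
      unfolding u(1) w(1) scaleR_sum_right sum.distrib[symmetric]
      by (intro sum.cong refl) (simp add: scaleR_add_left scaleR_diff_left)
    moreover have "(\<Sum>i\<le>n. a * u i + b * w i) = 1"
      using u(3) w(3) ab(3) by (simp add: sum.distrib sum_distrib_left[symmetric])
    ultimately show "a *\<^sub>R x + b *\<^sub>R y \<in> K"
      using u(2) w(2) ab unfolding K_def
      by (intro CollectI exI[of _ "\<lambda>i. a * u i + b * w i"]) auto
  qed
  moreover have "?v ` {..n} \<subseteq> K"
  proof safe
    fix k assume k: "k \<le> n"
    have "?v k = (\<Sum>i\<le>n. of_bool (i = k) *\<^sub>R ?v i)"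
      using k by (subst sum.mono_neutral_right[of _ "{k}"]) auto
    moreover have "(\<Sum>i\<le>n. of_bool (i = k) :: real) = 1"
      using k by (subst sum.mono_neutral_right[of _ "{k}"]) auto
    ultimately show "?v k \<in> K"
      unfolding K_def by (intro CollectI exI[of _ "\<lambda>i. of_bool (i = k)"]) auto
  qed
  ultimately have "x \<in> K"
    using x hull_minimal[of "?v ` {..n}" K convex] by blast
  then obtain u where u: "\<And>i. i \<le> n \<Longrightarrow> 0 \<le> u i" "sum u {..n} = 1" "x = (\<Sum>i\<le>n. u i *\<^sub>R ?v i)"
    by (auto simp: K_def)
  show thesis
  proof (rule that[of "\<lambda>i. if i \<in> S then u i else - u i"])
    show "x = (\<Sum>i\<le>n. (if i \<in> S then u i else - u i) *\<^sub>R e i)"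
      unfolding u(3) by (intro sum.cong) auto
    have "(\<Sum>i\<le>n. \<bar>if i \<in> S then u i else - u i\<bar>) = sum u {..n}"
      using u(1) by (intro sum.cong) auto
    then show "(\<Sum>i\<le>n. \<bar>if i \<in> S then u i else - u i\<bar>) = 1" using u(2) by simp
  qed
qed

text \<open>Without a common zero, label each point by a dominant component and its sign. On a fine
  subdivision the parity of alternating simplices is then the same in all dimensions: it is 1 in
  dimension 0, by the empty simplex, and 0 in dimension \<open>n\<close>, where n + 1 vertices share
  n indices.\<close>

theorem Borsuk_Ulam_cross_sphere:
  fixes e :: "nat \<Rightarrow> 'a::real_normed_vector" and g :: "nat \<Rightarrow> 'a \<Rightarrow> real"
  assumes cont: "\<And>i. i < n \<Longrightarrow> continuous_on (cross_sphere e n) (g i)"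
    and odd: "\<And>i x. i < n \<Longrightarrow> x \<in> cross_sphere e n \<Longrightarrow> g i (- x) = - g i x"
  shows "\<exists>x\<in>cross_sphere e n. \<forall>i<n. g i x = 0"
proof (rule ccontr)
  assume "\<not> ?thesis"
  then have nz: "\<exists>i<n. g i x \<noteq> 0" if "x \<in> cross_sphere e n" for x
    using that by blast
  let ?X = "cross_sphere e n"
  have "e 0 \<in> ?X"
    using hull_orthant_subset[of 0 n e "{0}"] by (auto simp: orthant_def)
  then have n: "n > 0" using nz[of "e 0"] by auto
  define M where "M = (\<lambda>x. Max ((\<lambda>i. \<bar>g i x\<bar>) ` {..<n}))"
  have M_ge: "\<bar>g i x\<bar> \<le> M x" if "i < n" for i x
    using that by (auto simp: M_def)
  have "\<exists>i<n. \<bar>g i x\<bar> = M x" for x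
  proof -
    have "M x \<in> (\<lambda>i. \<bar>g i x\<bar>) ` {..<n}"
      unfolding M_def using n by (intro Max_in) auto
    then show ?thesis by auto
  qed
  \<comment> \<open>Breaking ties by the least index makes the choice depend on the absolute values
    only, so that the antipodal map changes nothing but the sign of the label.\<close>
  define ix where "ix = (\<lambda>x. LEAST i. i < n \<and> \<bar>g i x\<bar> = M x)"
  have ix: "ix x < n" "\<bar>g (ix x) x\<bar> = M x" for x
    using LeastI_ex[OF \<open>\<And>x. \<exists>i<n. \<bar>g i x\<bar> = M x\<close>[of x]] by (auto simp: ix_def)
  define lab where "lab = (\<lambda>x. (ix x, g (ix x) x > 0))"
  have M_pos: "0 < M x" if "x \<in> ?X" for x
    using nz[OF that] M_ge[of _ x] by (metis abs_le_zero_iff dual_order.trans not_less)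
  have abs_uminus: "\<bar>g i (- x)\<bar> = \<bar>g i x\<bar>" if "i < n" "x \<in> ?X" for i x
    using odd[OF that] by simp
  have M_uminus: "M (- x) = M x" if "x \<in> ?X" for x
    unfolding M_def using abs_uminus[OF _ that] by (intro arg_cong[where f = Max] image_cong) auto
  have ix_uminus: "ix (- x) = ix x" if "x \<in> ?X" for x
    unfolding ix_def M_uminus[OF that] using abs_uminus[OF _ that]
    by (intro arg_cong[where f = Least]) auto
  have lab_uminus: "lab (- x) = flip (lab x)" if "x \<in> ?X" for x
    using ix[of x] M_pos[OF that] odd[OF ix(1) that] ix_uminus[OF that]
    by (auto simp: lab_def flip_def)
  have contM: "continuous_on ?X M"
  proof -
    have "continuous_on ?X (\<lambda>x. Max ((\<lambda>i. \<bar>g i x\<bar>) ` {..<k}))" if "0 < k" "k \<le> n" for k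
      using that
    proof (induction k)
      case (Suc k)
      show ?case
      proof (cases "k = 0")
        case True
        then show ?thesis using cont[of 0] n by (simp add: lessThan_Suc continuous_on_rabs)
      next
        case False
        have eq: "(\<lambda>x. Max ((\<lambda>i. \<bar>g i x\<bar>) ` {..<Suc k})) = (\<lambda>x. max \<bar>g k x\<bar> (Max ((\<lambda>i. \<bar>g i x\<bar>) ` {..<k})))"
        proof
          fix x show "Max ((\<lambda>i. \<bar>g i x\<bar>) ` {..<Suc k}) = max \<bar>g k x\<bar> (Max ((\<lambda>i. \<bar>g i x\<bar>) ` {..<k}))"
            unfolding lessThan_Suc image_insert using False by (intro Max_insert) auto
        qed
        show ?thesis
          unfolding eq using Suc False cont[of k]
          by (intro continuous_on_max continuous_on_rabs) auto
      qed
    qed simp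
    then show ?thesis using n by (simp add: M_def[abs_def])
  qed
  obtain \<mu> where \<mu>: "0 < \<mu>" "\<And>x. x \<in> ?X \<Longrightarrow> \<mu> \<le> M x"
  proof -
    obtain x0 where "x0 \<in> ?X" "\<And>x. x \<in> ?X \<Longrightarrow> M x0 \<le> M x"
      using continuous_attains_inf[OF compact_cross_sphere _ contM] \<open>e 0 \<in> ?X\<close> by blast
    then show thesis using that[of "M x0"] M_pos by blast
  qed
  have "\<exists>d>0. \<forall>x\<in>?X. \<forall>y\<in>?X. dist y x < d \<longrightarrow> dist (g i y) (g i x) < \<mu>" if "i < n" for i
    using compact_uniformly_continuous[OF cont[OF that] compact_cross_sphere] \<mu>(1)
    unfolding uniformly_continuous_on_def by blast
  then obtain dd where dd: "\<And>i. i < n \<Longrightarrow> 0 < dd i"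
    "\<And>i x y. i < n \<Longrightarrow> x \<in> ?X \<Longrightarrow> y \<in> ?X \<Longrightarrow> dist y x < dd i \<Longrightarrow> dist (g i y) (g i x) < \<mu>"
    by metis
  define d where "d = Min (dd ` {..<n})"
  have "dd ` {..<n} \<noteq> {}" using n by auto
  then have d: "0 < d" using dd(1) by (simp add: d_def)
  \<comment> \<open>Complementary labels on x and y would give one component opposite signs and
    absolute values at least \<mu> at points where it differs by less than \<mu>.\<close>
  have compl: "flip (lab x) \<noteq> lab y" if "x \<in> ?X" "y \<in> ?X" "dist x y < d" for x y
  proof
    assume eq: "flip (lab x) = lab y"
    then have i: "ix y = ix x" and s: "(g (ix x) x > 0) \<longleftrightarrow> \<not> (g (ix x) y > 0)"
      unfolding lab_def flip_def prod_eq_iff by auto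
    have "d \<le> dd (ix x)" unfolding d_def using ix(1) by simp
    then have "dist (g (ix x) x) (g (ix x) y) < \<mu>"
      using dd(2)[OF ix(1) that(2,1), of x] that(3) by simp
    moreover have "\<bar>g (ix x) x\<bar> \<ge> \<mu>" "\<bar>g (ix x) y\<bar> \<ge> \<mu>"
      using ix(2)[of x] ix(2)[of y] i \<mu>(2)[OF that(1)] \<mu>(2)[OF that(2)] by simp_all
    ultimately show False using s \<mu>(1) unfolding dist_real_def by linarith
  qed
  obtain D where D: "\<And>x y. x \<in> ?X \<Longrightarrow> y \<in> ?X \<Longrightarrow> dist x y \<le> D"
    using compact_imp_bounded[OF compact_cross_sphere[of e n]] unfolding bounded_two_points by blast
  have "\<exists>N. (real n / real (Suc n)) ^ N * max D 1 < d"
  proof -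
    have "(\<lambda>N. (real n / real (Suc n)) ^ N * max D 1) \<longlonglongrightarrow> 0 * max D 1"
      by (intro tendsto_mult LIMSEQ_realpow_zero tendsto_const) auto
    then have "\<forall>\<^sub>F N in sequentially. (real n / real (Suc n)) ^ N * max D 1 < d"
      using d by (intro order_tendstoD(2)) auto
    then show ?thesis by (auto simp: eventually_sequentially)
  qed
  then obtain N where N: "(real n / real (Suc n)) ^ N * max D 1 < d" by blast
  define \<alpha> where "\<alpha> = (\<lambda>\<sigma>. alternating n (map lab \<sigma>))"
  define A where "A = (subdiv ^^ N) \<alpha>"
  \<comment> \<open>The mesh bound is the average of \<open>d\<close> and the mesh reached after
    \<open>N\<close> subdivisions: the subdivision satisfies it, and it is still strictly below
    \<open>d\<close>.\<close>
  have loc: "(subdiv ^^ N) \<phi> (orthant e j S) = (subdiv ^^ N) \<psi> (orthant e j S)"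
    if j: "j \<le> n" and eq: "\<And>\<tau>. set \<tau> \<subseteq> ?X \<Longrightarrow> length \<tau> = Suc j \<Longrightarrow> mesh_le \<tau> (d / 2 + (real n / real (Suc n)) ^ N * max D 1 / 2) \<Longrightarrow> \<phi> \<tau> = \<psi> \<tau>"
    for j S \<phi> \<psi>
  proof (rule subdiv_funpow_local[where d = "max D 1" and m = n])
    have "set (orthant e j S) \<subseteq> ?X"
      using hull_orthant_subset[OF j, of e S] by (meson hull_subset subset_trans)
    then show "mesh_le (orthant e j S) (max D 1)"
      unfolding mesh_le_def using D by (meson le_max_iff_disj subsetD)
    show "length (orthant e j S) \<le> Suc n" using j by (simp add: orthant_def)
    fix \<tau> assume "set \<tau> \<subseteq> convex hull set (orthant e j S)" "length \<tau> = length (orthant e j S)"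
      "mesh_le \<tau> ((real n / real (Suc n)) ^ N * max D 1)"
    moreover have "(real n / real (Suc n)) ^ N * max D 1
        \<le> d / 2 + (real n / real (Suc n)) ^ N * max D 1 / 2"
      using N by linarith
    ultimately show "\<phi> \<tau> = \<psi> \<tau>"
      using hull_orthant_subset[OF j, of e S]
      by (intro eq) (auto simp: orthant_def mesh_le_def simp del: upt_Suc intro: order_trans)
  qed
  have \<alpha>_cob: "coboundary \<alpha> \<tau> = \<alpha> \<tau> + \<alpha> (map uminus \<tau>)"
    if \<tau>: "set \<tau> \<subseteq> ?X" "mesh_le \<tau> (d / 2 + (real n / real (Suc n)) ^ N * max D 1 / 2)" for \<tau>
  proof -
    have "coboundary \<alpha> \<tau> = coboundary (alternating n) (map lab \<tau>)"
      by (simp add: \<alpha>_def coboundary_map)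
    also have "\<dots> = alternating n (map lab \<tau>) + alternating n (map flip (map lab \<tau>))"
    proof (rule coboundary_alternating)
      show "fst l < n" if "l \<in> set (map lab \<tau>)" for l
        using that ix(1) by (auto simp: lab_def)
      show "flip l \<notin> set (map lab \<tau>)" if "l \<in> set (map lab \<tau>)" for l
      proof
        assume "flip l \<in> set (map lab \<tau>)"
        then obtain x y where xy: "x \<in> set \<tau>" "y \<in> set \<tau>" "flip (lab x) = lab y"
          using \<open>l \<in> set (map lab \<tau>)\<close> by auto
        have "dist x y \<le> d / 2 + (real n / real (Suc n)) ^ N * max D 1 / 2"
          using \<tau>(2) xy(1,2) unfolding mesh_le_def by blast
        also have "\<dots> < d" using N by simp
        finally show False using compl[of x y] xy \<tau>(1) by blast
      qed
    qed
    also have "map flip (map lab \<tau>) = map lab (map uminus \<tau>)"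
      using lab_uminus \<tau>(1) by auto
    finally show ?thesis by (simp add: \<alpha>_def)
  qed
  \<comment> \<open>\<open>B\<close> counts the alternating simplices of either sign. It agrees with
    a coboundary on every orthant and is the sum of \<open>A\<close> and its antipode; the first
    fact admits \<open>hemisphere_coboundary\<close>, the second recognises the result as the same
    count one dimension lower.\<close>
  define B where "B = (\<lambda>\<tau>. A \<tau> + A (map uminus \<tau>))"
  have AB: "coboundary A (orthant e j S) = B (orthant e j S)" if "j \<le> n" for j S
  proof -
    have "coboundary A (orthant e j S) = (subdiv ^^ N) (coboundary \<alpha>) (orthant e j S)"
      by (simp add: A_def subdiv_funpow_coboundary)
    also have "\<dots> = (subdiv ^^ N) (\<lambda>\<tau>. \<alpha> \<tau> + \<alpha> (map uminus \<tau>)) (orthant e j S)"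
      using that by (rule loc) (rule \<alpha>_cob)
    also have "\<dots> = B (orthant e j S)"
      by (simp add: subdiv_funpow_add subdiv_funpow_uminus A_def B_def)
    finally show ?thesis .
  qed
  have step: "hemisphere e (Suc j) B = hemisphere e j B" if "Suc j \<le> n" for j
  proof -
    have "hemisphere e (Suc j) B = hemisphere e (Suc j) (coboundary A)"
      by (rule hemisphere_cong) (simp add: AB that)
    also have "\<dots> = hemisphere e j B"
      unfolding hemisphere_coboundary B_def hemisphere_add ..
    finally show ?thesis .
  qed
  have "hemisphere e j B = 1" if "j \<le> n" for j
    using that
  proof (induction j)
    case 0
    have "orthant e 0 {0} = [e 0]" by (simp add: orthant_def)
    then have "hemisphere e 0 B = coboundary A [e 0]"
      using AB[of 0 "{0}"] by simp
    \<comment> \<open>The only face of a vertex is the empty simplex of the augmented complex, whose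
      empty label list counts as alternating.\<close>
    also have "\<dots> = A []" by simp
    also have "\<dots> = \<alpha> []"
    proof -
      have "(subdiv ^^ k) \<alpha> [] = \<alpha> []" for k by (induction k) auto
      then show ?thesis by (simp add: A_def)
    qed
    also have "\<dots> = 1"
    proof -
      have "alternating k [] = 1" for k by (induction k) auto
      then show ?thesis by (simp add: \<alpha>_def)
    qed
    finally show ?case .
  next
    case (Suc j)
    then show ?case using step[of j] by simp
  qed
  then have "hemisphere e n B = 1" by blast
  moreover have "hemisphere e n B = hemisphere e n (\<lambda>_. 0)"
  proof (rule hemisphere_cong)
    fix S
    have "B (orthant e n S) = (subdiv ^^ N) (\<lambda>\<tau>. \<alpha> \<tau> + \<alpha> (map uminus \<tau>)) (orthant e n S)"
      by (simp add: subdiv_funpow_add subdiv_funpow_uminus A_def B_def)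
    \<comment> \<open>A simplex of dimension \<open>n\<close> has n + 1 labels with only
      \<open>n\<close> available indices.\<close>
    also have "\<dots> = (subdiv ^^ N) (\<lambda>\<tau>. 0) (orthant e n S)"
      by (rule loc) (auto simp: \<alpha>_def alternating_eq_0)
    also have "\<dots> = 0"
    proof -
      have "subdiv (\<lambda>\<tau>. 0) \<sigma> = 0" for \<sigma> :: "'a list"
        using subdiv_add[of "\<lambda>_. 0" "\<lambda>_. 0" \<sigma>] by simp
      then have "subdiv (\<lambda>\<tau>. 0) = (\<lambda>\<tau> :: 'a list. 0)" by blast
      then have "(subdiv ^^ k) (\<lambda>\<tau>. 0) = (\<lambda>\<tau> :: 'a list. 0)" for k
        by (induction k) simp_all
      then show ?thesis by (rule fun_cong)
    qed
    finally show "B (orthant e n S) = 0" .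
  qed
  moreover have "hemisphere e k (\<lambda>_. 0) = 0" for k by (induction k) simp_all
  ultimately show False by (metis zero_neq_one)
qed

section \<open>Small critical points of even functionals\<close>

text \<open>Only semidefinite, because the bending energy does not see a continuous function outside
  {0..T}.\<close>

locale semi_inner =
  fixes B :: "'a::real_normed_vector \<Rightarrow> 'a \<Rightarrow> real"
  assumes bounded_bilinear: "bounded_bilinear B"
    and symmetric: "B x y = B y x"
    and nonneg: "0 \<le> B x x"
begin

sublocale bounded_bilinear B by (rule bounded_bilinear)

definition nrm :: "'a \<Rightarrow> real" where "nrm x = sqrt (B x x)"

lemma nrm_ge_0 [simp]: "0 \<le> nrm x" and nrm_square: "(nrm x)\<^sup>2 = B x x"
  by (simp_all add: nrm_def nonneg)

lemma nrm_0 [simp]: "nrm 0 = 0"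
  by (simp add: nrm_def zero_left)

lemma nrm_minus [simp]: "nrm (- x) = nrm x"
  by (simp add: nrm_def minus_left minus_right)

lemma nrm_minus_commute: "nrm (x - y) = nrm (y - x)"
  using nrm_minus[of "x - y"] by simp

lemma nrm_scaleR: "nrm (a *\<^sub>R x) = \<bar>a\<bar> * nrm x"
proof -
  have "B (a *\<^sub>R x) (a *\<^sub>R x) = a\<^sup>2 * B x x"
    by (simp add: scaleR_left scaleR_right power2_eq_square)
  then show ?thesis by (simp add: nrm_def real_sqrt_mult)
qed

lemma Cauchy_Schwarz: "\<bar>B x y\<bar> \<le> nrm x * nrm y"
proof -
  have q: "0 \<le> B x x + 2 * t * B x y + t\<^sup>2 * B y y" for t
    using nonneg[of "x + t *\<^sub>R y"] symmetric[of y x]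
    by (simp add: add_left add_right scaleR_left scaleR_right power2_eq_square algebra_simps)
  have "(B x y)\<^sup>2 \<le> B x x * B y y"
  proof (cases "B y y = 0")
    case True
    have "B x y = 0"
    proof (rule ccontr)
      assume "B x y \<noteq> 0"
      \<comment> \<open>With \<open>B y y = 0\<close> the quadratic polynomial is affine in t, and
        this t gives it the value -1.\<close>
      then show False
        using q[of "- (B x x + 1) / (2 * B x y)"] True by (simp add: field_simps)
    qed
    then show ?thesis using True by simp
  next
    case False
    then have "0 < B y y" using nonneg[of y] by simp
    then show ?thesis
      using q[of "- B x y / B y y"] by (simp add: field_simps power2_eq_square)
  qed
  then have "sqrt ((B x y)\<^sup>2) \<le> sqrt (B x x * B y y)" by (rule real_sqrt_le_mono)
  then show ?thesis by (simp only: nrm_def real_sqrt_mult[symmetric] real_sqrt_abs)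
qed

lemma nrm_triangle: "nrm (x + y) \<le> nrm x + nrm y"
proof (rule power2_le_imp_le)
  have "(nrm (x + y))\<^sup>2 = (nrm x)\<^sup>2 + 2 * B x y + (nrm y)\<^sup>2"
    using symmetric[of y x] by (simp add: nrm_square add_left add_right)
  also have "\<dots> \<le> (nrm x + nrm y)\<^sup>2"
    using Cauchy_Schwarz[of x y] by (simp add: power2_sum)
  finally show "(nrm (x + y))\<^sup>2 \<le> (nrm x + nrm y)\<^sup>2" .
qed simp

lemma nrm_triangle_sub: "nrm x \<le> nrm y + nrm (x - y)"
  using nrm_triangle[of y "x - y"] by simp

lemma nrm_diff_triangle: "nrm (x - y) \<le> nrm x + nrm y"
  using nrm_triangle[of x "- y"] by simp

lemma nrm_le_norm: "\<exists>K>0. \<forall>x. nrm x \<le> K * norm x"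
proof -
  obtain K where K: "0 < K" "\<And>x y. norm (B x y) \<le> norm x * norm y * K"
    using pos_bounded by blast
  have "nrm x \<le> sqrt K * norm x" for x
  proof (rule power2_le_imp_le)
    show "(nrm x)\<^sup>2 \<le> (sqrt K * norm x)\<^sup>2"
      using K(2)[of x x] K(1) nonneg[of x]
      by (simp add: nrm_square power_mult_distrib power2_eq_square[of "norm x"] mult.commute)
  qed (use K(1) in simp)
  then show ?thesis using K(1) by (intro exI[of _ "sqrt K"]) simp
qed

end

text \<open>\<open>A\<close> is uniformly continuous and compact from the seminorm
  \<open>nrm\<close> into the norm. Limits are taken only of values of \<open>A\<close>, in the
  norm, where \<open>V\<close> is closed. The derivative of \<Psi> is uniform in the base point, so
  that one step length suits a whole ball.\<close>

locale compact_gradient = semi_inner B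
  for B :: "'a::real_normed_vector \<Rightarrow> 'a \<Rightarrow> real" +
  fixes V :: "'a set" and A :: "'a \<Rightarrow> 'a" and \<Psi> :: "'a \<Rightarrow> real"
  assumes subspace_V: "subspace V" and closed_V: "closed V"
    and A_V: "x \<in> V \<Longrightarrow> A x \<in> V"
    and A_odd: "x \<in> V \<Longrightarrow> A (- x) = - A x"
    and A_unif: "0 < \<epsilon> \<Longrightarrow> \<exists>\<kappa>>0. \<forall>x\<in>V. \<forall>y\<in>V. nrm (x - y) \<le> \<kappa> \<longrightarrow> norm (A x - A y) \<le> \<epsilon>"
    and A_compact: "(\<And>n. f n \<in> V) \<Longrightarrow> (\<And>n. nrm (f n) \<le> R) \<Longrightarrow>
       \<exists>l k. strict_mono (k :: nat \<Rightarrow> nat) \<and> (\<lambda>n. A (f (k n))) \<longlonglongrightarrow> l"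
    and \<Psi>_0: "\<Psi> 0 = 0"
    and \<Psi>_even: "x \<in> V \<Longrightarrow> \<Psi> (- x) = \<Psi> x"
    and \<Psi>_deriv: "0 < \<epsilon> \<Longrightarrow>
       \<exists>\<kappa>>0. \<forall>x\<in>V. \<forall>d\<in>V. nrm d \<le> \<kappa> \<longrightarrow> \<bar>\<Psi> (x + d) - \<Psi> x - B (A x) d\<bar> \<le> \<epsilon> * nrm d"
begin

definition energy :: "'a \<Rightarrow> real" where "energy x = B x x / 2 - \<Psi> x"

lemma V_diff: "x \<in> V \<Longrightarrow> y \<in> V \<Longrightarrow> x - y \<in> V"
  and V_scaleR: "x \<in> V \<Longrightarrow> c *\<^sub>R x \<in> V"
  and V_0: "0 \<in> V"
  using subspace_V by (auto simp: subspace_diff subspace_scale subspace_0)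

lemma A_0: "A 0 = 0"
proof -
  have "A 0 = - A 0" using A_odd[OF V_0] by simp
  then have "2 *\<^sub>R A 0 = 0" by (simp only: scaleR_2 eq_neg_iff_add_eq_0)
  then show ?thesis by simp
qed

lemma energy_even: "x \<in> V \<Longrightarrow> energy (- x) = energy x"
  by (simp add: energy_def minus_left minus_right \<Psi>_even)

lemma continuous_A: "continuous_on V A"
  unfolding continuous_on_iff
proof safe
  fix x and e :: real assume x: "x \<in> V" and e: "0 < e"
  obtain \<kappa> where \<kappa>: "\<kappa> > 0" "\<And>x y. x \<in> V \<Longrightarrow> y \<in> V \<Longrightarrow> nrm (x - y) \<le> \<kappa> \<Longrightarrow> norm (A x - A y) \<le> e / 2"
    using A_unif[of "e / 2"] e by auto
  obtain K where K: "K > 0" "\<And>x. nrm x \<le> K * norm x" using nrm_le_norm by blast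
  show "\<exists>d>0. \<forall>x'\<in>V. dist x' x < d \<longrightarrow> dist (A x') (A x) < e"
  proof (intro exI[of _ "\<kappa> / K"] conjI ballI impI)
    show "0 < \<kappa> / K" using \<kappa>(1) K(1) by simp
    fix y assume y: "y \<in> V" "dist y x < \<kappa> / K"
    have "nrm (y - x) \<le> \<kappa>"
      using K(2)[of "y - x"] y(2) K(1) by (simp add: dist_norm field_simps)
    then show "dist (A y) (A x) < e"
      using \<kappa>(2)[OF y(1) x] e by (simp add: dist_norm)
  qed
qed

lemma continuous_\<Psi>: "continuous_on V \<Psi>"
  unfolding continuous_on_iff
proof safe
  fix x and e :: real assume x: "x \<in> V" and e: "0 < e"
  obtain \<kappa> where \<kappa>: "\<kappa> > 0" "\<And>d. d \<in> V \<Longrightarrow> nrm d \<le> \<kappa> \<Longrightarrow> \<bar>\<Psi> (x + d) - \<Psi> x - B (A x) d\<bar> \<le> 1 * nrm d"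
    using \<Psi>_deriv[of 1] x by auto
  obtain K where K: "K > 0" "\<And>x. nrm x \<le> K * norm x" using nrm_le_norm by blast
  define L where "L = nrm (A x) + 1"
  have L: "L > 0" unfolding L_def using nrm_ge_0[of "A x"] by linarith
  show "\<exists>d>0. \<forall>x'\<in>V. dist x' x < d \<longrightarrow> dist (\<Psi> x') (\<Psi> x) < e"
  proof (intro exI[of _ "min \<kappa> (e / L) / K"] conjI ballI impI)
    show "0 < min \<kappa> (e / L) / K" using \<kappa>(1) K(1) L e by simp
    fix y assume y: "y \<in> V" "dist y x < min \<kappa> (e / L) / K"
    have "K * norm (y - x) < min \<kappa> (e / L)"
      using y(2) K(1) by (simp add: dist_norm pos_less_divide_eq mult.commute)
    then have n: "nrm (y - x) < min \<kappa> (e / L)" using K(2)[of "y - x"] by linarith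
    then have "\<bar>\<Psi> y - \<Psi> x - B (A x) (y - x)\<bar> \<le> nrm (y - x)"
      using \<kappa>(2)[of "y - x"] V_diff[OF y(1) x] by simp
    then have "\<bar>\<Psi> y - \<Psi> x\<bar> \<le> L * nrm (y - x)"
      using Cauchy_Schwarz[of "A x" "y - x"] unfolding L_def by (simp add: algebra_simps)
    also have "\<dots> < e" using n L by (simp add: pos_less_divide_eq mult.commute)
    finally show "dist (\<Psi> y) (\<Psi> x) < e" by (simp add: dist_real_def)
  qed
qed

lemma continuous_energy: "continuous_on V energy"
  unfolding energy_def[abs_def]
  by (intro continuous_on_diff continuous_on_divide continuous_on continuous_on_id
      continuous_\<Psi> continuous_on_const) auto

text \<open>Otherwise some sequence in the ball has unbounded gradients, although its images under
  \<open>A\<close> converge, hence stay bounded, along a subsequence.\<close>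

lemma gradient_bounded: "\<exists>M>0. \<forall>z\<in>V. nrm z \<le> R \<longrightarrow> nrm (z - A z) \<le> M"
proof (rule ccontr)
  assume neg: "\<not> ?thesis"
  have "\<exists>z\<in>V. nrm z \<le> R \<and> real n + 1 < nrm (z - A z)" for n :: nat
    using neg by (meson not_le of_nat_0_le_iff add_nonneg_pos zero_less_one)
  then obtain f where f: "\<And>n. f n \<in> V" "\<And>n. nrm (f n) \<le> R" "\<And>n. real n + 1 < nrm (f n - A (f n))"
    by metis
  obtain l k where k: "strict_mono (k :: nat \<Rightarrow> nat)" "(\<lambda>n. A (f (k n))) \<longlonglongrightarrow> l"
    using A_compact[of f R] f(1,2) by blast
  obtain K where K: "K > 0" "\<And>x. nrm x \<le> K * norm x" using nrm_le_norm by blast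
  obtain C where C: "\<And>n. norm (A (f (k n))) \<le> C"
    using convergent_imp_bounded[OF k(2)] by (auto simp: bounded_iff)
  obtain n :: nat where n: "R + K * C < real n" using reals_Archimedean2 by blast
  have "real n \<le> real (k n)" using seq_suble[OF k(1)] by simp
  also have "\<dots> < nrm (f (k n)) + nrm (A (f (k n)))"
    using f(3)[of "k n"] nrm_diff_triangle[of "f (k n)" "A (f (k n))"] by linarith
  also have "\<dots> \<le> R + K * C"
    using f(2)[of "k n"] K(2)[of "A (f (k n))"] mult_left_mono[OF C[of n], of K] K(1) by linarith
  finally show False using n by linarith
qed

text \<open>The Palais--Smale property; \<open>z - A z\<close> is the gradient of the energy.\<close>

lemma gradient_gap:
  assumes no_fix: "\<And>z. z \<in> V \<Longrightarrow> 0 < nrm z \<Longrightarrow> nrm z \<le> r \<Longrightarrow> A z \<noteq> z" and \<rho>: "0 < \<rho>"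
  shows "\<exists>\<nu>>0. \<forall>z\<in>V. \<rho> \<le> nrm z \<and> nrm z \<le> r \<longrightarrow> \<nu> \<le> nrm (z - A z)"
proof (rule ccontr)
  assume neg: "\<not> ?thesis"
  have "\<exists>z\<in>V. \<rho> \<le> nrm z \<and> nrm z \<le> r \<and> nrm (z - A z) < inverse (real (Suc n))" for n
    using neg by (meson not_le inverse_positive_iff_positive of_nat_0_less_iff zero_less_Suc)
  then obtain f where f: "\<And>n. f n \<in> V" "\<And>n. \<rho> \<le> nrm (f n)" "\<And>n. nrm (f n) \<le> r"
    "\<And>n. nrm (f n - A (f n)) < inverse (real (Suc n))"
    by metis
  obtain l k where k: "strict_mono (k :: nat \<Rightarrow> nat)" and l: "(\<lambda>n. A (f (k n))) \<longlonglongrightarrow> l"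
    using A_compact[of f r] f(1,3) by blast
  have lV: "l \<in> V"
    using closed_sequentially[OF closed_V _ l] A_V f(1) by blast
  obtain K where K: "K > 0" "\<And>x. nrm x \<le> K * norm x" using nrm_le_norm by blast
  \<comment> \<open>The gradients tend to 0, so \<open>f (k n)\<close> follows
    \<open>A (f (k n))\<close> to \<open>l\<close> in the seminorm. Applying \<open>A\<close> once
    more returns to the norm and identifies \<open>l\<close> as a fixed point.\<close>
  have conv: "(\<lambda>n. nrm (f (k n) - l)) \<longlonglongrightarrow> 0"
  proof (rule tendsto_sandwich[OF _ _ tendsto_const])
    show "\<forall>\<^sub>F n in sequentially. 0 \<le> nrm (f (k n) - l)" by simp
    have "nrm (f (k n) - l) \<le> inverse (real (Suc (k n))) + K * norm (A (f (k n)) - l)" for n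
      using nrm_triangle[of "f (k n) - A (f (k n))" "A (f (k n)) - l"] f(4)[of "k n"]
        K(2)[of "A (f (k n)) - l"] by simp
    then show "\<forall>\<^sub>F n in sequentially. nrm (f (k n) - l) \<le>
        inverse (real (Suc (k n))) + K * norm (A (f (k n)) - l)" by simp
    have "(\<lambda>n. inverse (real (Suc (k n))) + K * norm (A (f (k n)) - l)) \<longlonglongrightarrow> 0 + K * 0"
      using LIMSEQ_subseq_LIMSEQ[OF LIMSEQ_inverse_real_of_nat k] l
      by (intro tendsto_add tendsto_mult tendsto_const) (auto simp: o_def tendsto_norm_zero_iff LIM_zero)
    then show "(\<lambda>n. inverse (real (Suc (k n))) + K * norm (A (f (k n)) - l)) \<longlonglongrightarrow> 0" by simp
  qed
  have "(\<lambda>n. A (f (k n))) \<longlonglongrightarrow> A l"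
    unfolding lim_sequentially
  proof safe
    fix e :: real assume e: "0 < e"
    obtain \<kappa> where \<kappa>: "\<kappa> > 0" "\<And>x y. x \<in> V \<Longrightarrow> y \<in> V \<Longrightarrow> nrm (x - y) \<le> \<kappa> \<Longrightarrow> norm (A x - A y) \<le> e / 2"
      using A_unif[of "e / 2"] e by auto
    obtain no where "\<And>n. n \<ge> no \<Longrightarrow> nrm (f (k n) - l) < \<kappa>"
      using order_tendstoD(2)[OF conv \<kappa>(1)] by (auto simp: eventually_sequentially)
    then have "dist (A (f (k n))) (A l) < e" if "n \<ge> no" for n
      using \<kappa>(2)[OF f(1) lV, of "k n"] that e by (force simp: dist_norm)
    then show "\<exists>no. \<forall>n\<ge>no. dist (A (f (k n))) (A l) < e" by blast
  qed
  then have Al: "A l = l" using l LIMSEQ_unique by blast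
  have "\<bar>nrm (f (k n)) - nrm l\<bar> \<le> nrm (f (k n) - l)" for n
    using nrm_triangle_sub[of "f (k n)" l] nrm_triangle_sub[of l "f (k n)"] nrm_minus_commute[of l "f (k n)"]
    by linarith
  then have "(\<lambda>n. nrm (f (k n))) \<longlonglongrightarrow> nrm l"
    using Lim_null_comparison[OF _ conv, of "\<lambda>n. nrm (f (k n)) - nrm l"]
    by (intro LIM_zero_cancel[of _ "nrm l"]) simp
  then have "\<rho> \<le> nrm l" "nrm l \<le> r"
    using f(2,3) by (auto intro: LIMSEQ_le_const LIMSEQ_le_const2)
  then show False using no_fix[OF lV] \<rho> Al by linarith
qed

text \<open>With n the seminorm of the gradient, a step changes the energy by -s n^2 + s^2 n^2 / 2
  plus the remainder of \<Psi>. As s is at most 1/2, the second term is at most s n^2 / 4; as \<nu>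
  is at most n, so is the remainder. Half of the decrease is left. The bound \<kappa> / M keeps the
  step within the range of the derivative estimate.\<close>

lemma energy_descent:
  assumes "0 < \<nu>" "0 < M"
  shows "\<exists>\<tau>>0. \<forall>z\<in>V. \<forall>s. \<nu> \<le> nrm (z - A z) \<and> nrm (z - A z) \<le> M \<and> 0 \<le> s \<and> s \<le> \<tau> \<longrightarrow>
           energy (z - s *\<^sub>R (z - A z)) \<le> energy z - s * (nrm (z - A z))\<^sup>2 / 2"
proof -
  obtain \<kappa> where \<kappa>: "\<kappa> > 0" "\<And>x d. x \<in> V \<Longrightarrow> d \<in> V \<Longrightarrow> nrm d \<le> \<kappa> \<Longrightarrow>
      \<bar>\<Psi> (x + d) - \<Psi> x - B (A x) d\<bar> \<le> \<nu> / 4 * nrm d"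
    using \<Psi>_deriv[of "\<nu> / 4"] assms(1) by auto
  show ?thesis
  proof (intro exI[of _ "min (1/2) (\<kappa> / M)"] conjI ballI allI impI)
    show "0 < min (1/2) (\<kappa> / M)" using \<kappa>(1) assms by simp
    fix z s assume z: "z \<in> V"
      and *: "\<nu> \<le> nrm (z - A z) \<and> nrm (z - A z) \<le> M \<and> 0 \<le> s \<and> s \<le> min (1/2) (\<kappa> / M)"
    define D where "D = z - A z"
    define n where "n = nrm D"
    have s: "0 \<le> s" "s \<le> 1/2" and n: "\<nu> \<le> n" "n \<le> M" using * by (auto simp: n_def D_def)
    have D: "D \<in> V" unfolding D_def using z A_V V_diff by blast
    have "s * n \<le> \<kappa> / M * M" using * n assms s by (intro mult_mono) auto
    then have "nrm (- s *\<^sub>R D) \<le> \<kappa>" using assms s by (simp add: nrm_scaleR n_def)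
    then have this_step: "\<bar>\<Psi> (z + (- s) *\<^sub>R D) - \<Psi> z - B (A z) ((- s) *\<^sub>R D)\<bar> \<le> \<nu> / 4 * (s * n)"
      using \<kappa>(2)[OF z V_scaleR[OF D, of "- s"]] s by (simp add: nrm_scaleR n_def)
    then have 1: "\<Psi> z - s * B (A z) D - \<nu> / 4 * (s * n) \<le> \<Psi> (z - s *\<^sub>R D)"
    proof -
      have e: "B (A z) ((- s) *\<^sub>R D) = - (s * B (A z) D)" "z + (- s) *\<^sub>R D = z - s *\<^sub>R D"
        by (simp_all only: scaleR_right) simp_all
      show ?thesis using abs_le_D2[OF this_step] unfolding e by linarith
    qed
    have 2: "B (z - s *\<^sub>R D) (z - s *\<^sub>R D) = B z z - 2 * s * B z D + s\<^sup>2 * n\<^sup>2"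
      using symmetric[of D z]
      by (simp add: diff_left diff_right scaleR_left scaleR_right nrm_square n_def power2_eq_square[of s] algebra_simps)
    have 3: "n\<^sup>2 = B z D - B (A z) D"
      unfolding n_def nrm_square diff_left[symmetric] D_def ..
    have 4: "s\<^sup>2 * n\<^sup>2 \<le> 1/2 * (s * n\<^sup>2)"
      using mult_right_mono[OF s(2), of "s * n\<^sup>2"] s(1) by (simp add: power2_eq_square[of s] mult.assoc)
    have 5: "\<nu> / 4 * (s * n) \<le> 1/4 * (s * n\<^sup>2)"
      using mult_right_mono[OF n(1), of "s * n"] s n assms by (simp add: power2_eq_square mult_ac)
    have "energy (z - s *\<^sub>R D) \<le> energy z - s * (B z D - B (A z) D) + s\<^sup>2 * n\<^sup>2 / 2 + \<nu> / 4 * (s * n)"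
      using 1 unfolding energy_def 2 by (simp add: algebra_simps diff_divide_distrib add_divide_distrib)
    also have "\<dots> \<le> energy z - s * n\<^sup>2 / 2"
      using 4 5 unfolding 3[symmetric] by (simp add: algebra_simps)
    finally show "energy (z - s *\<^sub>R (z - A z)) \<le> energy z - s * (nrm (z - A z))\<^sup>2 / 2"
      by (simp add: D_def n_def)
  qed
qed

text \<open>Clark's theorem, localised to a ball. If there were no small fixed points, an odd discretised
  gradient flow would push an \<open>n\<close>-dimensional sphere of negative energy below the level \<open>- c\<close>, where
  \<open>c\<close> does not depend on \<open>n\<close>. There \<open>\<Psi> \<ge> c\<close>, so that finitely many functionals have no common
  zero, against the Borsuk--Ulam theorem once their number is at most \<open>n\<close>.\<close>

theorem small_fixed_point:
  assumes finite_genus: "\<And>c R. 0 < c \<Longrightarrow> \<exists>n (l :: nat \<Rightarrow> 'a \<Rightarrow> real). (\<forall>i<n. bounded_linear (l i)) \<and>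
      (\<forall>x\<in>V. nrm x \<le> R \<and> (\<forall>i<n. l i x = 0) \<longrightarrow> \<Psi> x < c)"
    and negative_spheres: "\<And>n \<rho>. 0 < \<rho> \<Longrightarrow>
      \<exists>e \<epsilon>. 0 < \<epsilon> \<and> (\<forall>x\<in>cross_sphere e n. x \<in> V \<and> nrm x \<le> \<rho> \<and> energy x \<le> - \<epsilon>)"
    and r: "0 < r"
  shows "\<exists>z\<in>V. 0 < nrm z \<and> nrm z \<le> r \<and> A z = z"
proof (rule ccontr)
  assume neg: "\<not> ?thesis"
  then have no_fix: "\<And>z. z \<in> V \<Longrightarrow> 0 < nrm z \<Longrightarrow> nrm z \<le> r \<Longrightarrow> A z \<noteq> z" by blast
  obtain \<nu>1 where \<nu>1: "0 < \<nu>1" "\<And>z. z \<in> V \<Longrightarrow> r / 4 \<le> nrm z \<Longrightarrow> nrm z \<le> r \<Longrightarrow> \<nu>1 \<le> nrm (z - A z)"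
    using gradient_gap[of r "r / 4"] no_fix r by auto
  \<comment> \<open>Chosen so that 2 c is the cost \<nu>1 / 2 per unit of distance times r / 4: by
    the barrier in \<open>P\<close> below, a point with energy above - 2 c lies within radius 3 r /
    4.\<close>
  define c where "c = \<nu>1 * r / 16"
  have c: "0 < c" using \<nu>1(1) r by (simp add: c_def)
  \<comment> \<open>\<open>c\<close> precedes the dimension \<open>n\<close>; the energy \<epsilon>
    of the sphere and the step length are chosen afterwards and may depend on
    \<open>n\<close>.\<close>
  obtain n and l :: "nat \<Rightarrow> 'a \<Rightarrow> real" where l: "\<And>i. i < n \<Longrightarrow> bounded_linear (l i)"
    "\<And>x. x \<in> V \<Longrightarrow> nrm x \<le> r \<Longrightarrow> (\<And>i. i < n \<Longrightarrow> l i x = 0) \<Longrightarrow> \<Psi> x < c"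
    using finite_genus[OF c, of r] by blast
  obtain e \<epsilon> where \<epsilon>: "0 < \<epsilon>" and e: "\<And>x. x \<in> cross_sphere e n \<Longrightarrow> x \<in> V"
    "\<And>x. x \<in> cross_sphere e n \<Longrightarrow> nrm x \<le> r / 4" "\<And>x. x \<in> cross_sphere e n \<Longrightarrow> energy x \<le> - \<epsilon>"
    using negative_spheres[of "r / 4" n] r by auto
  obtain \<kappa> where \<kappa>: "\<kappa> > 0" "\<And>d. d \<in> V \<Longrightarrow> nrm d \<le> \<kappa> \<Longrightarrow> \<bar>\<Psi> d\<bar> \<le> nrm d"
  proof -
    obtain \<kappa> where "\<kappa> > 0" "\<And>x d. x \<in> V \<Longrightarrow> d \<in> V \<Longrightarrow> nrm d \<le> \<kappa> \<Longrightarrow>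
        \<bar>\<Psi> (x + d) - \<Psi> x - B (A x) d\<bar> \<le> 1 * nrm d"
      using \<Psi>_deriv[of 1] by auto
    from that[OF this(1)] this(2)[OF V_0] show thesis by (simp add: A_0 zero_left \<Psi>_0)
  qed
  define \<rho> where "\<rho> = min \<kappa> \<epsilon>"
  have \<rho>: "0 < \<rho>" using \<kappa>(1) \<epsilon> by (simp add: \<rho>_def)
  \<comment> \<open>Near 0 the potential is bounded by the seminorm, so energy at most -\<epsilon>
    keeps a point away from 0, where the gradient may be small.\<close>
  have low: "\<rho> \<le> nrm z" if "z \<in> V" "energy z \<le> - \<epsilon>" for z
  proof (rule ccontr)
    assume "\<not> \<rho> \<le> nrm z"
    then have "nrm z \<le> \<kappa>" "nrm z < \<epsilon>" by (auto simp: \<rho>_def)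
    then show False
      using \<kappa>(2)[OF that(1)] that(2) nonneg[of z] unfolding energy_def by linarith
  qed
  obtain \<nu> where \<nu>: "0 < \<nu>" "\<And>z. z \<in> V \<Longrightarrow> \<rho> \<le> nrm z \<Longrightarrow> nrm z \<le> r \<Longrightarrow> \<nu> \<le> nrm (z - A z)"
    using gradient_gap[of r \<rho>] no_fix \<rho> by blast
  obtain M where M: "0 < M" "\<And>z. z \<in> V \<Longrightarrow> nrm z \<le> r \<Longrightarrow> nrm (z - A z) \<le> M"
    using gradient_bounded[of r] by blast
  obtain \<tau>0 where \<tau>0: "0 < \<tau>0" "\<And>z s. z \<in> V \<Longrightarrow> \<nu> \<le> nrm (z - A z) \<Longrightarrow> nrm (z - A z) \<le> M \<Longrightarrow>
      0 \<le> s \<Longrightarrow> s \<le> \<tau>0 \<Longrightarrow> energy (z - s *\<^sub>R (z - A z)) \<le> energy z - s * (nrm (z - A z))\<^sup>2 / 2"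
    using energy_descent[OF \<nu>(1) M(1)] by blast
  \<comment> \<open>The second bound limits the displacement in one step to r / 4.\<close>
  define \<tau> where "\<tau> = min \<tau>0 (r / (4 * M))"
  have \<tau>: "0 < \<tau>" "\<tau> \<le> \<tau>0" "\<tau> * M \<le> r / 4"
    using \<tau>0(1) r M(1) by (auto simp: \<tau>_def min_def field_simps)
  \<comment> \<open>A cutoff in the energy: full steps above level -c, no motion below - 2 c. It is
    even because the energy is, so the step \<open>S\<close> is odd.\<close>
  define \<eta> where "\<eta> z = max 0 (min 1 (2 + energy z / c))" for z
  define S where "S z = z - (\<tau> * \<eta> z) *\<^sub>R (z - A z)" for z
  \<comment> \<open>The last clause is a barrier: a point beyond radius r / 2 must have paid at
    least \<nu>1 / 2 in energy per unit of distance.\<close>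
  define P where "P z \<longleftrightarrow> z \<in> V \<and> nrm z \<le> r \<and> energy z \<le> - \<epsilon>
      \<and> energy z + \<nu>1 / 2 * (nrm z - r / 2) \<le> 0" for z
  have \<eta>: "0 \<le> \<eta> z" "\<eta> z \<le> 1" for z by (auto simp: \<eta>_def)
  have S_V: "S z \<in> V" if "z \<in> V" for z
    unfolding S_def using that by (intro V_diff V_scaleR A_V)
  define q where "q = \<tau> * \<nu>\<^sup>2 / 2"
  have q: "0 < q" using \<tau>(1) \<nu>(1) by (simp add: q_def)
  have step: "P (S z) \<and> energy (S z) \<le> max (- c) (energy z - q)" if "P z" for z
  proof (cases "\<eta> z = 0")
    case True
    then have "2 + energy z / c \<le> 0" unfolding \<eta>_def by (auto simp: max_def min_def split: if_splits)
    then have "energy z \<le> - c" using c by (simp add: field_simps)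
    then show ?thesis using that True by (simp add: S_def)
  next
    case False
    define s where "s = \<tau> * \<eta> z"
    define N where "N = nrm (z - A z)"
    have Pz: "z \<in> V" "nrm z \<le> r" "energy z \<le> - \<epsilon>" "energy z + \<nu>1 / 2 * (nrm z - r / 2) \<le> 0"
      using that by (auto simp: P_def)
    have s: "0 \<le> s" "s \<le> \<tau>"
      using \<eta>[of z] \<tau>(1) by (auto simp: s_def mult_le_cancel_left1)
    have "0 < 2 + energy z / c" using False unfolding \<eta>_def by (auto simp: max_def min_def split: if_splits)
    then have "- 2 * c < energy z" using c by (simp add: field_simps)
    then have "\<nu>1 / 2 * (nrm z - r / 2) < \<nu>1 / 2 * (r / 4)" using Pz(4) by (simp add: c_def)
    then have z34: "nrm z < 3 * r / 4" using \<nu>1(1) by (simp add: mult_less_cancel_left)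
    have N: "\<nu> \<le> N" "N \<le> M"
      using \<nu>(2)[OF Pz(1) low[OF Pz(1,3)] Pz(2)] M(2)[OF Pz(1,2)] by (simp_all add: N_def)
    have en: "energy (S z) \<le> energy z - s * N\<^sup>2 / 2"
      unfolding S_def s_def[symmetric] N_def
      using \<tau>0(2)[OF Pz(1), of s] N s \<tau>(2) by (simp add: N_def)
    have sN: "0 \<le> s * N" "s * N \<le> r / 4"
    proof -
      show "0 \<le> s * N" using s by (simp add: N_def)
      have "s * N \<le> \<tau> * M" using s N \<tau>(1) by (intro mult_mono) (auto simp: N_def)
      then show "s * N \<le> r / 4" using \<tau>(3) by simp
    qed
    have nS: "nrm (S z) \<le> nrm z + s * N"
      using nrm_diff_triangle[of z "s *\<^sub>R (z - A z)"] s
      by (simp add: S_def s_def[symmetric] nrm_scaleR N_def)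
    have en0: "energy (S z) \<le> - \<epsilon>"
      using en Pz(3) s by (smt (verit) zero_le_power2 mult_nonneg_nonneg divide_nonneg_nonneg)
    \<comment> \<open>Beyond radius r / 4 the gradient is at least \<nu>1, so a displacement s N
      lowers the energy by at least \<nu>1 / 2 * s N and the barrier survives. From inside, a single
      step cannot pass radius r / 2.\<close>
    have "energy (S z) + \<nu>1 / 2 * (nrm (S z) - r / 2) \<le> 0"
    proof (cases "r / 4 \<le> nrm z")
      case True
      then have "\<nu>1 \<le> N" using \<nu>1(2)[OF Pz(1)] Pz(2) by (simp add: N_def)
      then have "\<nu>1 * (s * N) \<le> s * N\<^sup>2"
        using mult_right_mono[of \<nu>1 N "s * N"] sN by (simp add: power2_eq_square mult_ac)
      moreover have "\<nu>1 / 2 * (nrm (S z) - r / 2) \<le> \<nu>1 / 2 * (nrm z + s * N - r / 2)"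
        using nS \<nu>1(1) by (intro mult_left_mono) auto
      ultimately show ?thesis using en Pz(4) by (simp add: algebra_simps)
    next
      case False
      then have "nrm (S z) - r / 2 \<le> 0" using nS sN by linarith
      then have "\<nu>1 / 2 * (nrm (S z) - r / 2) \<le> 0" using \<nu>1(1) by (simp add: mult_nonneg_nonpos)
      then show ?thesis using en0 \<epsilon> by linarith
    qed
    then have "P (S z)"
      using S_V[OF Pz(1)] en0 nS sN z34 by (simp add: P_def)
    moreover have "energy (S z) \<le> max (- c) (energy z - q)"
    proof (cases "- c \<le> energy z")
      case True
      then have "\<eta> z = 1" unfolding \<eta>_def using c by (simp add: field_simps)
      then have "s = \<tau>" by (simp add: s_def)
      moreover have "\<nu>\<^sup>2 \<le> N\<^sup>2" using N(1) \<nu>(1) by (intro power_mono) auto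
      ultimately have "q \<le> s * N\<^sup>2 / 2" using \<tau>(1) by (simp add: q_def)
      then show ?thesis using en by simp
    next
      case False
      have "0 \<le> s * N\<^sup>2 / 2" using s by simp
      then show ?thesis using en False by linarith
    qed
    ultimately show ?thesis by blast
  qed
  have iter: "P ((S ^^ j) z) \<and> energy ((S ^^ j) z) \<le> max (- c) (energy z - real j * q)" if "P z" for j z
  proof (induction j)
    case 0
    then show ?case using that by simp
  next
    case (Suc j)
    have "energy ((S ^^ Suc j) z) \<le> max (- c) (energy ((S ^^ j) z) - q)"
      using step Suc by simp
    also have "\<dots> \<le> max (- c) (energy z - real (Suc j) * q)"
      using Suc q by (auto simp: algebra_simps max_def split: if_splits)
    finally show ?case using step Suc by simp
  qed
  \<comment> \<open>The initial energy is negative, so enough steps with gain \<open>q\<close> bring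
    every point of the sphere down to level -c.\<close>
  obtain j :: nat where j: "c < real j * q"
    using reals_Archimedean3[OF q] by blast
  have cont_S: "continuous_on V S"
    unfolding S_def[abs_def] \<eta>_def[abs_def]
    by (intro continuous_on_diff continuous_on_scaleR continuous_on_mult continuous_on_max continuous_on_min
        continuous_on_add continuous_on_divide continuous_on_const continuous_on_id continuous_energy continuous_A)
      (use c in auto)
  have Sj: "continuous_on V (S ^^ i) \<and> (\<forall>z\<in>V. (S ^^ i) z \<in> V \<and> (S ^^ i) (- z) = - (S ^^ i) z)" for i
  proof (induction i)
    case 0
    show ?case by (simp add: continuous_on_id)
  next
    case (Suc i)
    have "continuous_on ((S ^^ i) ` V) S"
      using Suc by (intro continuous_on_subset[OF cont_S]) auto
    then have "continuous_on V (S ^^ Suc i)"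
      using Suc continuous_on_compose[of V "S ^^ i" S] by simp
    moreover have "S (- w) = - S w" if "w \<in> V" for w
      using that by (simp add: S_def \<eta>_def energy_even A_odd scaleR_diff_right)
    ultimately show ?case using Suc S_V by simp
  qed
  have "\<exists>x\<in>cross_sphere e n. \<forall>i<n. l i ((S ^^ j) x) = 0"
  proof (rule Borsuk_Ulam_cross_sphere)
    fix i assume i: "i < n"
    have "continuous_on (cross_sphere e n) (S ^^ j)"
      using Sj e(1) by (meson continuous_on_subset subsetI)
    then show "continuous_on (cross_sphere e n) (\<lambda>x. l i ((S ^^ j) x))"
      by (rule bounded_linear.continuous_on[OF l(1)[OF i]])
    fix x assume x: "x \<in> cross_sphere e n"
    show "l i ((S ^^ j) (- x)) = - l i ((S ^^ j) x)"
      using Sj[of j] e(1)[OF x] by (simp add: linear_neg[OF bounded_linear.linear[OF l(1)[OF i]]])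
  qed
  then obtain x where x: "x \<in> cross_sphere e n" "\<And>i. i < n \<Longrightarrow> l i ((S ^^ j) x) = 0" by blast
  have "\<nu>1 / 2 * (nrm x - r / 2) \<le> 0"
    using e(2)[OF x(1)] \<nu>1(1) r by (intro mult_nonneg_nonpos) auto
  then have "P x" using e[OF x(1)] r \<epsilon> by (simp add: P_def)
  then have w: "P ((S ^^ j) x)" "energy ((S ^^ j) x) \<le> - c"
    using iter[of x j] e(3)[OF x(1)] j \<epsilon> by auto
  have "\<Psi> ((S ^^ j) x) < c"
    using w(1) x(2) by (intro l(2)) (auto simp: P_def)
  then show False
    using w(2) nonneg[of "(S ^^ j) x"] unfolding energy_def by linarith
qed

end

section \<open>Absolutely continuous functions\<close>

lemma absolutely_continuous_fun_onE:
  assumes "absolutely_continuous_fun_on S g" "0 < \<epsilon>"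
  obtains \<eta> where "\<eta> > 0" "\<And>\<D>. \<D> division_of \<Union>\<D> \<Longrightarrow> \<Union>\<D> \<subseteq> S \<Longrightarrow>
      (\<Sum>K\<in>\<D>. measure lborel K) < \<eta> \<Longrightarrow> (\<Sum>K\<in>\<D>. \<bar>g (Sup K) - g (Inf K)\<bar>) < \<epsilon>"
proof -
  have "\<exists>\<eta>>0. \<forall>\<D>. \<D> division_of \<Union>\<D> \<and> \<Union>\<D> \<subseteq> S \<and> (\<Sum>K\<in>\<D>. measure lborel K) < \<eta>
      \<longrightarrow> (\<Sum>K\<in>\<D>. \<bar>g (Sup K) - g (Inf K)\<bar>) < \<epsilon>"
    using assms(1)[unfolded absolutely_continuous_fun_on_def, rule_format, OF assms(2)] .
  then obtain \<eta> where \<eta>: "\<eta> > 0" "\<forall>\<D>. \<D> division_of \<Union>\<D> \<and> \<Union>\<D> \<subseteq> S \<and> (\<Sum>K\<in>\<D>. measure lborel K) < \<eta>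
      \<longrightarrow> (\<Sum>K\<in>\<D>. \<bar>g (Sup K) - g (Inf K)\<bar>) < \<epsilon>" by blast
  show thesis
  proof (rule that[OF \<eta>(1)])
    fix \<D> :: "real set set"
    assume "\<D> division_of \<Union>\<D>" "\<Union>\<D> \<subseteq> S" "(\<Sum>K\<in>\<D>. measure lborel K) < \<eta>"
    then show "(\<Sum>K\<in>\<D>. \<bar>g (Sup K) - g (Inf K)\<bar>) < \<epsilon>"
      by (intro \<eta>(2)[rule_format] conjI)
  qed
qed

lemma absolutely_continuous_fun_on_subset:
  "absolutely_continuous_fun_on S g \<Longrightarrow> S' \<subseteq> S \<Longrightarrow> absolutely_continuous_fun_on S' g"
  unfolding absolutely_continuous_fun_on_def by (meson subset_trans)

lemma division_of_real_intervals:
  fixes \<D> :: "real set set"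
  assumes "\<D> division_of S" "K \<in> \<D>"
  shows "Inf K \<in> S" "Sup K \<in> S" "\<bar>Sup K - Inf K\<bar> = measure lborel K"
proof -
  obtain a b where ab: "K = cbox a b" "K \<noteq> {}" "K \<subseteq> S"
    using division_ofD[OF assms(1)] assms(2) by metis
  then have "a \<le> b" by simp
  then show "Inf K \<in> S" "Sup K \<in> S" "\<bar>Sup K - Inf K\<bar> = measure lborel K"
    using ab by auto
qed

lemma absolutely_continuous_fun_on_cong:
  fixes f g :: "real \<Rightarrow> real"
  assumes "\<And>x. x \<in> S \<Longrightarrow> f x = g x" "absolutely_continuous_fun_on S f"
  shows "absolutely_continuous_fun_on S g"
  unfolding absolutely_continuous_fun_on_def
proof (intro allI impI)
  fix \<epsilon> :: real assume "0 < \<epsilon>"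
  from absolutely_continuous_fun_onE[OF assms(2) this] obtain \<eta> where \<eta>: "\<eta> > 0"
    "\<And>\<D>. \<D> division_of \<Union>\<D> \<Longrightarrow> \<Union>\<D> \<subseteq> S \<Longrightarrow>
      (\<Sum>K\<in>\<D>. measure lborel K) < \<eta> \<Longrightarrow> (\<Sum>K\<in>\<D>. \<bar>f (Sup K) - f (Inf K)\<bar>) < \<epsilon>" by blast
  show "\<exists>\<eta>>0. \<forall>\<D>. \<D> division_of \<Union>\<D> \<and> \<Union>\<D> \<subseteq> S \<and> (\<Sum>K\<in>\<D>. measure lborel K) < \<eta>
      \<longrightarrow> (\<Sum>K\<in>\<D>. \<bar>g (Sup K) - g (Inf K)\<bar>) < \<epsilon>"
  proof (intro exI[of _ \<eta>] conjI allI impI)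
    fix \<D> :: "real set set"
    assume D: "\<D> division_of \<Union>\<D> \<and> \<Union>\<D> \<subseteq> S \<and> (\<Sum>K\<in>\<D>. measure lborel K) < \<eta>"
    have "(\<Sum>K\<in>\<D>. \<bar>g (Sup K) - g (Inf K)\<bar>) = (\<Sum>K\<in>\<D>. \<bar>f (Sup K) - f (Inf K)\<bar>)"
    proof (intro sum.cong refl)
      fix K assume K: "K \<in> \<D>"
      note * = division_of_real_intervals[OF conjunct1[OF D] K]
      show "\<bar>g (Sup K) - g (Inf K)\<bar> = \<bar>f (Sup K) - f (Inf K)\<bar>"
      proof -
        have "Sup K \<in> S" "Inf K \<in> S" using *(1,2) D by blast+
        then show ?thesis using assms(1) by simp
      qed
    qed
    then show "(\<Sum>K\<in>\<D>. \<bar>g (Sup K) - g (Inf K)\<bar>) < \<epsilon>" using \<eta>(2)[of \<D>] D by simp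
  qed (rule \<eta>(1))
qed

lemma absolutely_continuous_fun_on_lipschitz:
  fixes g :: "real \<Rightarrow> real"
  assumes "L-lipschitz_on S g"
  shows "absolutely_continuous_fun_on S g"
  unfolding absolutely_continuous_fun_on_def
proof (intro allI impI)
  fix \<epsilon> :: real assume \<epsilon>: "0 < \<epsilon>"
  have L: "0 \<le> L" using lipschitz_on_nonneg[OF assms] .
  show "\<exists>\<eta>>0. \<forall>\<D>. \<D> division_of \<Union>\<D> \<and> \<Union>\<D> \<subseteq> S \<and> (\<Sum>K\<in>\<D>. measure lborel K) < \<eta>
      \<longrightarrow> (\<Sum>K\<in>\<D>. \<bar>g (Sup K) - g (Inf K)\<bar>) < \<epsilon>"
  proof (intro exI[of _ "\<epsilon> / (L + 1)"] conjI allI impI)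
    show "0 < \<epsilon> / (L + 1)" using L \<epsilon> by simp
    fix \<D> :: "real set set"
    assume D: "\<D> division_of \<Union>\<D> \<and> \<Union>\<D> \<subseteq> S \<and> (\<Sum>K\<in>\<D>. measure lborel K) < \<epsilon> / (L + 1)"
    have "(\<Sum>K\<in>\<D>. \<bar>g (Sup K) - g (Inf K)\<bar>) \<le> (\<Sum>K\<in>\<D>. L * measure lborel K)"
    proof (rule sum_mono)
      fix K assume K: "K \<in> \<D>"
      note * = division_of_real_intervals[OF conjunct1[OF D] K]
      show "\<bar>g (Sup K) - g (Inf K)\<bar> \<le> L * measure lborel K"
        using lipschitz_onD[OF assms, of "Sup K" "Inf K"] * D by (auto simp: dist_real_def)
    qed
    also have "\<dots> = L * (\<Sum>K\<in>\<D>. measure lborel K)" by (simp add: sum_distrib_left)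
    also have "\<dots> \<le> L * (\<epsilon> / (L + 1))" using D L by (intro mult_left_mono) auto
    also have "\<dots> < \<epsilon>" using L \<epsilon> by (simp add: field_simps)
    finally show "(\<Sum>K\<in>\<D>. \<bar>g (Sup K) - g (Inf K)\<bar>) < \<epsilon>" .
  qed
qed

lemma absolutely_continuous_fun_on_continuous:
  fixes g :: "real \<Rightarrow> real"
  assumes "absolutely_continuous_fun_on {a..b} g"
  shows "continuous_on {a..b} g"
  unfolding continuous_on_iff
proof safe
  fix x e :: real assume x: "x \<in> {a..b}" and e: "0 < e"
  obtain \<eta> where \<eta>: "\<eta> > 0" "\<And>\<D>. \<D> division_of \<Union>\<D> \<Longrightarrow> \<Union>\<D> \<subseteq> {a..b} \<Longrightarrow>
      (\<Sum>K\<in>\<D>. measure lborel K) < \<eta> \<Longrightarrow> (\<Sum>K\<in>\<D>. \<bar>g (Sup K) - g (Inf K)\<bar>) < e"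
    using absolutely_continuous_fun_onE[OF assms e] by blast
  have *: "\<bar>g w - g y\<bar> < e" if "y \<in> {a..b}" "w \<in> {a..b}" "y \<le> w" "w - y < \<eta>" for y w
  proof -
    have "{cbox y w} division_of \<Union>{cbox y w}"
      using division_of_self[of y w] that(3) by simp
    then show ?thesis using \<eta>(2)[of "{cbox y w}"] that by auto
  qed
  show "\<exists>d>0. \<forall>x'\<in>{a..b}. dist x' x < d \<longrightarrow> dist (g x') (g x) < e"
  proof (intro exI[of _ \<eta>] conjI ballI impI)
    fix y assume y: "y \<in> {a..b}" "dist y x < \<eta>"
    show "dist (g y) (g x) < e"
      using *[of x y] *[of y x] x y by (cases "x \<le> y") (auto simp: dist_real_def abs_minus_commute)
  qed (use \<eta> in auto)
qed

lemma absolutely_continuous_fun_on_diff: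
  fixes f g :: "real \<Rightarrow> real"
  assumes "absolutely_continuous_fun_on S f" "absolutely_continuous_fun_on S g"
  shows "absolutely_continuous_fun_on S (\<lambda>x. f x - g x)"
  unfolding absolutely_continuous_fun_on_def
proof (intro allI impI)
  fix \<epsilon> :: real assume \<epsilon>: "0 < \<epsilon>"
  obtain \<eta>1 where 1: "\<eta>1 > 0" "\<And>\<D>. \<D> division_of \<Union>\<D> \<Longrightarrow> \<Union>\<D> \<subseteq> S \<Longrightarrow>
      (\<Sum>K\<in>\<D>. measure lborel K) < \<eta>1 \<Longrightarrow> (\<Sum>K\<in>\<D>. \<bar>f (Sup K) - f (Inf K)\<bar>) < \<epsilon> / 2"
    using absolutely_continuous_fun_onE[OF assms(1) half_gt_zero[OF \<epsilon>]] by blast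
  obtain \<eta>2 where 2: "\<eta>2 > 0" "\<And>\<D>. \<D> division_of \<Union>\<D> \<Longrightarrow> \<Union>\<D> \<subseteq> S \<Longrightarrow>
      (\<Sum>K\<in>\<D>. measure lborel K) < \<eta>2 \<Longrightarrow> (\<Sum>K\<in>\<D>. \<bar>g (Sup K) - g (Inf K)\<bar>) < \<epsilon> / 2"
    using absolutely_continuous_fun_onE[OF assms(2) half_gt_zero[OF \<epsilon>]] by blast
  show "\<exists>\<eta>>0. \<forall>\<D>. \<D> division_of \<Union>\<D> \<and> \<Union>\<D> \<subseteq> S \<and> (\<Sum>K\<in>\<D>. measure lborel K) < \<eta>
      \<longrightarrow> (\<Sum>K\<in>\<D>. \<bar>f (Sup K) - g (Sup K) - (f (Inf K) - g (Inf K))\<bar>) < \<epsilon>"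
  proof (intro exI[of _ "min \<eta>1 \<eta>2"] conjI allI impI)
    fix \<D> :: "real set set"
    assume D: "\<D> division_of \<Union>\<D> \<and> \<Union>\<D> \<subseteq> S \<and> (\<Sum>K\<in>\<D>. measure lborel K) < min \<eta>1 \<eta>2"
    have "(\<Sum>K\<in>\<D>. \<bar>f (Sup K) - g (Sup K) - (f (Inf K) - g (Inf K))\<bar>)
        \<le> (\<Sum>K\<in>\<D>. \<bar>f (Sup K) - f (Inf K)\<bar>) + (\<Sum>K\<in>\<D>. \<bar>g (Sup K) - g (Inf K)\<bar>)"
      unfolding sum.distrib[symmetric] by (rule sum_mono) linarith
    also have "\<dots> < \<epsilon>" using 1(2)[of \<D>] 2(2)[of \<D>] D by simp
    finally show "(\<Sum>K\<in>\<D>. \<bar>f (Sup K) - g (Sup K) - (f (Inf K) - g (Inf K))\<bar>) < \<epsilon>" .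
  qed (use 1 2 in auto)
qed

lemma absolutely_continuous_fun_on_mult_lipschitz:
  fixes f g :: "real \<Rightarrow> real"
  assumes f: "L-lipschitz_on {a..b} f" and g: "absolutely_continuous_fun_on {a..b} g"
  shows "absolutely_continuous_fun_on {a..b} (\<lambda>x. f x * g x)"
  unfolding absolutely_continuous_fun_on_def
proof (intro allI impI)
  fix \<epsilon> :: real assume \<epsilon>: "0 < \<epsilon>"
  have L: "0 \<le> L" using lipschitz_on_nonneg[OF f] .
  have "bounded (f ` {a..b})" "bounded (g ` {a..b})"
    using lipschitz_on_continuous_on[OF f] absolutely_continuous_fun_on_continuous[OF g]
    by (auto intro!: compact_imp_bounded compact_continuous_image)
  then have "\<exists>F>0. \<forall>x\<in>{a..b}. \<bar>f x\<bar> \<le> F" "\<exists>G>0. \<forall>x\<in>{a..b}. \<bar>g x\<bar> \<le> G"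
    unfolding bounded_pos by auto
  then obtain F G where F: "0 < F" "\<And>x. x \<in> {a..b} \<Longrightarrow> \<bar>f x\<bar> \<le> F"
    and G: "0 < G" "\<And>x. x \<in> {a..b} \<Longrightarrow> \<bar>g x\<bar> \<le> G" by blast
  have "0 < \<epsilon> / (2 * F)" using \<epsilon> F(1) by simp
  then obtain \<eta>1 where 1: "\<eta>1 > 0" "\<And>\<D>. \<D> division_of \<Union>\<D> \<Longrightarrow> \<Union>\<D> \<subseteq> {a..b} \<Longrightarrow>
      (\<Sum>K\<in>\<D>. measure lborel K) < \<eta>1 \<Longrightarrow> (\<Sum>K\<in>\<D>. \<bar>g (Sup K) - g (Inf K)\<bar>) < \<epsilon> / (2 * F)"
    using absolutely_continuous_fun_onE[OF g] by blast
  define \<eta>2 where "\<eta>2 = \<epsilon> / (2 * G * (L + 1))"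
  have \<eta>2: "0 < \<eta>2" using \<epsilon> G(1) L by (simp add: \<eta>2_def)
  show "\<exists>\<eta>>0. \<forall>\<D>. \<D> division_of \<Union>\<D> \<and> \<Union>\<D> \<subseteq> {a..b} \<and> (\<Sum>K\<in>\<D>. measure lborel K) < \<eta>
      \<longrightarrow> (\<Sum>K\<in>\<D>. \<bar>f (Sup K) * g (Sup K) - f (Inf K) * g (Inf K)\<bar>) < \<epsilon>"
  proof (intro exI[of _ "min \<eta>1 \<eta>2"] conjI allI impI)
    fix \<D> :: "real set set"
    assume D: "\<D> division_of \<Union>\<D> \<and> \<Union>\<D> \<subseteq> {a..b} \<and> (\<Sum>K\<in>\<D>. measure lborel K) < min \<eta>1 \<eta>2"
    have "\<bar>f (Sup K) * g (Sup K) - f (Inf K) * g (Inf K)\<bar>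
        \<le> F * \<bar>g (Sup K) - g (Inf K)\<bar> + G * L * measure lborel K" if K: "K \<in> \<D>" for K
    proof -
      note K' = division_of_real_intervals[OF conjunct1[OF D] K]
      have S: "Sup K \<in> {a..b}" and I: "Inf K \<in> {a..b}" using K'(1,2) D by blast+
      have "f (Sup K) * g (Sup K) - f (Inf K) * g (Inf K) =
          f (Sup K) * (g (Sup K) - g (Inf K)) + (f (Sup K) - f (Inf K)) * g (Inf K)"
        by (simp add: algebra_simps)
      also have "\<bar>\<dots>\<bar> \<le> \<bar>f (Sup K)\<bar> * \<bar>g (Sup K) - g (Inf K)\<bar> + \<bar>f (Sup K) - f (Inf K)\<bar> * \<bar>g (Inf K)\<bar>"
        by (metis abs_mult abs_triangle_ineq)
      also have "\<bar>f (Sup K)\<bar> * \<bar>g (Sup K) - g (Inf K)\<bar> \<le> F * \<bar>g (Sup K) - g (Inf K)\<bar>"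
        using F(2)[OF S] by (intro mult_right_mono) auto
      also have "\<bar>f (Sup K) - f (Inf K)\<bar> * \<bar>g (Inf K)\<bar> \<le> (L * measure lborel K) * G"
        using lipschitz_onD[OF f S I] G(2)[OF I] K'(3) L
        by (intro mult_mono) (auto simp: dist_real_def)
      finally show ?thesis by (simp add: mult_ac)
    qed
    then have "(\<Sum>K\<in>\<D>. \<bar>f (Sup K) * g (Sup K) - f (Inf K) * g (Inf K)\<bar>)
        \<le> F * (\<Sum>K\<in>\<D>. \<bar>g (Sup K) - g (Inf K)\<bar>) + G * L * (\<Sum>K\<in>\<D>. measure lborel K)"
      unfolding sum_distrib_left sum.distrib[symmetric] by (rule sum_mono)
    also have "\<dots> < \<epsilon> / 2 + \<epsilon> / 2"
    proof (rule add_less_le_mono)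
      show "F * (\<Sum>K\<in>\<D>. \<bar>g (Sup K) - g (Inf K)\<bar>) < \<epsilon> / 2"
        using 1(2)[of \<D>] D F(1) by (simp add: field_simps)
      have "G * L * (\<Sum>K\<in>\<D>. measure lborel K) \<le> G * (L + 1) * \<eta>2"
        using D G(1) L by (intro mult_mono) (auto intro: sum_nonneg)
      also have "\<dots> = \<epsilon> / 2" using G(1) L by (simp add: \<eta>2_def divide_simps)
      finally show "G * L * (\<Sum>K\<in>\<D>. measure lborel K) \<le> \<epsilon> / 2" .
    qed
    finally show "(\<Sum>K\<in>\<D>. \<bar>f (Sup K) * g (Sup K) - f (Inf K) * g (Inf K)\<bar>) < \<epsilon>" by simp
  qed (use 1 \<eta>2 in auto)
qed

lemma lipschitz_of_continuous_derivative:
  fixes g :: "real \<Rightarrow> real"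
  assumes "\<And>x. x \<in> {a..b} \<Longrightarrow> (g has_real_derivative g' x) (at x within {a..b})"
    and "continuous_on {a..b} g'"
  shows "\<exists>L. L-lipschitz_on {a..b} g"
proof -
  obtain C where C: "0 < C" "\<And>x. x \<in> {a..b} \<Longrightarrow> norm (g' x) \<le> C"
    using compact_imp_bounded[OF compact_continuous_image[OF assms(2) compact_Icc]]
    unfolding bounded_pos by auto
  have "C-lipschitz_on {a..b} g"
  proof (rule bounded_derivative_imp_lipschitz)
    show "(g has_derivative (*) (g' x)) (at x within {a..b})" if "x \<in> {a..b}" for x
      using assms(1)[OF that] by (simp add: has_field_derivative_def)
    show "onorm ((*) (g' x)) \<le> C" if "x \<in> {a..b}" for x
      using C(2)[OF that] by (intro onorm_le) (simp add: abs_mult mult_right_mono)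
  qed (use C in auto)
  then show ?thesis by blast
qed

text \<open>In a Riemann sum, the intervals tagged in the exceptional null set have small total length,
  so that absolute continuity bounds their contribution.\<close>

theorem fundamental_theorem_of_calculus_absolutely_continuous:
  fixes F :: "real \<Rightarrow> real"
  assumes ab: "a \<le> b" and ac: "absolutely_continuous_fun_on {a..b} F" and N: "negligible N"
    and F': "\<And>x. x \<in> {a..b} - N \<Longrightarrow> (F has_vector_derivative f x) (at x within {a..b})"
  shows "(f has_integral (F b - F a)) {a..b}"
proof (cases "a = b")
  case True
  then show ?thesis using has_integral_refl(2)[of f a] by simp
next
  case False
  then have ab': "a < b" using ab by simp
  \<comment> \<open>Setting the integrand to 0 on the null set removes the terms tagged there from
    the Riemann sums; only the increments of \<open>F\<close> over these intervals remain.\<close>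
  define g where "g x = (if x \<in> N then 0 else f x)" for x
  have "(g has_integral (F b - F a)) (cbox a b)"
    unfolding has_integral_factor_content
  proof (intro allI impI)
    fix e :: real assume e: "0 < e"
    have "0 < e / 2 * (b - a)" using e ab' by simp
    then obtain \<eta> where \<eta>: "\<eta> > 0" "\<And>\<D>. \<D> division_of \<Union>\<D> \<Longrightarrow> \<Union>\<D> \<subseteq> {a..b} \<Longrightarrow>
        (\<Sum>K\<in>\<D>. measure lborel K) < \<eta> \<Longrightarrow> (\<Sum>K\<in>\<D>. \<bar>F (Sup K) - F (Inf K)\<bar>) < e / 2 * (b - a)"
      using absolutely_continuous_fun_onE[OF ac] by blast
    obtain U where U: "open U" "N \<subseteq> U" "U - N \<in> lmeasurable" "emeasure lebesgue (U - N) < ennreal \<eta>"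
      using sets_lebesgue_outer_open[OF negligible_imp_sets[OF N] \<eta>(1)] by blast
    have Nm: "N \<in> lmeasurable" using N by (rule negligible_imp_measurable)
    have Um: "U \<in> lmeasurable" using fmeasurable.Un[OF U(3) Nm] U(2) by (simp add: Un_absorb2)
    have "measure lebesgue U = measure lebesgue (U - N)"
      using N Um by (simp add: measure_Diff_null_set negligible_iff_null_sets fmeasurableD)
    also have "\<dots> < \<eta>"
      using U(4) emeasure_eq_measure2[OF U(3)] \<eta>(1) by (simp add: ennreal_less_iff)
    finally have U\<eta>: "measure lebesgue U < \<eta>" .
    have "\<forall>x. \<exists>d>0. x \<in> {a..b} - N \<longrightarrow>
        (\<forall>y\<in>{a..b}. norm (y - x) < d \<longrightarrow> norm (F y - F x - (y - x) *\<^sub>R f x) \<le> e / 2 * norm (y - x))"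
      using F'[unfolded has_vector_derivative_def has_derivative_within_alt] half_gt_zero[OF e] by blast
    then obtain d where d: "\<And>x. 0 < d x"
      "\<And>x y. x \<in> {a..b} - N \<Longrightarrow> y \<in> {a..b} \<Longrightarrow> norm (y - x) < d x \<Longrightarrow>
          norm (F y - F x - (y - x) *\<^sub>R f x) \<le> e / 2 * norm (y - x)"
      by metis
    \<comment> \<open>For tags in \<open>N\<close> the gauge is the small open set itself, not a
      ball around the tag, so that all these intervals together have length below \<eta>.\<close>
    define \<gamma> where "\<gamma> x = (if x \<in> N then U else ball x (d x))" for x
    have gauge: "gauge \<gamma>"
      unfolding gauge_def \<gamma>_def using U(1,2) d(1) by auto
    have riemann: "norm ((\<Sum>(x,k)\<in>p. measure lborel k *\<^sub>R g x) - (F b - F a)) \<le> e * measure lborel (cbox a b)"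
      if p: "p tagged_division_of cbox a b" and fine: "\<gamma> fine p" for p
    proof -
      note pD = tagged_division_ofD[OF p]
      have real_sum: "(\<Sum>(x,K)\<in>p. \<phi> (Sup K) - \<phi> (Inf K)) = \<phi> b - \<phi> a" for \<phi> :: "real \<Rightarrow> real"
        using additive_tagged_division_1[OF ab, of p \<phi>] p by simp
      define pN where "pN = {xK \<in> p. fst xK \<in> N}"
      define \<D> where "\<D> = snd ` pN"
      have tpd: "pN tagged_partial_division_of {a..b}"
        using tagged_partial_division_subset[of p "{a..b}" pN] p
        by (simp add: tagged_division_of_def pN_def)
      have td: "pN tagged_division_of \<Union>\<D>"
        unfolding \<D>_def by (rule tagged_partial_division_of_Union_self[OF tpd])
      have div: "\<D> division_of \<Union>\<D>"
        using division_of_tagged_division[OF td] unfolding \<D>_def .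
      have D_ab: "\<Union>\<D> \<subseteq> {a..b}"
      proof (rule Union_least)
        fix K assume "K \<in> \<D>"
        then obtain x where "(x, K) \<in> p" unfolding \<D>_def pN_def by auto
        from pD(3)[OF this] show "K \<subseteq> {a..b}" by simp
      qed
      have D_U: "\<Union>\<D> \<subseteq> U"
      proof (rule Union_least)
        fix K assume "K \<in> \<D>"
        then obtain x where "(x, K) \<in> p" "x \<in> N" unfolding \<D>_def pN_def by auto
        then show "K \<subseteq> U" using fineD[OF fine, of x K] by (simp add: \<gamma>_def)
      qed
      have cpt: "compact (\<Union>\<D>)"
        using division_ofD(1,4)[OF div] by (intro compact_Union) auto
      have "(\<Sum>K\<in>\<D>. measure lborel K) = (\<Sum>K\<in>\<D>. measure lebesgue K)"
      proof (intro sum.cong refl)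
        fix K assume "K \<in> \<D>"
        then obtain u v where "K = cbox u v" using division_ofD(4)[OF div] by blast
        then show "measure lborel K = measure lebesgue K" by (simp add: measure_completion)
      qed
      also have "\<dots> = measure lebesgue (\<Union>\<D>)" by (rule content_division[OF div])
      also have "measure lebesgue (\<Union>\<D>) \<le> measure lebesgue U"
        using measure_mono_fmeasurable[OF D_U fmeasurableD[OF lmeasurable_compact[OF cpt]] Um] .
      finally have "(\<Sum>K\<in>\<D>. \<bar>F (Sup K) - F (Inf K)\<bar>) < e / 2 * (b - a)"
        using U\<eta> by (intro \<eta>(2) div D_ab) simp
      also have "(\<Sum>K\<in>\<D>. \<bar>F (Sup K) - F (Inf K)\<bar>) = (\<Sum>(x,K)\<in>pN. \<bar>F (Sup K) - F (Inf K)\<bar>)"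
      proof -
        \<comment> \<open>Distinct tagged pairs share an interval only if its interior is empty, and
          there the increment is 0. The value 0 at the empty set is what the reindexing rule
          requires of empty boxes.\<close>
        define h where "h K = (if K = {} then 0 else \<bar>F (Sup K) - F (Inf K)\<bar>)" for K :: "real set"
        have "(\<Sum>K\<in>\<D>. \<bar>F (Sup K) - F (Inf K)\<bar>) = sum h \<D>"
          using division_ofD(3)[OF div] by (intro sum.cong) (auto simp: h_def)
        also have "\<dots> = (\<Sum>(x,K)\<in>pN. h K)"
          unfolding \<D>_def
          by (rule sum.over_tagged_division_lemma[OF td, symmetric]) (auto simp: h_def box_eq_empty not_less)
        also have "\<dots> = (\<Sum>(x,K)\<in>pN. \<bar>F (Sup K) - F (Inf K)\<bar>)"
          using pD(2) by (intro sum.cong) (auto simp: h_def pN_def dest!: pD(2))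
        finally show ?thesis .
      qed
      finally have sumN: "(\<Sum>(x,K)\<in>pN. \<bar>F (Sup K) - F (Inf K)\<bar>) < e / 2 * (b - a)" .
      \<comment> \<open>Straddle estimate: the tag lies between the end points, and the errors on
        its two sides add up to the length of the interval times the same constant.\<close>
      have good: "\<bar>measure lborel K * f x - (F (Sup K) - F (Inf K))\<bar> \<le> e / 2 * (Sup K - Inf K)"
        if xK: "(x, K) \<in> p" "x \<notin> N" for x K
      proof -
        obtain u v where uv: "K = cbox u v" using pD(4)[OF xK(1)] by blast
        have x: "x \<in> K" "K \<subseteq> {a..b}" using pD(2,3)[OF xK(1)] by auto
        have "K \<subseteq> ball x (d x)" using fineD[OF fine xK(1)] xK(2) by (simp add: \<gamma>_def)
        moreover have uvK: "u \<in> K" "v \<in> K" "u \<le> x" "x \<le> v" using x(1) by (auto simp: uv)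
        ultimately have uv': "norm (u - x) < d x" "norm (v - x) < d x"
          by (auto simp: subset_iff dist_norm norm_minus_commute)
        have "\<bar>F u - F x - (u - x) * f x\<bar> \<le> e / 2 * (x - u)" "\<bar>F v - F x - (v - x) * f x\<bar> \<le> e / 2 * (v - x)"
        proof -
          have m: "u \<in> {a..b}" "v \<in> {a..b}" "x \<in> {a..b} - N" using uvK x xK(2) by auto
          have n: "norm (u - x) = x - u" "norm (v - x) = v - x" using uvK by auto
          show "\<bar>F u - F x - (u - x) * f x\<bar> \<le> e / 2 * (x - u)" "\<bar>F v - F x - (v - x) * f x\<bar> \<le> e / 2 * (v - x)"
            using d(2)[OF m(3,1) uv'(1)] d(2)[OF m(3,2) uv'(2)] unfolding n by simp_all
        qed
        then have "\<bar>(v - u) * f x - (F v - F u)\<bar> \<le> e / 2 * (v - u)"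
          unfolding abs_le_iff by (auto simp: algebra_simps)
        then show ?thesis using uvK by (simp add: uv)
      qed
      have "norm ((\<Sum>(x,K)\<in>p. measure lborel K *\<^sub>R g x) - (F b - F a))
          = \<bar>\<Sum>(x,K)\<in>p. measure lborel K * g x - (F (Sup K) - F (Inf K))\<bar>"
        unfolding real_sum[of F, symmetric] sum_subtractf[symmetric]
        by (simp add: split_def)
      also have "\<dots> \<le> (\<Sum>(x,K)\<in>p. e / 2 * (Sup K - Inf K) + (if x \<in> N then \<bar>F (Sup K) - F (Inf K)\<bar> else 0))"
      proof (rule order_trans[OF sum_abs], rule sum_mono)
        fix xK assume "xK \<in> p"
        then obtain x K where xK: "xK = (x, K)" "(x, K) \<in> p" by (cases xK) auto
        obtain u v where uv: "K = cbox u v" "u \<le> v" using pD(2,4)[OF xK(2)] by (metis cbox_interval atLeastAtMost_iff order_trans)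
        have "0 \<le> e / 2 * (Sup K - Inf K)" using uv e by simp
        then show "\<bar>case xK of (x, K) \<Rightarrow> measure lborel K * g x - (F (Sup K) - F (Inf K))\<bar>
            \<le> (case xK of (x, K) \<Rightarrow> e / 2 * (Sup K - Inf K) + (if x \<in> N then \<bar>F (Sup K) - F (Inf K)\<bar> else 0))"
          using good[OF xK(2)] by (auto simp: xK(1) g_def)
      qed
      also have "\<dots> = e / 2 * (\<Sum>(x,K)\<in>p. Sup K - Inf K)
          + (\<Sum>(x,K)\<in>p. if x \<in> N then \<bar>F (Sup K) - F (Inf K)\<bar> else 0)"
        unfolding split_def sum.distrib sum_distrib_left ..
      also have "(\<Sum>(x,K)\<in>p. if x \<in> N then \<bar>F (Sup K) - F (Inf K)\<bar> else 0) = (\<Sum>(x,K)\<in>pN. \<bar>F (Sup K) - F (Inf K)\<bar>)"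
        unfolding pN_def split_def by (rule sum.inter_filter[OF pD(1), symmetric])
      also have "(\<Sum>(x,K)\<in>p. Sup K - Inf K) = b - a" using real_sum[of "\<lambda>x. x"] by simp
      finally have "norm ((\<Sum>(x,K)\<in>p. measure lborel K *\<^sub>R g x) - (F b - F a))
          \<le> e / 2 * (b - a) + (\<Sum>(x,K)\<in>pN. \<bar>F (Sup K) - F (Inf K)\<bar>)" .
      also have "\<dots> \<le> e * (b - a)" using sumN by (simp add: field_simps)
      finally show ?thesis using ab by simp
    qed
    show "\<exists>\<gamma>. gauge \<gamma> \<and> (\<forall>p. p tagged_division_of cbox a b \<and> \<gamma> fine p \<longrightarrow>
        norm ((\<Sum>(x,k)\<in>p. measure lborel k *\<^sub>R g x) - (F b - F a)) \<le> e * measure lborel (cbox a b))"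
    proof (intro exI[of _ \<gamma>] conjI allI impI)
      show "gauge \<gamma>" by (rule gauge)
    qed (elim conjE, rule riemann)
  qed
  then show ?thesis
    using has_integral_spike[OF N, of "{a..b}" f g] by (simp add: g_def)
qed

text \<open>Two integrations by parts at once: \<open>Q p - R v\<close> has derivative
  \<open>Q d - q v\<close> almost everywhere, because the products of \<open>R\<close> and
  \<open>p\<close> cancel. Here p = v', and the second derivatives d and q need exist only off null
  sets.\<close>

lemma integration_by_parts_absolutely_continuous:
  fixes p v Q R :: "real \<Rightarrow> real"
  assumes ab: "a \<le> b" and p: "absolutely_continuous_fun_on {a..b} p"
    and N: "negligible N" "\<And>x. x \<in> {a..b} - N \<Longrightarrow> (p has_real_derivative d x) (at x within {a..b})"
    and v: "\<And>x. x \<in> {a..b} \<Longrightarrow> (v has_real_derivative p x) (at x within {a..b})"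
    and Q: "\<And>x. x \<in> {a..b} \<Longrightarrow> (Q has_real_derivative R x) (at x within {a..b})"
    and R: "L-lipschitz_on {a..b} R"
    and N': "negligible N'" "\<And>x. x \<in> {a..b} - N' \<Longrightarrow> (R has_real_derivative q x) (at x within {a..b})"
  shows "((\<lambda>x. Q x * d x - q x * v x) has_integral
           (Q b * p b - R b * v b - (Q a * p a - R a * v a))) {a..b}"
proof (rule fundamental_theorem_of_calculus_absolutely_continuous[OF ab])
  obtain LQ where LQ: "LQ-lipschitz_on {a..b} Q"
    using lipschitz_of_continuous_derivative[OF Q lipschitz_on_continuous_on[OF R]] by auto
  obtain Lv where Lv: "Lv-lipschitz_on {a..b} v"
    using lipschitz_of_continuous_derivative[OF v absolutely_continuous_fun_on_continuous[OF p]] by auto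
  show "absolutely_continuous_fun_on {a..b} (\<lambda>x. Q x * p x - R x * v x)"
    using absolutely_continuous_fun_on_mult_lipschitz[OF LQ p]
      absolutely_continuous_fun_on_mult_lipschitz[OF R absolutely_continuous_fun_on_lipschitz[OF Lv]]
    by (rule absolutely_continuous_fun_on_diff)
  show "negligible (N \<union> N')" using N(1) N'(1) by (rule negligible_Un)
  fix x assume x: "x \<in> {a..b} - (N \<union> N')"
  have "((\<lambda>x. Q x * p x - R x * v x) has_real_derivative
      (R x * p x + d x * Q x - (q x * v x + p x * R x))) (at x within {a..b})"
    using x by (intro DERIV_diff DERIV_mult N N' v Q) auto
  then show "((\<lambda>x. Q x * p x - R x * v x) has_vector_derivative (Q x * d x - q x * v x)) (at x within {a..b})"
    by (simp add: has_real_derivative_iff_has_vector_derivative algebra_simps)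
qed

section \<open>Clamped deflections and the bending energy\<close>

lemma integral_lincomb:
  fixes f g k :: "real \<Rightarrow> real"
  assumes "f integrable_on S" "g integrable_on S" "k integrable_on S"
  shows "integral S (\<lambda>y. f y - a * g y - b * k y) = integral S f - a * integral S g - b * integral S k"
  using integral_diff[OF integrable_diff[OF assms(1) integrable_on_mult_right[OF assms(2), of a]]
      integrable_on_mult_right[OF assms(3), of b]]
    integral_diff[OF assms(1) integrable_on_mult_right[OF assms(2), of a]]
  by (simp only: integral_mult_right)

text \<open>Integrability is not assumed, since a non-integrable function has integral 0 by
  convention.\<close>

lemma abs_integral_le:
  fixes f :: "real \<Rightarrow> real"
  assumes "a \<le> b" "\<And>x. x \<in> {a..b} \<Longrightarrow> \<bar>f x\<bar> \<le> M"
  shows "\<bar>integral {a..b} f\<bar> \<le> M * (b - a)"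
proof -
  have M: "0 \<le> M" using assms(2)[of a] assms(1) by force
  show ?thesis
  proof (cases "f integrable_on {a..b}")
    case True
    then show ?thesis
      using has_integral_bound[OF M, of f "integral {a..b} f" a b] assms by (simp add: has_integral_integral)
  next
    case False
    then show ?thesis using M assms(1) by (simp add: not_integrable_integral)
  qed
qed

lemma integral_pos_continuous:
  fixes f :: "real \<Rightarrow> real"
  assumes ab: "a < b" and f: "continuous_on {a..b} f" "\<And>x. x \<in> {a..b} \<Longrightarrow> 0 \<le> f x"
    and x: "x \<in> {a..b}" "0 < f x"
  shows "0 < integral {a..b} f"
proof -
  have "0 \<le> integral {a..b} f" using f by (intro integral_nonneg integrable_continuous_real) auto
  moreover have "integral {a..b} f \<noteq> 0"
  proof
    assume "integral {a..b} f = 0"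
    then have "(f has_integral 0) (cbox a b)"
      using integrable_integral[OF integrable_continuous_real[OF f(1)]] by simp
    then have "f x = 0"
      using has_integral_0_cbox_imp_0[of a b f x] f x ab by simp
    then show False using x(2) by simp
  qed
  ultimately show ?thesis by linarith
qed

locale weighted_interval =
  fixes T :: real and W :: "real \<Rightarrow> real"
  assumes T_pos: "0 < T" and W_cont: "continuous_on {0..T} W"
    and W_pos: "\<And>x. x \<in> {0..T} \<Longrightarrow> 0 < W x"
begin

text \<open>A deflection \<open>u\<close> is represented by its curvature \<open>z = u''\<close>, a continuous function, of which only
  the restriction to \<open>{0..T}\<close> matters.\<close>

definition slope :: "(real \<Rightarrow>\<^sub>C real) \<Rightarrow> real \<Rightarrow> real" where
  "slope z y = integral {0..y} (apply_bcontfun z)"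

definition deflection :: "(real \<Rightarrow>\<^sub>C real) \<Rightarrow> real \<Rightarrow> real" where
  "deflection z y = integral {0..y} (slope z)"

text \<open>The end conditions at 0 hold by construction, so two linear conditions at T
  remain.\<close>

definition clamped :: "(real \<Rightarrow>\<^sub>C real) set" where
  "clamped = {z. slope z T = 0 \<and> deflection z T = 0}"

definition bending :: "(real \<Rightarrow>\<^sub>C real) \<Rightarrow> (real \<Rightarrow>\<^sub>C real) \<Rightarrow> real" where
  "bending z w = integral {0..T} (\<lambda>y. W y * (z y * w y))"

lemma slope_deriv:
  "y \<in> {0..b} \<Longrightarrow> (slope z has_real_derivative z y) (at y within {0..b})"
  unfolding slope_def[abs_def] by (rule integral_has_real_derivative) auto

lemma slope_continuous: "continuous_on {0..b} (slope z)"
  using slope_deriv by (intro DERIV_continuous_on) auto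

lemma deflection_deriv:
  "y \<in> {0..b} \<Longrightarrow> (deflection z has_real_derivative slope z y) (at y within {0..b})"
  unfolding deflection_def[abs_def] by (rule integral_has_real_derivative) (rule slope_continuous)

lemma deflection_continuous: "continuous_on {0..b} (deflection z)"
  using deflection_deriv by (intro DERIV_continuous_on) auto

lemma slope_0 [simp]: "slope z 0 = 0" and deflection_0 [simp]: "deflection z 0 = 0"
  by (simp_all add: slope_def deflection_def)

lemma slope_add: "slope (z + w) y = slope z y + slope w y"
  by (simp add: slope_def plus_bcontfun.rep_eq integral_add integrable_continuous_real)

lemma slope_scaleR: "slope (c *\<^sub>R z) y = c * slope z y"
  by (simp add: slope_def scaleR_bcontfun.rep_eq)

lemma deflection_add: "deflection (z + w) y = deflection z y + deflection w y"
  unfolding deflection_def slope_add[abs_def]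
  by (intro integral_add integrable_continuous_real slope_continuous)

lemma deflection_scaleR: "deflection (c *\<^sub>R z) y = c * deflection z y"
  unfolding deflection_def slope_scaleR[abs_def] by simp

lemma bounded_linear_slope: "y \<in> {0..T} \<Longrightarrow> bounded_linear (\<lambda>z. slope z y)"
proof (rule bounded_linear_intro[where K = T])
  fix z assume y: "y \<in> {0..T}"
  have "\<bar>slope z y\<bar> \<le> norm z * (y - 0)"
    unfolding slope_def using y norm_bounded[of z] by (intro abs_integral_le) auto
  also have "\<dots> \<le> norm z * T" using y by (intro mult_left_mono) auto
  finally show "norm (slope z y) \<le> norm z * T" by simp
qed (simp_all add: slope_add slope_scaleR)

lemma bounded_linear_deflection: "y \<in> {0..T} \<Longrightarrow> bounded_linear (\<lambda>z. deflection z y)"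
proof (rule bounded_linear_intro[where K = "T * T"])
  fix z assume y: "y \<in> {0..T}"
  have "\<bar>slope z x\<bar> \<le> norm z * T" if "x \<in> {0..T}" for x
  proof -
    have "\<bar>slope z x\<bar> \<le> norm z * (x - 0)"
      unfolding slope_def using that norm_bounded[of z] by (intro abs_integral_le) auto
    also have "\<dots> \<le> norm z * T" using that by (intro mult_left_mono) auto
    finally show ?thesis .
  qed
  then have "\<bar>deflection z y\<bar> \<le> (norm z * T) * (y - 0)"
    unfolding deflection_def using y by (intro abs_integral_le) auto
  also have "\<dots> \<le> (norm z * T) * T" using y T_pos by (intro mult_left_mono) auto
  finally show "norm (deflection z y) \<le> norm z * (T * T)" by (simp add: mult.assoc)
qed (simp_all add: deflection_add deflection_scaleR)

lemma slope_deflection_minus: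
  "slope (- z) y = - slope z y" "deflection (- z) y = - deflection z y"
  using slope_scaleR[of "-1" z y] deflection_scaleR[of "-1" z y] by simp_all

lemma deflection_diff: "deflection (z - w) y = deflection z y - deflection w y"
  using deflection_add[of z "- w" y] by (simp add: slope_deflection_minus)

lemma slope_absolutely_continuous:
  "absolutely_continuous_fun_on {0..T} (slope z)"
proof -
  obtain L where "L-lipschitz_on {0..T} (slope z)"
    using lipschitz_of_continuous_derivative[OF slope_deriv, of T z] by auto
  then show ?thesis by (rule absolutely_continuous_fun_on_lipschitz)
qed

lemma subspace_clamped: "subspace clamped"
proof (rule subspaceI)
  show "0 \<in> clamped"
    using slope_scaleR[of 0 0 T] deflection_scaleR[of 0 0 T] by (simp add: clamped_def)
qed (simp_all add: clamped_def slope_add slope_scaleR deflection_add deflection_scaleR)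

lemma closed_clamped: "closed clamped"
proof -
  have "closed {z. slope z T = 0}" "closed {z. deflection z T = 0}"
    using T_pos
    by (auto intro!: closed_Collect_eq linear_continuous_on bounded_linear_slope bounded_linear_deflection)
  then show ?thesis unfolding clamped_def by (rule closed_Collect_conj)
qed

lemma W_bounds: "\<exists>w0 w1. 0 < w0 \<and> (\<forall>x\<in>{0..T}. w0 \<le> W x \<and> W x \<le> w1)"
proof -
  have ne: "{0..T} \<noteq> {}" using T_pos by simp
  obtain a b where "a \<in> {0..T}" "b \<in> {0..T}" "\<And>x. x \<in> {0..T} \<Longrightarrow> W a \<le> W x \<and> W x \<le> W b"
    using continuous_attains_inf[OF compact_Icc ne W_cont] continuous_attains_sup[OF compact_Icc ne W_cont]
    by metis
  then show ?thesis using W_pos by blast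
qed

lemma bending_integrable: "(\<lambda>y. W y * (apply_bcontfun z y * apply_bcontfun w y)) integrable_on {0..T}"
  by (intro integrable_continuous_real continuous_intros W_cont) auto

lemma bounded_bilinear_bending: "bounded_bilinear bending"
proof -
  obtain w1 where w1: "\<And>x. x \<in> {0..T} \<Longrightarrow> W x \<le> w1" using W_bounds by blast
  have w1': "0 \<le> w1" using w1[of 0] W_pos[of 0] T_pos by force
  show ?thesis
  proof
    show "bending (z + z') w = bending z w + bending z' w" for z z' w
      using integral_add[OF bending_integrable[of z w] bending_integrable[of z' w]]
      by (simp add: bending_def plus_bcontfun.rep_eq algebra_simps)
    show "bending z (w + w') = bending z w + bending z w'" for z w w'
      using integral_add[OF bending_integrable[of z w] bending_integrable[of z w']]
      by (simp add: bending_def plus_bcontfun.rep_eq algebra_simps)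
    show "bending (r *\<^sub>R z) w = r *\<^sub>R bending z w" for r z w
      by (simp add: bending_def scaleR_bcontfun.rep_eq mult_ac flip: integral_mult_right)
    show "bending z (r *\<^sub>R w) = r *\<^sub>R bending z w" for r z w
      by (simp add: bending_def scaleR_bcontfun.rep_eq mult_ac flip: integral_mult_right)
    show "\<exists>K. \<forall>z w. norm (bending z w) \<le> norm z * norm w * K"
    proof (intro exI allI)
      fix z w
      have "\<bar>bending z w\<bar> \<le> (w1 * (norm z * norm w)) * (T - 0)"
        unfolding bending_def
      proof (rule abs_integral_le)
        fix x assume x: "x \<in> {0..T}"
        have "\<bar>z x\<bar> * \<bar>w x\<bar> \<le> norm z * norm w"
          using norm_bounded[of z x] norm_bounded[of w x] by (intro mult_mono) auto
        then show "\<bar>W x * (z x * w x)\<bar> \<le> w1 * (norm z * norm w)"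
          using mult_mono[OF w1[OF x], of "\<bar>z x\<bar> * \<bar>w x\<bar>"] W_pos[OF x] w1' by (simp add: abs_mult)
      qed (use T_pos in simp)
      then show "norm (bending z w) \<le> norm z * norm w * (w1 * T)" by (simp add: mult_ac)
    qed
  qed
qed

sublocale semi_inner bending
proof (rule semi_inner.intro)
  show "bounded_bilinear bending" by (rule bounded_bilinear_bending)
  show "bending z w = bending w z" for z w by (simp add: bending_def mult_ac)
  show "0 \<le> bending z z" for z
    unfolding bending_def using W_pos by (intro integral_nonneg bending_integrable) (simp add: less_imp_le)
qed

text \<open>A form of the Cauchy--Schwarz inequality, from 2 \<lambda> |a| \<le> \<lambda>^2 + a^2
  with \<lambda> close to \<open>nrm z\<close>. The addition e / T keeps \<lambda> positive when the
  seminorm is 0 and disappears with e.\<close>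

lemma L1_le_nrm: "\<exists>C>0. \<forall>z. integral {0..T} (\<lambda>y. \<bar>apply_bcontfun z y\<bar>) \<le> C * nrm z"
proof -
  obtain w0 where w0: "0 < w0" "\<And>x. x \<in> {0..T} \<Longrightarrow> w0 \<le> W x" using W_bounds by blast
  have "integral {0..T} (\<lambda>y. \<bar>apply_bcontfun z y\<bar>) \<le> (T / 2 + 1 / (2 * w0)) * nrm z" for z
  proof (rule field_le_epsilon)
    fix e :: real assume e: "0 < e"
    define lam where "lam = nrm z + e / T"
    have lam: "0 < lam" using e T_pos by (simp add: lam_def add_nonneg_pos)
    have "integral {0..T} (\<lambda>y. \<bar>apply_bcontfun z y\<bar>)
        \<le> integral {0..T} (\<lambda>y. lam / 2 + 1 / (2 * w0 * lam) * (W y * (apply_bcontfun z y * apply_bcontfun z y)))"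
    proof (rule integral_le)
      show "(\<lambda>y. \<bar>apply_bcontfun z y\<bar>) integrable_on {0..T}"
        by (intro integrable_continuous_real continuous_intros) auto
      show "(\<lambda>y. lam / 2 + 1 / (2 * w0 * lam) * (W y * (apply_bcontfun z y * apply_bcontfun z y))) integrable_on {0..T}"
        by (intro integrable_continuous_real continuous_intros W_cont) auto
      fix y assume y: "y \<in> {0..T}"
      have "2 * lam * \<bar>apply_bcontfun z y\<bar> \<le> lam\<^sup>2 + (apply_bcontfun z y)\<^sup>2"
        using zero_le_power2[of "lam - \<bar>apply_bcontfun z y\<bar>"] by (simp add: power2_diff)
      also have "(apply_bcontfun z y)\<^sup>2 \<le> 1 / w0 * (W y * (apply_bcontfun z y)\<^sup>2)"
        using mult_right_mono[OF w0(2)[OF y], of "(apply_bcontfun z y)\<^sup>2"] w0(1) by (simp add: field_simps)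
      finally have "\<bar>apply_bcontfun z y\<bar> \<le> (lam\<^sup>2 + 1 / w0 * (W y * (apply_bcontfun z y)\<^sup>2)) / (2 * lam)"
        using lam by (simp add: field_simps)
      also have "\<dots> = lam / 2 + 1 / (2 * w0 * lam) * (W y * (apply_bcontfun z y * apply_bcontfun z y))"
        using lam w0(1) by (simp add: power2_eq_square add_divide_distrib)
      finally show "\<bar>apply_bcontfun z y\<bar> \<le> lam / 2 + 1 / (2 * w0 * lam) * (W y * (apply_bcontfun z y * apply_bcontfun z y))" .
    qed
    also have "\<dots> = lam / 2 * T + 1 / (2 * w0 * lam) * (nrm z)\<^sup>2"
      using T_pos by (subst integral_add[OF _ integrable_on_mult_right[OF bending_integrable]])
        (auto simp: nrm_square bending_def simp del: times_divide_eq_left)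
    also have "1 / (2 * w0 * lam) * (nrm z)\<^sup>2 \<le> 1 / (2 * w0) * nrm z"
    proof -
      have "nrm z * nrm z \<le> lam * nrm z"
        using e T_pos by (intro mult_right_mono) (auto simp: lam_def)
      then show ?thesis using lam w0(1) by (simp add: power2_eq_square field_simps)
    qed
    also have "lam / 2 * T = T / 2 * nrm z + e / 2"
      using T_pos by (simp add: lam_def field_simps)
    finally show "integral {0..T} (\<lambda>y. \<bar>apply_bcontfun z y\<bar>) \<le> (T / 2 + 1 / (2 * w0)) * nrm z + e"
      using e by (simp add: algebra_simps)
  qed
  then show ?thesis
    using w0(1) T_pos by (intro exI[of _ "T / 2 + 1 / (2 * w0)"]) (auto intro: add_pos_pos)
qed

text \<open>The embedding constant: it bounds slopes, and after one more integration deflections, by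
  the seminorm.\<close>

definition emb :: real where
  "emb = (SOME C. 0 < C \<and> (\<forall>z. integral {0..T} (\<lambda>y. \<bar>apply_bcontfun z y\<bar>) \<le> C * nrm z))"

lemma emb_pos: "0 < emb"
  and L1_le: "integral {0..T} (\<lambda>y. \<bar>apply_bcontfun z y\<bar>) \<le> emb * nrm z"
proof -
  have "0 < emb \<and> (\<forall>z. integral {0..T} (\<lambda>y. \<bar>apply_bcontfun z y\<bar>) \<le> emb * nrm z)"
    unfolding emb_def using L1_le_nrm by (rule someI_ex)
  then show "0 < emb" "integral {0..T} (\<lambda>y. \<bar>apply_bcontfun z y\<bar>) \<le> emb * nrm z" by auto
qed

lemma slope_le: "y \<in> {0..T} \<Longrightarrow> \<bar>slope z y\<bar> \<le> emb * nrm z"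
proof -
  assume y: "y \<in> {0..T}"
  have "\<bar>slope z y\<bar> \<le> integral {0..y} (\<lambda>y. \<bar>apply_bcontfun z y\<bar>)"
    unfolding slope_def real_norm_def[symmetric]
    by (intro integral_norm_bound_integral integrable_continuous_real continuous_intros) auto
  also have "\<dots> \<le> integral {0..T} (\<lambda>y. \<bar>apply_bcontfun z y\<bar>)"
    using y by (intro integral_subset_le integrable_continuous_real continuous_intros) auto
  finally show ?thesis using L1_le[of z] by simp
qed

text \<open>This supplies equicontinuity for the compactness argument and controls a deflection
  between grid points.\<close>

lemma deflection_lipschitz: "(emb * nrm z)-lipschitz_on {0..T} (deflection z)"
proof (rule bounded_derivative_imp_lipschitz)
  show "(deflection z has_derivative (*) (slope z x)) (at x within {0..T})" if "x \<in> {0..T}" for x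
    using deflection_deriv[OF that] by (simp add: has_field_derivative_def)
  show "onorm ((*) (slope z x)) \<le> emb * nrm z" if "x \<in> {0..T}" for x
    using slope_le[OF that] by (intro onorm_le) (simp add: abs_mult mult_right_mono)
qed (use emb_pos in auto)

lemma deflection_le: "y \<in> {0..T} \<Longrightarrow> \<bar>deflection z y\<bar> \<le> emb * T * nrm z"
proof -
  assume y: "y \<in> {0..T}"
  have "\<bar>deflection z y\<bar> \<le> emb * nrm z * y"
    using lipschitz_onD[OF deflection_lipschitz y, of 0 z] y by (simp add: dist_real_def)
  also have "\<dots> \<le> emb * nrm z * T"
    using y emb_pos by (intro mult_left_mono) auto
  finally show ?thesis by (simp add: mult_ac)
qed

text \<open>Mass, centre of mass and moment of inertia of a rod with density 1 / W. With the origin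
  at the centre, the functions 1 and y - centre are orthogonal for this density, so the two
  coefficients of an affine projection decouple.\<close>

definition mass :: real where "mass = integral {0..T} (\<lambda>y. 1 / W y)"
definition centre :: real where "centre = integral {0..T} (\<lambda>y. y / W y) / mass"
definition inertia :: real where "inertia = integral {0..T} (\<lambda>y. (y - centre)\<^sup>2 / W y)"

lemma W_nonzero: "x \<in> {0..T} \<Longrightarrow> W x \<noteq> 0"
  using W_pos by force

lemma mass_pos: "0 < mass"
  unfolding mass_def using T_pos W_pos W_nonzero
  by (intro integral_pos_continuous[where x = 0] continuous_intros W_cont) (auto simp: less_imp_le)

lemma inertia_pos: "0 < inertia"
proof -
  have "0 < (0 - centre)\<^sup>2 / W 0 \<or> 0 < (T - centre)\<^sup>2 / W T"
    using T_pos W_pos[of 0] W_pos[of T] by (cases "centre = 0") auto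
  moreover have "0 \<in> {0..T}" "T \<in> {0..T}" using T_pos by auto
  ultimately obtain x where "x \<in> {0..T}" "0 < (x - centre)\<^sup>2 / W x" by blast
  then show ?thesis
    unfolding inertia_def using T_pos W_pos W_nonzero
    by (intro integral_pos_continuous[where x = x] continuous_intros W_cont) (auto simp: less_imp_le)
qed

definition mean :: "(real \<Rightarrow> real) \<Rightarrow> real" where
  "mean h = integral {0..T} (\<lambda>y. h y / W y) / mass"
definition moment :: "(real \<Rightarrow> real) \<Rightarrow> real" where
  "moment h = integral {0..T} (\<lambda>y. (y - centre) * h y / W y) / inertia"
text \<open>The curvature whose bending moment, W times curvature, is \<open>h\<close> up to an
  affine function; the affine part is the orthogonal projection for the density 1 / W, which makes
  the result clamped.\<close>

definition project :: "(real \<Rightarrow> real) \<Rightarrow> real \<Rightarrow> real" where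
  "project h y = (h y - mean h - moment h * (y - centre)) / W y"

lemma project_continuous: "continuous_on {0..T} h \<Longrightarrow> continuous_on {0..T} (project h)"
  unfolding project_def[abs_def] using W_nonzero by (intro continuous_intros W_cont) auto

lemma int_centre: "integral {0..T} (\<lambda>y. (y - centre) / W y) = 0"
proof -
  have "integral {0..T} (\<lambda>y. y / W y - centre * (1 / W y)) =
      integral {0..T} (\<lambda>y. y / W y) - centre * integral {0..T} (\<lambda>y. 1 / W y)"
  proof -
    have I: "(\<lambda>y. y / W y) integrable_on {0..T}" "(\<lambda>y. centre * (1 / W y)) integrable_on {0..T}"
      using W_nonzero by (auto intro!: integrable_continuous_real continuous_intros W_cont)
    show ?thesis unfolding integral_diff[OF I] integral_mult_right ..
  qed
  also have "\<dots> = 0" using mass_pos by (simp add: centre_def mass_def)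
  finally show ?thesis by (simp add: diff_divide_distrib)
qed

lemma int_project:
  assumes h: "continuous_on {0..T} h"
  shows "integral {0..T} (project h) = 0" "integral {0..T} (\<lambda>y. (y - centre) * project h y) = 0"
proof -
  have I: "(\<lambda>y. h y / W y) integrable_on {0..T}" "(\<lambda>y. 1 / W y) integrable_on {0..T}"
    "(\<lambda>y. (y - centre) / W y) integrable_on {0..T}" "(\<lambda>y. (y - centre) * h y / W y) integrable_on {0..T}"
    "(\<lambda>y. (y - centre)\<^sup>2 / W y) integrable_on {0..T}"
    using W_nonzero by (auto intro!: integrable_continuous_real continuous_intros W_cont h)
  have "integral {0..T} (project h) =
      integral {0..T} (\<lambda>y. h y / W y - mean h * (1 / W y) - moment h * ((y - centre) / W y))"
    unfolding project_def using W_nonzero by (intro integral_cong) (simp add: field_simps)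
  also have "\<dots> = integral {0..T} (\<lambda>y. h y / W y) - mean h * mass - moment h * 0"
    unfolding integral_lincomb[OF I(1,2,3)] int_centre mass_def ..
  also have "\<dots> = 0" using mass_pos by (simp add: mean_def)
  finally show "integral {0..T} (project h) = 0" .
  have "integral {0..T} (\<lambda>y. (y - centre) * project h y) =
      integral {0..T} (\<lambda>y. (y - centre) * h y / W y - mean h * ((y - centre) / W y)
         - moment h * ((y - centre)\<^sup>2 / W y))"
    unfolding project_def using W_nonzero
    by (intro integral_cong) (simp add: field_simps power2_eq_square)
  also have "\<dots> = integral {0..T} (\<lambda>y. (y - centre) * h y / W y) - mean h * 0 - moment h * inertia"
    unfolding integral_lincomb[OF I(4,3,5)] int_centre inertia_def ..
  also have "\<dots> = 0" using inertia_pos by (simp add: moment_def)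
  finally show "integral {0..T} (\<lambda>y. (y - centre) * project h y) = 0" .
qed

lemma project_diff:
  assumes "continuous_on {0..T} h" "continuous_on {0..T} k"
  shows "project h y - project k y = project (\<lambda>x. h x - k x) y"
proof -
  have "mean (\<lambda>x. h x - k x) = mean h - mean k"
  proof -
    have "integral {0..T} (\<lambda>y. h y / W y - k y / W y) = integral {0..T} (\<lambda>y. h y / W y) - integral {0..T} (\<lambda>y. k y / W y)"
      using W_nonzero assms by (intro integral_diff integrable_continuous_real continuous_intros W_cont) auto
    then show ?thesis by (simp add: mean_def diff_divide_distrib)
  qed
  moreover have "moment (\<lambda>x. h x - k x) = moment h - moment k"
  proof -
    have "integral {0..T} (\<lambda>y. (y - centre) * h y / W y - (y - centre) * k y / W y) =
        integral {0..T} (\<lambda>y. (y - centre) * h y / W y) - integral {0..T} (\<lambda>y. (y - centre) * k y / W y)"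
      using W_nonzero assms by (intro integral_diff integrable_continuous_real continuous_intros W_cont) auto
    moreover have "(\<lambda>y. (y - centre) * h y / W y - (y - centre) * k y / W y) =
        (\<lambda>y. (y - centre) * (h y - k y) / W y)"
      by (simp add: fun_eq_iff right_diff_distrib diff_divide_distrib)
    ultimately show ?thesis by (simp add: moment_def diff_divide_distrib)
  qed
  ultimately show ?thesis
    by (simp add: project_def diff_divide_distrib left_diff_distrib)
qed

lemma project_bound: "\<exists>C>0. \<forall>h \<epsilon>. (\<forall>y\<in>{0..T}. \<bar>h y\<bar> \<le> \<epsilon>) \<longrightarrow> (\<forall>y\<in>{0..T}. \<bar>project h y\<bar> \<le> C * \<epsilon>)"
proof -
  obtain w0 where w0: "0 < w0" "\<And>x. x \<in> {0..T} \<Longrightarrow> w0 \<le> W x" using W_bounds by blast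
  define L where "L = T + \<bar>centre\<bar>"
  have L: "0 < L" "\<And>y. y \<in> {0..T} \<Longrightarrow> \<bar>y - centre\<bar> \<le> L" using T_pos by (auto simp: L_def)
  define C where "C = (1 + T / w0 / mass + L * T / w0 / inertia * L) / w0"
  have "0 < C"
    unfolding C_def using w0(1) T_pos mass_pos inertia_pos L(1)
    by (intro divide_pos_pos add_pos_pos mult_pos_pos) auto
  moreover have "\<bar>project h y\<bar> \<le> C * \<epsilon>" if h: "\<forall>y\<in>{0..T}. \<bar>h y\<bar> \<le> \<epsilon>" and y: "y \<in> {0..T}" for h \<epsilon> y
  proof -
    have \<epsilon>: "0 \<le> \<epsilon>" using h y by force
    have q: "\<bar>h x\<bar> / W x \<le> \<epsilon> / w0" if "x \<in> {0..T}" for x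
      using h w0 that \<epsilon> W_pos[OF that] by (intro frac_le) auto
    have "\<bar>integral {0..T} (\<lambda>y. h y / W y)\<bar> \<le> \<epsilon> / w0 * (T - 0)"
    proof (rule abs_integral_le)
      show "\<bar>h x / W x\<bar> \<le> \<epsilon> / w0" if "x \<in> {0..T}" for x
        using q[OF that] W_pos[OF that] by (simp add: abs_divide)
    qed (use T_pos in simp)
    then have m: "\<bar>mean h\<bar> \<le> \<epsilon> / w0 * T / mass"
      using mass_pos divide_right_mono[of "\<bar>integral {0..T} (\<lambda>y. h y / W y)\<bar>" "\<epsilon> / w0 * T" mass]
      by (simp add: mean_def abs_divide)
    have "\<bar>integral {0..T} (\<lambda>y. (y - centre) * h y / W y)\<bar> \<le> (L * (\<epsilon> / w0)) * (T - 0)"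
    proof (rule abs_integral_le)
      fix x assume x: "x \<in> {0..T}"
      have "\<bar>(x - centre) * h x / W x\<bar> = \<bar>x - centre\<bar> * (\<bar>h x\<bar> / W x)"
        using W_pos[OF x] by (simp add: abs_mult abs_divide)
      also have "\<dots> \<le> L * (\<epsilon> / w0)"
        using L(2)[OF x] L(1) q[OF x] W_pos[OF x] by (intro mult_mono) auto
      finally show "\<bar>(x - centre) * h x / W x\<bar> \<le> L * (\<epsilon> / w0)" .
    qed (use T_pos in simp)
    then have mo: "\<bar>moment h\<bar> \<le> L * (\<epsilon> / w0) * T / inertia"
      using inertia_pos divide_right_mono[of "\<bar>integral {0..T} (\<lambda>y. (y - centre) * h y / W y)\<bar>"
        "L * (\<epsilon> / w0) * T" inertia]
      by (simp add: moment_def abs_divide)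
    have "\<bar>h y - mean h - moment h * (y - centre)\<bar> \<le> \<bar>h y\<bar> + \<bar>mean h\<bar> + \<bar>moment h\<bar> * \<bar>y - centre\<bar>"
      using abs_triangle_ineq4[of "h y - mean h" "moment h * (y - centre)"] abs_triangle_ineq4[of "h y" "mean h"]
      by (simp add: abs_mult)
    also have "\<dots> \<le> \<epsilon> + \<epsilon> / w0 * T / mass + (L * (\<epsilon> / w0) * T / inertia) * L"
      using h y m mo L by (intro add_mono mult_mono) auto
    finally have "\<bar>project h y\<bar> \<le> (\<epsilon> + \<epsilon> / w0 * T / mass + (L * (\<epsilon> / w0) * T / inertia) * L) / w0"
      unfolding project_def abs_divide using w0 y W_pos[OF y] by (intro frac_le) auto
    also have "\<dots> = C * \<epsilon>" by (simp add: C_def algebra_simps add_divide_distrib)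
    finally show ?thesis .
  qed
  ultimately show ?thesis by blast
qed

text \<open>The extension is constant on either side of {0..T}, so the sup norm over the line is the
  one over the interval.\<close>

definition curvature :: "(real \<Rightarrow> real) \<Rightarrow> real \<Rightarrow>\<^sub>C real" where
  "curvature h = Bcontfun (ext_cont (project h) 0 T)"

lemma apply_curvature:
  assumes "continuous_on {0..T} h"
  shows "apply_bcontfun (curvature h) = ext_cont (project h) 0 T"
proof -
  have c: "continuous_on (cbox 0 T) (project h)" using project_continuous[OF assms] by simp
  have "ext_cont (project h) 0 T \<in> bcontfun"
  proof -
    obtain M where M: "\<And>y. y \<in> cbox 0 T \<Longrightarrow> norm (project h y) \<le> M"
      using compact_imp_bounded[OF compact_continuous_image[OF c compact_cbox]]
      unfolding bounded_iff by blast
    have "clamp 0 T y \<in> cbox 0 T" for y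
      using T_pos by (intro clamp_in_interval) auto
    then show ?thesis
      using M c by (intro bcontfun_normI[where b = M] continuous_on_ext_cont) (auto simp: ext_cont_def)
  qed
  then show ?thesis by (simp add: curvature_def Bcontfun_inverse)
qed

lemma curvature_eq:
  "continuous_on {0..T} h \<Longrightarrow> y \<in> {0..T} \<Longrightarrow> apply_bcontfun (curvature h) y = project h y"
  by (simp add: apply_curvature)

lemma curvature_dist: "\<exists>C>0. \<forall>h k \<epsilon>. continuous_on {0..T} h \<longrightarrow> continuous_on {0..T} k \<longrightarrow>
    (\<forall>y\<in>{0..T}. \<bar>h y - k y\<bar> \<le> \<epsilon>) \<longrightarrow> norm (curvature h - curvature k) \<le> C * \<epsilon>"
proof -
  obtain C where C: "C > 0" "\<And>h \<epsilon> y. (\<forall>y\<in>{0..T}. \<bar>h y\<bar> \<le> \<epsilon>) \<Longrightarrow> y \<in> {0..T} \<Longrightarrow> \<bar>project h y\<bar> \<le> C * \<epsilon>"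
    using project_bound by blast
  have "norm (curvature h - curvature k) \<le> C * \<epsilon>"
    if hk: "continuous_on {0..T} h" "continuous_on {0..T} k" and \<epsilon>: "\<forall>y\<in>{0..T}. \<bar>h y - k y\<bar> \<le> \<epsilon>" for h k \<epsilon>
  proof (rule norm_bound)
    fix x
    have "clamp 0 T x \<in> cbox 0 T" using T_pos by (intro clamp_in_interval) auto
    then have x: "clamp 0 T x \<in> {0..T}" by simp
    have "apply_bcontfun (curvature h - curvature k) x = project (\<lambda>x. h x - k x) (clamp 0 T x)"
      using project_diff[OF hk, of "clamp 0 T x"]
      by (simp add: minus_bcontfun.rep_eq apply_curvature hk ext_cont_def)
    then show "norm (apply_bcontfun (curvature h - curvature k) x) \<le> C * \<epsilon>"
      using C(2)[OF \<epsilon> x] by simp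
  qed
  then show ?thesis using C(1) by blast
qed

lemma deflection_T: "deflection z T = T * slope z T - integral {0..T} (\<lambda>y. y * z y)"
proof -
  have "((\<lambda>y. y * z y) has_integral (T * slope z T - deflection z T - (0 * slope z 0 - deflection z 0))) {0..T}"
  proof (rule fundamental_theorem_of_calculus)
    show "((\<lambda>y. y * slope z y - deflection z y) has_vector_derivative y * z y) (at y within {0..T})"
      if "y \<in> {0..T}" for y
      unfolding has_real_derivative_iff_has_vector_derivative[symmetric]
      using that by (auto intro!: derivative_eq_intros slope_deriv deflection_deriv)
  qed (use T_pos in simp)
  then show ?thesis by (simp add: integral_unique)
qed

text \<open>By parts, the end conditions at T are orthogonality to affine functions;
  \<open>y - centre\<close> replaces \<open>y\<close> to fit \<open>project\<close>.\<close>

lemma clamped_iff: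
  "z \<in> clamped \<longleftrightarrow> integral {0..T} (apply_bcontfun z) = 0 \<and> integral {0..T} (\<lambda>y. (y - centre) * z y) = 0"
proof -
  have "integral {0..T} (\<lambda>y. y * z y - centre * z y)
      = integral {0..T} (\<lambda>y. y * z y) - centre * integral {0..T} (apply_bcontfun z)"
    by (subst integral_diff) (auto intro!: integrable_continuous_real continuous_intros)
  then show ?thesis
    using deflection_T[of z] by (auto simp: clamped_def slope_def left_diff_distrib)
qed

lemma curvature_clamped:
  assumes "continuous_on {0..T} h" shows "curvature h \<in> clamped"
proof -
  have "integral {0..T} (apply_bcontfun (curvature h)) = integral {0..T} (project h)"
    "integral {0..T} (\<lambda>y. (y - centre) * apply_bcontfun (curvature h) y) = integral {0..T} (\<lambda>y. (y - centre) * project h y)"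
    by (intro integral_cong; simp add: curvature_eq assms)+
  then show ?thesis unfolding clamped_iff by (simp add: int_project[OF assms])
qed

text \<open>The weight cancels, and clamped curvatures annihilate the affine part. So
  \<open>curvature h\<close> is the Riesz representative of integration against
  \<open>h\<close>.\<close>

lemma bending_curvature:
  assumes h: "continuous_on {0..T} h" and d: "d \<in> clamped"
  shows "bending (curvature h) d = integral {0..T} (\<lambda>y. h y * d y)"
proof -
  have "bending (curvature h) d = integral {0..T} (\<lambda>y. h y * d y - mean h * d y - moment h * ((y - centre) * d y))"
    unfolding bending_def
  proof (rule integral_cong)
    fix y assume y: "y \<in> {0..T}"
    show "W y * (apply_bcontfun (curvature h) y * d y) = h y * d y - mean h * d y - moment h * ((y - centre) * d y)"
      using W_nonzero[OF y] by (simp add: curvature_eq[OF h y] project_def field_simps)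
  qed
  also have "\<dots> = integral {0..T} (\<lambda>y. h y * d y) - mean h * integral {0..T} (apply_bcontfun d)
      - moment h * integral {0..T} (\<lambda>y. (y - centre) * d y)"
  proof -
    have I: "(\<lambda>y. h y * d y) integrable_on {0..T}" "(\<lambda>y. mean h * d y) integrable_on {0..T}"
      "(\<lambda>y. moment h * ((y - centre) * d y)) integrable_on {0..T}"
      by (intro integrable_continuous_real continuous_intros h; auto)+
    show ?thesis
      by (simp add: integral_diff[OF integrable_diff[OF I(1,2)] I(3)] integral_diff[OF I(1,2)])
  qed
  also have "\<dots> = integral {0..T} (\<lambda>y. h y * d y)" using d unfolding clamped_iff by simp
  finally show ?thesis .
qed

end

section \<open>The action of an impulsive load\<close>

lemma absolutely_integrable_finite_discontinuities:
  fixes f :: "real \<Rightarrow> real"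
  assumes P: "finite P" and f: "continuous_on ({a..b} - P) f" and C: "\<And>x. x \<in> {a..b} \<Longrightarrow> \<bar>f x\<bar> \<le> C"
  shows "f absolutely_integrable_on {a..b}"
proof -
  have nP: "negligible P" using P by (rule negligible_finite)
  have S: "{a..b} - P \<in> sets lebesgue"
    using nP by (intro sets.Diff) (auto intro: negligible_imp_sets)
  have spike: "h absolutely_integrable_on ({a..b} - P) \<longleftrightarrow> h absolutely_integrable_on {a..b}" for h :: "real \<Rightarrow> real"
    by (rule absolutely_integrable_spike_set_eq; rule negligible_subset[OF nP]; auto)
  have "(\<lambda>x. C) absolutely_integrable_on {a..b}" by simp
  then have "(\<lambda>x. C) integrable_on ({a..b} - P)"
    unfolding spike[symmetric] by (rule set_lebesgue_integral_eq_integral(1))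
  then have "f absolutely_integrable_on ({a..b} - P)"
    using C by (intro measurable_bounded_by_integrable_imp_absolutely_integrable
        continuous_imp_measurable_on_sets_lebesgue f S) auto
  then show ?thesis unfolding spike .
qed

lemma uniform_dominated_convergence:
  fixes F :: "real \<Rightarrow> (real \<Rightarrow> real) set"
  assumes mono: "\<And>\<kappa> \<kappa>'. \<kappa> \<le> \<kappa>' \<Longrightarrow> F \<kappa> \<subseteq> F \<kappa>'"
    and int: "\<And>\<kappa> r. r \<in> F \<kappa> \<Longrightarrow> r integrable_on {a..b}"
    and bound: "\<And>\<kappa> r x. r \<in> F \<kappa> \<Longrightarrow> x \<in> {a..b} \<Longrightarrow> \<bar>r x\<bar> \<le> C"
    and ptw: "\<And>x \<epsilon>. x \<in> {a..b} \<Longrightarrow> 0 < \<epsilon> \<Longrightarrow> \<exists>\<kappa>>0. \<forall>r\<in>F \<kappa>. \<bar>r x\<bar> \<le> \<epsilon>"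
    and \<epsilon>: "0 < \<epsilon>"
  shows "\<exists>\<kappa>>0. \<forall>r\<in>F \<kappa>. \<bar>integral {a..b} r\<bar> \<le> \<epsilon>"
proof (rule ccontr)
  assume "\<not> ?thesis"
  then have "\<exists>r\<in>F (inverse (real (Suc n))). \<epsilon> < \<bar>integral {a..b} r\<bar>" for n
    by (meson not_le inverse_positive_iff_positive of_nat_0_less_iff zero_less_Suc)
  then obtain r where r: "\<And>n. r n \<in> F (inverse (real (Suc n)))" "\<And>n. \<epsilon> < \<bar>integral {a..b} (r n)\<bar>"
    by metis
  have "(\<lambda>n. integral {a..b} (r n)) \<longlonglongrightarrow> integral {a..b} (\<lambda>x. 0)"
  proof (rule dominated_convergence(2)[where h = "\<lambda>_. C"])
    show "r n integrable_on {a..b}" for n using int r(1) by blast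
    show "norm (r n x) \<le> C" if "x \<in> {a..b}" for n x using bound[OF r(1)[of n] that] by simp
    show "(\<lambda>n. r n x) \<longlonglongrightarrow> 0" if x: "x \<in> {a..b}" for x
    proof (rule LIMSEQ_I)
      fix e :: real assume "0 < e"
      then obtain \<kappa> where \<kappa>: "\<kappa> > 0" "\<And>r. r \<in> F \<kappa> \<Longrightarrow> \<bar>r x\<bar> \<le> e / 2"
        using ptw[OF x, of "e / 2"] by auto
      obtain no where no: "inverse (real (Suc no)) < \<kappa>" using reals_Archimedean[OF \<kappa>(1)] by blast
      have "norm (r n x - 0) < e" if "no \<le> n" for n
      proof -
        have "inverse (real (Suc n)) \<le> inverse (real (Suc no))"
          using that by (intro le_imp_inverse_le) auto
        then have "inverse (real (Suc n)) \<le> \<kappa>" using no by linarith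
        then have "r n \<in> F \<kappa>" using mono r(1)[of n] by blast
        then show ?thesis using \<kappa>(2) \<open>0 < e\<close> by fastforce
      qed
      then show "\<exists>no. \<forall>n\<ge>no. norm (r n x - 0) < e" by blast
    qed
  qed auto
  then have "(\<lambda>n. \<bar>integral {a..b} (r n)\<bar>) \<longlonglongrightarrow> 0" by (simp add: tendsto_rabs_zero)
  then have "\<epsilon> \<le> 0" using r(2) by (intro LIMSEQ_le_const) (auto intro: less_imp_le)
  then show False using \<epsilon> by simp
qed

lemma mean_value_abs:
  fixes F :: "real \<Rightarrow> real"
  assumes "\<And>r. (F has_real_derivative f r) (at r)"
  shows "\<exists>\<xi>. \<bar>\<xi> - a\<bar> \<le> \<bar>b - a\<bar> \<and> F b - F a = f \<xi> * (b - a)"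
proof (cases "a = b")
  case False
  then consider "a < b" | "b < a" by linarith
  then show ?thesis
  proof cases
    case 1
    then obtain z where "a < z" "z < b" "F b - F a = (b - a) * f z"
      using MVT2[of a b F f] assms by auto
    then show ?thesis by (intro exI[of _ z]) auto
  next
    case 2
    then obtain z where "b < z" "z < a" "F a - F b = (a - b) * f z"
      using MVT2[of b a F f] assms by auto
    then show ?thesis by (intro exI[of _ z]) (auto simp: algebra_simps)
  qed
qed auto

lemma even_antiderivative_of_odd:
  fixes F :: "real \<Rightarrow> real"
  assumes "\<And>r. (F has_real_derivative f r) (at r)" "\<And>r. f (- r) = - f r"
  shows "F (- r) = F r"
proof -
  have "((\<lambda>r. F (- r) - F r) has_real_derivative 0) (at r)" for r
    using DERIV_diff[OF DERIV_chain2[OF assms(1)[of "- r"] DERIV_minus[OF DERIV_ident]] assms(1)[of r]]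
      assms(2)[of r] by simp
  then have "F (- r) - F r = F (- 0) - F 0"
    by (intro DERIV_isconst_all) auto
  then show ?thesis by simp
qed

lemma modulus_unif:
  fixes f :: "real \<Rightarrow> real"
  assumes "uniformly_continuous_on UNIV f" "0 < \<epsilon>"
  shows "\<exists>\<kappa>>0. \<forall>r s. \<bar>r - s\<bar> \<le> \<kappa> \<longrightarrow> \<bar>f r - f s\<bar> \<le> \<epsilon>"
proof -
  obtain \<kappa> where "\<kappa> > 0" "\<And>r s. dist s r < \<kappa> \<Longrightarrow> dist (f s) (f r) < \<epsilon>"
    using assms unfolding uniformly_continuous_on_def by blast
  then show ?thesis
    by (intro exI[of _ "\<kappa> / 2"]) (force simp: dist_real_def intro: less_imp_le)
qed

text \<open>The nonlinearities are bounded and defined for all deflections, so that the functional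
  lives on a whole subspace; the weight is meant to be contained in \<open>g\<close> and
  \<open>J\<close>. \<open>P\<close> holds the points where the force switches on or off.\<close>

locale impulsive_beam = weighted_interval T W for T and W :: "real \<Rightarrow> real" +
  fixes \<beta> M :: real and g G :: "real \<Rightarrow> real \<Rightarrow> real" and P :: "real set"
    and N :: nat and t :: "nat \<Rightarrow> real" and J K :: "nat \<Rightarrow> real \<Rightarrow> real"
  assumes finite_P: "finite P"
    and g_cont: "\<And>u. continuous_on {0..T} u \<Longrightarrow> continuous_on ({0..T} - P) (\<lambda>x. g x (u x))"
    and G_cont: "\<And>u. continuous_on {0..T} u \<Longrightarrow> continuous_on ({0..T} - P) (\<lambda>x. G x (u x))"
    and g_bound: "\<And>x r. x \<in> {0..T} \<Longrightarrow> \<bar>g x r\<bar> \<le> M"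
    and g_unif: "\<And>x. x \<in> {0..T} \<Longrightarrow> uniformly_continuous_on UNIV (g x)"
    and g_odd: "\<And>x r. x \<in> {0..T} \<Longrightarrow> g x (- r) = - g x r"
    and G_deriv: "\<And>x r. x \<in> {0..T} \<Longrightarrow> (G x has_real_derivative g x r) (at r)"
    and G_0: "\<And>x. x \<in> {0..T} \<Longrightarrow> G x 0 = 0"
    and J_bound: "\<And>i r. i \<in> {1..N} \<Longrightarrow> \<bar>J i r\<bar> \<le> M"
    and J_unif: "\<And>i. i \<in> {1..N} \<Longrightarrow> uniformly_continuous_on UNIV (J i)"
    and J_odd: "\<And>i r. i \<in> {1..N} \<Longrightarrow> J i (- r) = - J i r"
    and K_deriv: "\<And>i r. i \<in> {1..N} \<Longrightarrow> (K i has_real_derivative J i r) (at r)"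
    and K_0: "\<And>i. i \<in> {1..N} \<Longrightarrow> K i 0 = 0"
    and t_mem: "\<And>i. i \<in> {1..N} \<Longrightarrow> t i \<in> {0..T}"
begin

definition load :: "(real \<Rightarrow> real) \<Rightarrow> (real \<Rightarrow> real) \<Rightarrow> real" where
  "load u v = integral {0..T} (\<lambda>x. g x (u x) * v x) + (\<Sum>i=1..N. J i (u (t i)) * v (t i))"

definition potential :: "(real \<Rightarrow> real) \<Rightarrow> real" where
  "potential u = integral {0..T} (\<lambda>x. G x (u x)) + (\<Sum>i=1..N. K i (u (t i)))"

text \<open>The second primitive of the load: the ramp starting at \<open>t i\<close> is the second
  primitive of a unit point load at \<open>t i\<close>.\<close>

definition load_moment :: "(real \<Rightarrow> real) \<Rightarrow> real \<Rightarrow> real" where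
  "load_moment u y = integral {0..y} (\<lambda>x. integral {0..x} (\<lambda>\<xi>. g \<xi> (u \<xi>)))
     + (\<Sum>i=1..N. J i (u (t i)) * max 0 (y - t i))"

text \<open>The Riesz representative of the derivative of the action, see \<open>bending_response\<close>; its fixed
  points are the weak solutions.\<close>

definition response :: "(real \<Rightarrow> real) \<Rightarrow> real \<Rightarrow>\<^sub>C real" where
  "response u = curvature (\<lambda>y. load_moment u y - \<beta> * u y)"

text \<open>For clamped curvatures the last term is \<beta> / 2 times the integral of the squared
  slope, by parts.\<close>

definition action :: "(real \<Rightarrow>\<^sub>C real) \<Rightarrow> real" where
  "action z = potential (deflection z) - \<beta> / 2 * integral {0..T} (\<lambda>y. deflection z y * z y)"

lemma M_nonneg: "0 \<le> M"
  using g_bound[of 0 0] T_pos by force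

lemma g_integrable:
  assumes "continuous_on {0..T} u"
  shows "(\<lambda>x. g x (u x)) integrable_on {0..T}"
  using absolutely_integrable_finite_discontinuities[OF finite_P g_cont[OF assms], of M] g_bound
  by (simp add: set_lebesgue_integral_eq_integral(1))

lemma gv_absolutely_integrable:
  assumes "continuous_on {0..T} u" "continuous_on {0..T} v"
  shows "(\<lambda>x. g x (u x) * v x) absolutely_integrable_on {0..T}"
proof -
  obtain C where C: "\<And>x. x \<in> {0..T} \<Longrightarrow> \<bar>v x\<bar> \<le> C"
    using compact_imp_bounded[OF compact_continuous_image[OF assms(2) compact_Icc]]
    unfolding bounded_iff real_norm_def by blast
  show ?thesis
  proof (rule absolutely_integrable_finite_discontinuities[OF finite_P])
    show "continuous_on ({0..T} - P) (\<lambda>x. g x (u x) * v x)"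
      by (intro continuous_on_mult g_cont assms continuous_on_subset[OF assms(2)]) auto
    show "\<bar>g x (u x) * v x\<bar> \<le> M * C" if "x \<in> {0..T}" for x
      unfolding abs_mult using that g_bound C M_nonneg by (intro mult_mono) auto
  qed
qed

lemma gv_integrable:
  assumes "continuous_on {0..T} u" "continuous_on {0..T} v"
  shows "(\<lambda>x. g x (u x) * v x) integrable_on {0..T}"
  using gv_absolutely_integrable[OF assms] by (simp add: set_lebesgue_integral_eq_integral(1))

lemma G_diff_le:
  assumes "x \<in> {0..T}" shows "\<bar>G x r - G x s\<bar> \<le> M * \<bar>r - s\<bar>"
proof -
  obtain \<xi> where "G x r - G x s = g x \<xi> * (r - s)"
    using mean_value_abs[OF G_deriv[OF assms], of s r] by blast
  then show ?thesis using g_bound[OF assms, of \<xi>] by (simp add: abs_mult mult_right_mono)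
qed

lemma K_diff_le:
  assumes "i \<in> {1..N}" shows "\<bar>K i r - K i s\<bar> \<le> M * \<bar>r - s\<bar>"
proof -
  obtain \<xi> where "K i r - K i s = J i \<xi> * (r - s)"
    using mean_value_abs[OF K_deriv[OF assms], of s r] by blast
  then show ?thesis using J_bound[OF assms, of \<xi>] by (simp add: abs_mult mult_right_mono)
qed

lemma G_integrable:
  assumes "continuous_on {0..T} u"
  shows "(\<lambda>x. G x (u x)) integrable_on {0..T}"
proof -
  obtain C where C: "\<And>x. x \<in> {0..T} \<Longrightarrow> \<bar>u x\<bar> \<le> C"
    using compact_imp_bounded[OF compact_continuous_image[OF assms compact_Icc]]
    unfolding bounded_iff real_norm_def by blast
  have "\<bar>G x (u x)\<bar> \<le> M * C" if "x \<in> {0..T}" for x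
  proof -
    have "\<bar>G x (u x)\<bar> \<le> M * \<bar>u x\<bar>" using G_diff_le[OF that, of "u x" 0] G_0[OF that] by simp
    also have "\<dots> \<le> M * C" using C[OF that] M_nonneg by (rule mult_left_mono)
    finally show ?thesis .
  qed
  then show ?thesis
    using absolutely_integrable_finite_discontinuities[OF finite_P G_cont[OF assms], of "M * C"]
    by (simp add: set_lebesgue_integral_eq_integral(1))
qed

lemma potential_bound:
  assumes u: "continuous_on {0..T} u" "\<And>x. x \<in> {0..T} \<Longrightarrow> \<bar>u x\<bar> \<le> c"
  shows "\<bar>potential u\<bar> \<le> M * (T + real N) * c"
proof -
  have "\<bar>integral {0..T} (\<lambda>x. G x (u x))\<bar> \<le> M * c * (T - 0)"
  proof (rule abs_integral_le)
    fix x assume x: "x \<in> {0..T}"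
    have "\<bar>G x (u x)\<bar> \<le> M * \<bar>u x\<bar>" using G_diff_le[OF x, of "u x" 0] G_0[OF x] by simp
    also have "\<dots> \<le> M * c" using u(2)[OF x] M_nonneg by (rule mult_left_mono)
    finally show "\<bar>G x (u x)\<bar> \<le> M * c" .
  qed (use T_pos in simp)
  moreover have "\<bar>\<Sum>i=1..N. K i (u (t i))\<bar> \<le> (\<Sum>i=1..N. M * c)"
  proof (rule order_trans[OF sum_abs], rule sum_mono)
    fix i assume i: "i \<in> {1..N}"
    have "\<bar>K i (u (t i))\<bar> \<le> M * \<bar>u (t i)\<bar>" using K_diff_le[OF i, of "u (t i)" 0] K_0[OF i] by simp
    also have "\<dots> \<le> M * c" using u(2)[OF t_mem[OF i]] M_nonneg by (rule mult_left_mono)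
    finally show "\<bar>K i (u (t i))\<bar> \<le> M * c" .
  qed
  ultimately show ?thesis unfolding potential_def by (simp add: algebra_simps)
qed

lemma shear_lipschitz:
  assumes "continuous_on {0..T} u"
  shows "M-lipschitz_on {0..T} (\<lambda>y. integral {0..y} (\<lambda>\<xi>. g \<xi> (u \<xi>)))"
proof (rule lipschitz_onI)
  have *: "\<bar>integral {0..y} (\<lambda>\<xi>. g \<xi> (u \<xi>)) - integral {0..x} (\<lambda>\<xi>. g \<xi> (u \<xi>))\<bar> \<le> M * (y - x)"
    if "x \<in> {0..T}" "y \<in> {0..T}" "x \<le> y" for x y
  proof -
    have "(\<lambda>\<xi>. g \<xi> (u \<xi>)) integrable_on {0..y}"
      using integrable_on_subinterval[OF g_integrable[OF assms]] that by auto
    then have "integral {0..x} (\<lambda>\<xi>. g \<xi> (u \<xi>)) + integral {x..y} (\<lambda>\<xi>. g \<xi> (u \<xi>)) = integral {0..y} (\<lambda>\<xi>. g \<xi> (u \<xi>))"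
      using that by (intro Henstock_Kurzweil_Integration.integral_combine) auto
    moreover have "\<bar>integral {x..y} (\<lambda>\<xi>. g \<xi> (u \<xi>))\<bar> \<le> M * (y - x)"
      using that g_bound by (intro abs_integral_le) auto
    ultimately show ?thesis by linarith
  qed
  show "dist (integral {0..x} (\<lambda>\<xi>. g \<xi> (u \<xi>))) (integral {0..y} (\<lambda>\<xi>. g \<xi> (u \<xi>))) \<le> M * dist x y"
    if "x \<in> {0..T}" "y \<in> {0..T}" for x y
    using *[of x y] *[of y x] that by (cases "x \<le> y") (auto simp: dist_real_def abs_minus_commute)
qed (rule M_nonneg)

lemma shear_deriv:
  assumes u: "continuous_on {0..T} u" and x: "x \<in> {0..T} - P"
  shows "((\<lambda>y. integral {0..y} (\<lambda>\<xi>. g \<xi> (u \<xi>))) has_real_derivative g x (u x)) (at x within {0..T})"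
proof -
  have "continuous (at x within ({0..T} - P)) (\<lambda>x. g x (u x))"
    using g_cont[OF u] x by (simp add: continuous_on_eq_continuous_within)
  then have "((\<lambda>y. integral {0..y} (\<lambda>\<xi>. g \<xi> (u \<xi>))) has_vector_derivative g x (u x)) (at x within ({0..T} - P))"
    using integral_has_vector_derivative_continuous_at[OF g_integrable[OF u] x finite_P] by simp
  \<comment> \<open>A finite set not containing \<open>x\<close> does not affect limits at
    \<open>x\<close>.\<close>
  moreover have "at x within ({0..T} - P) = at x within {0..T}"
    using x finite_P by (intro at_within_nhd[of x "- P"]) (auto intro: finite_imp_closed)
  ultimately show ?thesis by (simp add: has_real_derivative_iff_has_vector_derivative)
qed

lemma moment_deriv:
  assumes u: "continuous_on {0..T} u" and x: "x \<in> {0..T}"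
  shows "((\<lambda>y. integral {0..y} (\<lambda>x. integral {0..x} (\<lambda>\<xi>. g \<xi> (u \<xi>)))) has_real_derivative
      integral {0..x} (\<lambda>\<xi>. g \<xi> (u \<xi>))) (at x within {0..T})"
  using lipschitz_on_continuous_on[OF shear_lipschitz[OF u]] x by (intro integral_has_real_derivative)

lemma load_moment_continuous:
  assumes u: "continuous_on {0..T} u"
  shows "continuous_on {0..T} (load_moment u)"
proof -
  have "continuous_on {0..T} (\<lambda>y. integral {0..y} (\<lambda>x. integral {0..x} (\<lambda>\<xi>. g \<xi> (u \<xi>))))"
    using moment_deriv[OF u] by (intro DERIV_continuous_on) auto
  then show ?thesis unfolding load_moment_def[abs_def] by (intro continuous_intros)
qed

text \<open>Two integrations by parts carry both derivatives from \<open>v\<close> to the load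
  moment. The test function has an absolutely continuous slope only, as in
  \<open>H20\<close>.\<close>

theorem load_moment_represents_load:
  assumes u: "continuous_on {0..T} u" and p: "absolutely_continuous_fun_on {0..T} p"
    and N: "negligible S" "\<And>x. x \<in> {0..T} - S \<Longrightarrow> (p has_real_derivative d x) (at x within {0..T})"
    and v: "\<And>x. x \<in> {0..T} \<Longrightarrow> (v has_real_derivative p x) (at x within {0..T})"
    and bc: "v 0 = 0" "v T = 0" "p 0 = 0" "p T = 0"
  shows "((\<lambda>y. load_moment u y * d y) has_integral load u v) {0..T}"
proof -
  have v_cont: "continuous_on {0..T} v" using v by (intro DERIV_continuous_on) auto
  let ?Q = "\<lambda>y. integral {0..y} (\<lambda>x. integral {0..x} (\<lambda>\<xi>. g \<xi> (u \<xi>)))"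
  have "((\<lambda>x. ?Q x * d x - g x (u x) * v x) has_integral
      (?Q T * p T - integral {0..T} (\<lambda>\<xi>. g \<xi> (u \<xi>)) * v T
       - (?Q 0 * p 0 - integral {0..0} (\<lambda>\<xi>. g \<xi> (u \<xi>)) * v 0))) {0..T}"
    using T_pos finite_P
    by (intro integration_by_parts_absolutely_continuous[OF _ p N v moment_deriv[OF u]
          shear_lipschitz[OF u] _ shear_deriv[OF u]]) (auto intro: negligible_finite)
  then have "((\<lambda>x. ?Q x * d x - g x (u x) * v x) has_integral 0) {0..T}" using bc by simp
  from has_integral_add[OF this integrable_integral[OF gv_integrable[OF u v_cont]]]
  have 1: "((\<lambda>x. ?Q x * d x) has_integral integral {0..T} (\<lambda>x. g x (u x) * v x)) {0..T}" by simp
  \<comment> \<open>The ramp vanishes before \<open>t i\<close> and is affine after it. On {t i..T}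
    its double integration by parts leaves just the boundary value \<open>v (t i)\<close>.\<close>
  have 2: "((\<lambda>y. max 0 (y - t i) * d y) has_integral v (t i)) {0..T}" if i: "i \<in> {1..N}" for i
  proof -
    have ti: "0 \<le> t i" "t i \<le> T" using t_mem[OF i] by auto
    have sub: "{t i..T} \<subseteq> {0..T}" using ti by auto
    have "((\<lambda>y. (y - t i) * d y - 0 * v y) has_integral
        ((T - t i) * p T - 1 * v T - ((t i - t i) * p (t i) - 1 * v (t i)))) {t i..T}"
    proof (rule integration_by_parts_absolutely_continuous[where N = S and N' = "{}" and L = 0])
      show "absolutely_continuous_fun_on {t i..T} p"
        using p sub by (rule absolutely_continuous_fun_on_subset)
      show "(p has_real_derivative d x) (at x within {t i..T})" if "x \<in> {t i..T} - S" for x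
        using N(2)[of x] that sub by (auto intro: DERIV_subset)
      show "(v has_real_derivative p x) (at x within {t i..T})" if "x \<in> {t i..T}" for x
        using v[of x] that sub by (auto intro: DERIV_subset)
      show "((\<lambda>y. y - t i) has_real_derivative 1) (at x within {t i..T})" for x
        by (auto intro!: derivative_eq_intros)
      show "0-lipschitz_on {t i..T} (\<lambda>y. 1 :: real)" by (intro lipschitz_onI) auto
      show "((\<lambda>y. 1 :: real) has_real_derivative 0) (at x within {t i..T})" for x by simp
    qed (use ti N in auto)
    then have "((\<lambda>y. (y - t i) * d y) has_integral v (t i)) {t i..T}" using bc by simp
    then have B: "((\<lambda>y. max 0 (y - t i) * d y) has_integral v (t i)) {t i..T}"
      by (rule has_integral_eq[rotated]) auto
    have A: "((\<lambda>y. max 0 (y - t i) * d y) has_integral 0) {0..t i}"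
      by (rule has_integral_is_0) auto
    show ?thesis using has_integral_combine[OF ti A B] by simp
  qed
  have "((\<lambda>y. ?Q y * d y + (\<Sum>i=1..N. J i (u (t i)) * (max 0 (y - t i) * d y))) has_integral load u v) {0..T}"
    unfolding load_def by (intro has_integral_add 1 has_integral_sum has_integral_mult_right 2) auto
  then show ?thesis by (simp add: load_moment_def distrib_right sum_distrib_right mult.assoc)
qed

lemma response_continuous_arg:
  "continuous_on {0..T} u \<Longrightarrow> continuous_on {0..T} (\<lambda>y. load_moment u y - \<beta> * u y)"
  by (intro continuous_intros load_moment_continuous)

lemma bending_response:
  assumes u: "continuous_on {0..T} u" and d: "d \<in> clamped"
  shows "bending (response u) d = load u (deflection d) - \<beta> * integral {0..T} (\<lambda>y. u y * d y)"
proof -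
  have L: "((\<lambda>y. load_moment u y * d y) has_integral load u (deflection d)) {0..T}"
    using d by (intro load_moment_represents_load[OF u slope_absolutely_continuous, of "{}"])
      (auto intro: slope_deriv deflection_deriv simp: clamped_def)
  have I: "((\<lambda>y. u y * d y) has_integral integral {0..T} (\<lambda>y. u y * d y)) {0..T}"
    by (intro integrable_integral integrable_continuous_real continuous_intros u) auto
  have "bending (response u) d = integral {0..T} (\<lambda>y. (load_moment u y - \<beta> * u y) * d y)"
    unfolding response_def by (rule bending_curvature[OF response_continuous_arg[OF u] d])
  also have "\<dots> = load u (deflection d) - \<beta> * integral {0..T} (\<lambda>y. u y * d y)"
    using has_integral_diff[OF L has_integral_mult_right[OF I, of \<beta>]]
    by (intro integral_unique) (simp add: left_diff_distrib mult.assoc)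
  finally show ?thesis .
qed

lemma J_modulus:
  assumes "0 < \<epsilon>"
  shows "\<exists>\<kappa>>0. \<forall>i\<in>{1..N}. \<forall>r s. \<bar>r - s\<bar> \<le> \<kappa> \<longrightarrow> \<bar>J i r - J i s\<bar> \<le> \<epsilon>"
proof -
  have "\<forall>i\<in>{1..N}. \<exists>\<kappa>>0. \<forall>r s. \<bar>r - s\<bar> \<le> \<kappa> \<longrightarrow> \<bar>J i r - J i s\<bar> \<le> \<epsilon>"
    using modulus_unif[OF J_unif assms] by blast
  then obtain \<kappa> where \<kappa>: "\<And>i. i \<in> {1..N} \<Longrightarrow> 0 < \<kappa> i"
    "\<And>i r s. i \<in> {1..N} \<Longrightarrow> \<bar>r - s\<bar> \<le> \<kappa> i \<Longrightarrow> \<bar>J i r - J i s\<bar> \<le> \<epsilon>"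
    by metis
  define \<kappa>0 where "\<kappa>0 = Min (insert 1 (\<kappa> ` {1..N}))"
  have "0 < \<kappa>0" unfolding \<kappa>0_def using \<kappa>(1) by (subst Min_gr_iff) auto
  moreover have "\<kappa>0 \<le> \<kappa> i" if "i \<in> {1..N}" for i
    unfolding \<kappa>0_def using that by (intro Min_le) auto
  ultimately show ?thesis using \<kappa>(2) by (intro exI[of _ \<kappa>0]) force
qed

text \<open>The modulus of continuity of \<open>g x\<close> may depend on \<open>x\<close>, so only
  the integral over \<open>x\<close> can be made uniformly small, by dominated convergence.\<close>

lemma g_modulus:
  assumes "0 < \<epsilon>"
  shows "\<exists>\<kappa>>0. \<forall>u w. continuous_on {0..T} u \<longrightarrow> continuous_on {0..T} w \<longrightarrow>
    (\<forall>x\<in>{0..T}. \<bar>u x - w x\<bar> \<le> \<kappa>) \<longrightarrow> integral {0..T} (\<lambda>x. \<bar>g x (u x) - g x (w x)\<bar>) \<le> \<epsilon>"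
proof -
  define F where "F \<kappa> = {r. \<exists>u w. r = (\<lambda>x. \<bar>g x (u x) - g x (w x)\<bar>) \<and> continuous_on {0..T} u \<and>
      continuous_on {0..T} w \<and> (\<forall>x\<in>{0..T}. \<bar>u x - w x\<bar> \<le> \<kappa>)}" for \<kappa>
  have "\<exists>\<kappa>>0. \<forall>r\<in>F \<kappa>. \<bar>integral {0..T} r\<bar> \<le> \<epsilon>"
  proof (rule uniform_dominated_convergence[where C = "2 * M"])
    show "F \<kappa> \<subseteq> F \<kappa>'" if "\<kappa> \<le> \<kappa>'" for \<kappa> \<kappa>'
      using that unfolding F_def by (auto 4 5 intro: order_trans)
    show bd: "\<bar>r x\<bar> \<le> 2 * M" if rF: "r \<in> F \<kappa>" and x: "x \<in> {0..T}" for \<kappa> r x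
    proof -
      obtain u w where r: "r = (\<lambda>x. \<bar>g x (u x) - g x (w x)\<bar>)" using rF unfolding F_def by blast
      show ?thesis
        using g_bound[OF x, of "u x"] g_bound[OF x, of "w x"] unfolding r by (auto simp: abs_le_iff)
    qed
    show "r integrable_on {0..T}" if rF: "r \<in> F \<kappa>" for \<kappa> r
    proof -
      obtain u w where r: "r = (\<lambda>x. \<bar>g x (u x) - g x (w x)\<bar>)" "continuous_on {0..T} u" "continuous_on {0..T} w"
        using rF unfolding F_def by blast
      have "continuous_on ({0..T} - P) r"
        unfolding r(1) by (intro continuous_intros g_cont r)
      then have "r absolutely_integrable_on {0..T}"
        using bd[OF rF] by (rule absolutely_integrable_finite_discontinuities[OF finite_P])
      then show ?thesis by (simp add: set_lebesgue_integral_eq_integral(1))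
    qed
    show "\<exists>\<kappa>>0. \<forall>r\<in>F \<kappa>. \<bar>r x\<bar> \<le> \<epsilon>" if x: "x \<in> {0..T}" "0 < \<epsilon>" for x \<epsilon>
    proof -
      obtain \<kappa> where "\<kappa> > 0" "\<forall>r s. \<bar>r - s\<bar> \<le> \<kappa> \<longrightarrow> \<bar>g x r - g x s\<bar> \<le> \<epsilon>"
        using modulus_unif[OF g_unif[OF x(1)] x(2)] by blast
      then show ?thesis using x(1) unfolding F_def by (intro exI[of _ \<kappa>]) auto
    qed
  qed (rule assms)
  then obtain \<kappa> where \<kappa>: "\<kappa> > 0" "\<And>r. r \<in> F \<kappa> \<Longrightarrow> \<bar>integral {0..T} r\<bar> \<le> \<epsilon>" by blast
  have "integral {0..T} (\<lambda>x. \<bar>g x (u x) - g x (w x)\<bar>) \<le> \<epsilon>"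
    if "continuous_on {0..T} u" "continuous_on {0..T} w" "\<forall>x\<in>{0..T}. \<bar>u x - w x\<bar> \<le> \<kappa>" for u w
  proof -
    have "(\<lambda>x. \<bar>g x (u x) - g x (w x)\<bar>) \<in> F \<kappa>" using that unfolding F_def by blast
    from \<kappa>(2)[OF this] show ?thesis by linarith
  qed
  then show ?thesis using \<kappa>(1) by blast
qed

text \<open>By the mean value theorem the remainder divided by \<open>c\<close> is bounded by 2 M
  and tends to 0 at each x, so dominated convergence makes its integral small uniformly in the base
  function. The impulses are finitely many and have a common modulus.\<close>

lemma potential_differentiable:
  assumes "0 < \<epsilon>"
  shows "\<exists>\<kappa>>0. \<forall>u v c. continuous_on {0..T} u \<longrightarrow> continuous_on {0..T} v \<longrightarrow> c \<le> \<kappa> \<longrightarrow>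
    (\<forall>x\<in>{0..T}. \<bar>v x\<bar> \<le> c) \<longrightarrow>
    \<bar>potential (\<lambda>x. u x + v x) - potential u - load u v\<bar> \<le> \<epsilon> * c"
proof -
  define R where "R u v x = G x (u x + v x) - G x (u x) - g x (u x) * v x" for u v :: "real \<Rightarrow> real" and x
  have R_mvt: "\<exists>\<xi>. \<bar>\<xi> - u x\<bar> \<le> \<bar>v x\<bar> \<and> R u v x = (g x \<xi> - g x (u x)) * v x" if "x \<in> {0..T}" for u v x
    using mean_value_abs[OF G_deriv[OF that], of "u x" "u x + v x"]
    by (auto simp: R_def left_diff_distrib)
  define F where "F \<kappa> = {r. \<exists>u v c. r = (\<lambda>x. R u v x / c) \<and> continuous_on {0..T} u \<and>
      continuous_on {0..T} v \<and> 0 < c \<and> c \<le> \<kappa> \<and> (\<forall>x\<in>{0..T}. \<bar>v x\<bar> \<le> c)}" for \<kappa>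
  have R_int: "R u v integrable_on {0..T}" if "continuous_on {0..T} u" "continuous_on {0..T} v" for u v
    unfolding R_def[abs_def]
    by (intro integrable_diff G_integrable gv_integrable continuous_intros that)
  have R_integral: "integral {0..T} (R u v) = integral {0..T} (\<lambda>x. G x (u x + v x)) - integral {0..T} (\<lambda>x. G x (u x))
      - integral {0..T} (\<lambda>x. g x (u x) * v x)" if "continuous_on {0..T} u" "continuous_on {0..T} v" for u v
    unfolding R_def[abs_def] using that
    by (simp add: integral_diff integrable_diff G_integrable gv_integrable continuous_on_add)
  \<comment> \<open>The tolerance is shared by the integral and the N impulse terms.\<close>
  define e where "e = \<epsilon> / (real N + 2)"
  have e: "0 < e" using assms by (simp add: e_def)
  have "\<exists>\<kappa>>0. \<forall>r\<in>F \<kappa>. \<bar>integral {0..T} r\<bar> \<le> e"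
  proof (rule uniform_dominated_convergence[where C = "2 * M"])
    show "F \<kappa> \<subseteq> F \<kappa>'" if "\<kappa> \<le> \<kappa>'" for \<kappa> \<kappa>'
      using that unfolding F_def by (blast intro: order_trans)
    show "\<bar>r x\<bar> \<le> 2 * M" if rF: "r \<in> F \<kappa>" and x: "x \<in> {0..T}" for \<kappa> r x
    proof -
      obtain u v c where r: "r = (\<lambda>x. R u v x / c)" "0 < c" "\<bar>v x\<bar> \<le> c" using rF x unfolding F_def by blast
      obtain \<xi> where \<xi>: "R u v x = (g x \<xi> - g x (u x)) * v x" using R_mvt[OF x] by blast
      have "\<bar>g x \<xi> - g x (u x)\<bar> \<le> 2 * M"
        using g_bound[OF x, of \<xi>] g_bound[OF x, of "u x"] by linarith
      then have "\<bar>R u v x\<bar> \<le> 2 * M * c"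
        unfolding \<xi> abs_mult using r(3) M_nonneg by (intro mult_mono) auto
      then show ?thesis using r(2) by (simp add: r(1) abs_divide pos_divide_le_eq)
    qed
    show "r integrable_on {0..T}" if rF: "r \<in> F \<kappa>" for \<kappa> r
    proof -
      obtain u v c where r: "r = (\<lambda>x. R u v x / c)" "continuous_on {0..T} u" "continuous_on {0..T} v"
        using rF unfolding F_def by blast
      show ?thesis unfolding r(1) divide_inverse by (intro integrable_on_mult_left R_int r)
    qed
    show "\<exists>\<kappa>>0. \<forall>r\<in>F \<kappa>. \<bar>r x\<bar> \<le> \<epsilon>" if x: "x \<in> {0..T}" "0 < \<epsilon>" for x \<epsilon>
    proof -
      obtain \<kappa> where \<kappa>: "\<kappa> > 0" "\<And>r s. \<bar>r - s\<bar> \<le> \<kappa> \<Longrightarrow> \<bar>g x r - g x s\<bar> \<le> \<epsilon>"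
        using modulus_unif[OF g_unif[OF x(1)] x(2)] by blast
      have "\<bar>r x\<bar> \<le> \<epsilon>" if rF: "r \<in> F \<kappa>" for r
      proof -
        obtain u v c where r: "r = (\<lambda>x. R u v x / c)" "0 < c" "c \<le> \<kappa>" "\<bar>v x\<bar> \<le> c"
          using rF x(1) unfolding F_def by blast
        obtain \<xi> where \<xi>: "\<bar>\<xi> - u x\<bar> \<le> \<bar>v x\<bar>" "R u v x = (g x \<xi> - g x (u x)) * v x"
          using R_mvt[OF x(1)] by blast
        have "\<bar>R u v x\<bar> \<le> \<epsilon> * c"
          unfolding \<xi>(2) abs_mult using \<kappa>(2)[of \<xi> "u x"] \<xi>(1) r x(2) by (intro mult_mono) auto
        then show ?thesis using r(2) by (simp add: r(1) abs_divide pos_divide_le_eq)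
      qed
      then show ?thesis using \<kappa>(1) by blast
    qed
  qed (rule e)
  then obtain \<kappa>1 where \<kappa>1: "\<kappa>1 > 0" "\<And>r. r \<in> F \<kappa>1 \<Longrightarrow> \<bar>integral {0..T} r\<bar> \<le> e" by blast
  obtain \<kappa>2 where \<kappa>2: "\<kappa>2 > 0" "\<And>i r s. i \<in> {1..N} \<Longrightarrow> \<bar>r - s\<bar> \<le> \<kappa>2 \<Longrightarrow> \<bar>J i r - J i s\<bar> \<le> e"
    using J_modulus[OF e] by blast
  have "\<bar>potential (\<lambda>x. u x + v x) - potential u - load u v\<bar> \<le> \<epsilon> * c"
    if u: "continuous_on {0..T} u" and v: "continuous_on {0..T} v" and c: "c \<le> min \<kappa>1 \<kappa>2"
      and vc: "\<forall>x\<in>{0..T}. \<bar>v x\<bar> \<le> c" for u v c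
  proof -
    have c0: "0 \<le> c" using vc T_pos by (force dest: bspec[of _ _ 0])
    have A: "\<bar>integral {0..T} (R u v)\<bar> \<le> e * c"
    proof (cases "c = 0")
      case True
      then have "integral {0..T} (R u v) = integral {0..T} (\<lambda>x. 0)"
        using vc by (intro integral_cong) (auto simp: R_def)
      then show ?thesis using True by simp
    next
      case False
      then have cp: "0 < c" using c0 by simp
      have "(\<lambda>x. R u v x / c) \<in> F \<kappa>1" unfolding F_def using u v cp c vc by auto
      from \<kappa>1(2)[OF this] have "\<bar>integral {0..T} (R u v) / c\<bar> \<le> e" by simp
      then show ?thesis using cp by (simp add: abs_divide pos_divide_le_eq)
    qed
    have B: "\<bar>\<Sum>i=1..N. K i (u (t i) + v (t i)) - K i (u (t i)) - J i (u (t i)) * v (t i)\<bar> \<le> (\<Sum>i=1..N. e * c)"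
    proof (rule order_trans[OF sum_abs], rule sum_mono)
      fix i assume i: "i \<in> {1..N}"
      obtain \<xi> where \<xi>: "\<bar>\<xi> - u (t i)\<bar> \<le> \<bar>v (t i)\<bar>" "K i (u (t i) + v (t i)) - K i (u (t i)) = J i \<xi> * v (t i)"
        using mean_value_abs[OF K_deriv[OF i], of "u (t i)" "u (t i) + v (t i)"] by auto
      have vt: "\<bar>v (t i)\<bar> \<le> c" using vc t_mem[OF i] by blast
      have "K i (u (t i) + v (t i)) - K i (u (t i)) - J i (u (t i)) * v (t i) = (J i \<xi> - J i (u (t i))) * v (t i)"
        by (simp add: \<xi>(2) left_diff_distrib)
      also have "\<bar>\<dots>\<bar> \<le> e * c"
        unfolding abs_mult using \<kappa>2(2)[OF i, of \<xi> "u (t i)"] \<xi>(1) vt c e by (intro mult_mono) auto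
      finally show "\<bar>K i (u (t i) + v (t i)) - K i (u (t i)) - J i (u (t i)) * v (t i)\<bar> \<le> e * c" .
    qed
    have "potential (\<lambda>x. u x + v x) - potential u - load u v = integral {0..T} (R u v)
        + (\<Sum>i=1..N. K i (u (t i) + v (t i)) - K i (u (t i)) - J i (u (t i)) * v (t i))"
      by (simp add: potential_def load_def R_integral[OF u v] sum_subtractf)
    then have "\<bar>potential (\<lambda>x. u x + v x) - potential u - load u v\<bar> \<le> e * c + real N * (e * c)"
      using A B by simp
    also have "\<dots> = (real N + 1) * e * c" by (simp add: algebra_simps)
    also have "\<dots> \<le> \<epsilon> * c"
      using assms by (intro mult_right_mono c0) (simp add: e_def field_simps)
    finally show ?thesis .
  qed
  then show ?thesis using \<kappa>1(1) \<kappa>2(1) by (intro exI[of _ "min \<kappa>1 \<kappa>2"]) auto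
qed

lemma response_modulus:
  assumes "0 < \<epsilon>"
  shows "\<exists>\<kappa>>0. \<forall>u w. continuous_on {0..T} u \<longrightarrow> continuous_on {0..T} w \<longrightarrow>
    (\<forall>x\<in>{0..T}. \<bar>u x - w x\<bar> \<le> \<kappa>) \<longrightarrow> norm (response u - response w) \<le> \<epsilon>"
proof -
  obtain C where C: "C > 0" "\<And>h k \<epsilon>. continuous_on {0..T} h \<Longrightarrow> continuous_on {0..T} k \<Longrightarrow>
      \<forall>y\<in>{0..T}. \<bar>h y - k y\<bar> \<le> \<epsilon> \<Longrightarrow> norm (curvature h - curvature k) \<le> C * \<epsilon>"
    using curvature_dist by blast
  \<comment> \<open>The three summands are the integrated shear force, the N ramps of height at most
    T, and the term with \<beta>; C comes from the projection.\<close>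
  define e where "e = \<epsilon> / (C * (T + real N * T + \<bar>\<beta>\<bar>))"
  have D: "0 < T + real N * T + \<bar>\<beta>\<bar>" using T_pos by (intro add_pos_nonneg) auto
  have e: "0 < e" unfolding e_def using assms C(1) D by (intro divide_pos_pos mult_pos_pos)
  obtain \<kappa>1 where \<kappa>1: "\<kappa>1 > 0" "\<And>u w. continuous_on {0..T} u \<Longrightarrow> continuous_on {0..T} w \<Longrightarrow>
      \<forall>x\<in>{0..T}. \<bar>u x - w x\<bar> \<le> \<kappa>1 \<Longrightarrow> integral {0..T} (\<lambda>x. \<bar>g x (u x) - g x (w x)\<bar>) \<le> e"
    using g_modulus[OF e] by blast
  obtain \<kappa>2 where \<kappa>2: "\<kappa>2 > 0" "\<And>i r s. i \<in> {1..N} \<Longrightarrow> \<bar>r - s\<bar> \<le> \<kappa>2 \<Longrightarrow> \<bar>J i r - J i s\<bar> \<le> e"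
    using J_modulus[OF e] by blast
  have "norm (response u - response w) \<le> \<epsilon>"
    if u: "continuous_on {0..T} u" and w: "continuous_on {0..T} w"
      and uw: "\<forall>x\<in>{0..T}. \<bar>u x - w x\<bar> \<le> min e (min \<kappa>1 \<kappa>2)" for u w
  proof -
    have gd: "(\<lambda>x. g x (u x) - g x (w x)) integrable_on {0..x}" "(\<lambda>x. g x (u x)) integrable_on {0..x}"
      "(\<lambda>x. g x (w x)) integrable_on {0..x}" if "x \<in> {0..T}" for x
      using integrable_on_subinterval[OF g_integrable[OF u], of 0 x]
        integrable_on_subinterval[OF g_integrable[OF w], of 0 x] that
      by (auto intro: integrable_diff)
    have abs_int: "(\<lambda>x. \<bar>g x (u x) - g x (w x)\<bar>) integrable_on {0..T}"
    proof -
      have "(\<lambda>x. \<bar>g x (u x) - g x (w x)\<bar>) absolutely_integrable_on {0..T}"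
      proof (rule absolutely_integrable_finite_discontinuities[OF finite_P, where C = "2 * M"])
        show "continuous_on ({0..T} - P) (\<lambda>x. \<bar>g x (u x) - g x (w x)\<bar>)"
          by (intro continuous_intros g_cont u w)
        show "\<bar>\<bar>g x (u x) - g x (w x)\<bar>\<bar> \<le> 2 * M" if "x \<in> {0..T}" for x
          using g_bound[OF that, of "u x"] g_bound[OF that, of "w x"] by linarith
      qed
      then show ?thesis by (simp add: set_lebesgue_integral_eq_integral(1))
    qed
    have "\<bar>load_moment u y - \<beta> * u y - (load_moment w y - \<beta> * w y)\<bar> \<le> (T + real N * T + \<bar>\<beta>\<bar>) * e"
      if y: "y \<in> {0..T}" for y
    proof -
      let ?I = "\<lambda>u x. integral {0..x} (\<lambda>\<xi>. g \<xi> (u \<xi>))"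
      have shear: "\<bar>?I u x - ?I w x\<bar> \<le> e" if x: "x \<in> {0..T}" for x
      proof -
        have "?I u x - ?I w x = integral {0..x} (\<lambda>x. g x (u x) - g x (w x))"
          using gd[OF x] by (simp add: integral_diff)
        also have "\<bar>\<dots>\<bar> \<le> integral {0..x} (\<lambda>x. \<bar>g x (u x) - g x (w x)\<bar>)"
          unfolding real_norm_def[symmetric]
          using gd[OF x] integrable_on_subinterval[OF abs_int, of 0 x] x
          by (intro integral_norm_bound_integral) auto
        also have "\<dots> \<le> integral {0..T} (\<lambda>x. \<bar>g x (u x) - g x (w x)\<bar>)"
          using integrable_on_subinterval[OF abs_int, of 0 x] x abs_int by (intro integral_subset_le) auto
        also have "\<dots> \<le> e" using \<kappa>1(2)[OF u w] uw by simp
        finally show ?thesis .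
      qed
      have "integral {0..y} (?I u) - integral {0..y} (?I w) = integral {0..y} (\<lambda>x. ?I u x - ?I w x)"
        using y by (intro integral_diff[symmetric] integrable_continuous_real
            continuous_on_subset[OF lipschitz_on_continuous_on[OF shear_lipschitz]] u w) auto
      also have "\<bar>\<dots>\<bar> \<le> e * (y - 0)"
        using y shear by (intro abs_integral_le) auto
      also have "\<dots> \<le> e * T" using y e by (intro mult_left_mono) auto
      finally have 1: "\<bar>integral {0..y} (?I u) - integral {0..y} (?I w)\<bar> \<le> e * T" .
      have "\<bar>\<Sum>i=1..N. (J i (u (t i)) - J i (w (t i))) * max 0 (y - t i)\<bar> \<le> (\<Sum>i=1..N. e * T)"
      proof (rule order_trans[OF sum_abs], rule sum_mono)
        fix i assume i: "i \<in> {1..N}"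
        have "\<bar>J i (u (t i)) - J i (w (t i))\<bar> \<le> e"
          using uw t_mem[OF i] by (intro \<kappa>2(2) i) auto
        then show "\<bar>(J i (u (t i)) - J i (w (t i))) * max 0 (y - t i)\<bar> \<le> e * T"
          unfolding abs_mult using y t_mem[OF i] e by (intro mult_mono) auto
      qed
      then have 2: "\<bar>(\<Sum>i=1..N. J i (u (t i)) * max 0 (y - t i)) - (\<Sum>i=1..N. J i (w (t i)) * max 0 (y - t i))\<bar>
          \<le> real N * (e * T)"
        by (simp add: left_diff_distrib sum_subtractf)
      have "\<bar>u y - w y\<bar> \<le> e" using uw y by simp
      then have 3: "\<bar>\<beta> * u y - \<beta> * w y\<bar> \<le> \<bar>\<beta>\<bar> * e"
        unfolding right_diff_distrib[symmetric] abs_mult by (intro mult_left_mono) auto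
      have "\<bar>load_moment u y - \<beta> * u y - (load_moment w y - \<beta> * w y)\<bar> \<le> e * T + real N * (e * T) + \<bar>\<beta>\<bar> * e"
        using 1 2 3 unfolding load_moment_def by linarith
      then show ?thesis by (simp add: algebra_simps)
    qed
    then have "norm (response u - response w) \<le> C * ((T + real N * T + \<bar>\<beta>\<bar>) * e)"
      unfolding response_def by (intro C(2) response_continuous_arg u w) auto
    also have "\<dots> = \<epsilon>" unfolding e_def using C(1) D by simp
    finally show ?thesis .
  qed
  then show ?thesis using e \<kappa>1(1) \<kappa>2(1) by (intro exI[of _ "min e (min \<kappa>1 \<kappa>2)"]) auto
qed

section \<open>Symmetry, differentiability and compactness of the action\<close>

lemma curvature_cong:
  assumes "continuous_on {0..T} h" "continuous_on {0..T} k" "\<And>y. y \<in> {0..T} \<Longrightarrow> h y = k y"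
  shows "curvature h = curvature k"
proof -
  obtain C where "norm (curvature h - curvature k) \<le> C * 0"
    using curvature_dist assms by (metis abs_zero diff_self order_refl)
  then show ?thesis by simp
qed

lemma curvature_uminus:
  assumes "continuous_on {0..T} h"
  shows "curvature (\<lambda>y. - h y) = - curvature h"
proof -
  have "project (\<lambda>y. - h y) y = - project h y" for y
  proof -
    have "mean (\<lambda>y. - h y) = - mean h" "moment (\<lambda>y. - h y) = - moment h"
      by (simp_all add: mean_def moment_def)
    then show ?thesis unfolding project_def minus_divide_left by simp
  qed
  then show ?thesis
    using assms by (intro bcontfun_eqI)
      (simp add: apply_curvature continuous_on_minus uminus_bcontfun.rep_eq ext_cont_def)
qed

lemma response_uminus:
  assumes u: "continuous_on {0..T} u"
  shows "response (\<lambda>y. - u y) = - response u"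
proof -
  have eq: "load_moment (\<lambda>y. - u y) y = - load_moment u y" if y: "y \<in> {0..T}" for y
  proof -
    have inner: "integral {0..x} (\<lambda>\<xi>. g \<xi> (- u \<xi>)) = - integral {0..x} (\<lambda>\<xi>. g \<xi> (u \<xi>))" if "x \<in> {0..T}" for x
    proof -
      have "integral {0..x} (\<lambda>\<xi>. g \<xi> (- u \<xi>)) = integral {0..x} (\<lambda>\<xi>. - g \<xi> (u \<xi>))"
        using that g_odd by (intro integral_cong) auto
      then show ?thesis by simp
    qed
    have "integral {0..y} (\<lambda>x. integral {0..x} (\<lambda>\<xi>. g \<xi> (- u \<xi>))) =
        integral {0..y} (\<lambda>x. - integral {0..x} (\<lambda>\<xi>. g \<xi> (u \<xi>)))"
      using y inner by (intro integral_cong) auto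
    moreover have "(\<Sum>i=1..N. J i (- u (t i)) * max 0 (y - t i)) = (\<Sum>i=1..N. - (J i (u (t i)) * max 0 (y - t i)))"
      by (intro sum.cong) (simp_all add: J_odd)
    ultimately show ?thesis by (simp add: load_moment_def sum_negf)
  qed
  have "response (\<lambda>y. - u y) = curvature (\<lambda>y. - (load_moment u y - \<beta> * u y))"
    unfolding response_def using u
    by (intro curvature_cong response_continuous_arg continuous_intros load_moment_continuous) (auto simp: eq)
  also have "\<dots> = - response u"
    unfolding response_def by (intro curvature_uminus response_continuous_arg u)
  finally show ?thesis .
qed

lemma deflection_uminus: "deflection (- z) = (\<lambda>y. - deflection z y)"
  by (simp add: fun_eq_iff slope_deflection_minus)

lemma integral_mult_curvature_le:
  assumes "continuous_on {0..T} u" "\<And>x. x \<in> {0..T} \<Longrightarrow> \<bar>u x\<bar> \<le> c"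
  shows "\<bar>integral {0..T} (\<lambda>y. u y * apply_bcontfun z y)\<bar> \<le> c * (emb * nrm z)"
proof -
  have c: "0 \<le> c" using assms(2)[of 0] T_pos by force
  have "\<bar>integral {0..T} (\<lambda>y. u y * apply_bcontfun z y)\<bar> \<le> integral {0..T} (\<lambda>y. c * \<bar>apply_bcontfun z y\<bar>)"
    unfolding real_norm_def[symmetric]
  proof (rule integral_norm_bound_integral)
    show "(\<lambda>y. u y * apply_bcontfun z y) integrable_on {0..T}"
      "(\<lambda>y. c * norm (apply_bcontfun z y)) integrable_on {0..T}"
      by (intro integrable_continuous_real continuous_intros assms; auto)+
    show "norm (u x * apply_bcontfun z x) \<le> c * norm (apply_bcontfun z x)" if "x \<in> {0..T}" for x
      using assms(2)[OF that] by (simp add: abs_mult mult_right_mono)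
  qed
  also have "\<dots> \<le> c * (emb * nrm z)"
    using c L1_le[of z] by (simp add: mult_left_mono)
  finally show ?thesis .
qed

text \<open>Green's identity without boundary terms. It makes the part of the derivative that
  contains \<beta> the gradient of a quadratic form.\<close>

lemma deflection_symmetric:
  assumes "x \<in> clamped" "d \<in> clamped"
  shows "integral {0..T} (\<lambda>y. deflection d y * apply_bcontfun x y) = integral {0..T} (\<lambda>y. deflection x y * apply_bcontfun d y)"
proof -
  have "((\<lambda>y. deflection x y * apply_bcontfun d y - deflection d y * apply_bcontfun x y) has_integral
      (deflection x T * slope d T - deflection d T * slope x T - (deflection x 0 * slope d 0 - deflection d 0 * slope x 0))) {0..T}"
  proof (rule fundamental_theorem_of_calculus)
    show "((\<lambda>y. deflection x y * slope d y - deflection d y * slope x y) has_vector_derivative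
        deflection x y * apply_bcontfun d y - deflection d y * apply_bcontfun x y) (at y within {0..T})"
      if "y \<in> {0..T}" for y
      unfolding has_real_derivative_iff_has_vector_derivative[symmetric]
      using that by (auto intro!: derivative_eq_intros slope_deriv deflection_deriv)
  qed (use T_pos in simp)
  then have "integral {0..T} (\<lambda>y. deflection x y * apply_bcontfun d y - deflection d y * apply_bcontfun x y) = 0"
    using assms by (simp add: clamped_def integral_unique)
  moreover have "(\<lambda>y. deflection x y * apply_bcontfun d y) integrable_on {0..T}" "(\<lambda>y. deflection d y * apply_bcontfun x y) integrable_on {0..T}"
    by (intro integrable_continuous_real continuous_intros deflection_continuous; auto)+
  ultimately show ?thesis by (simp add: integral_diff)
qed

lemma action_differentiable:
  assumes "0 < \<epsilon>"
  shows "\<exists>\<kappa>>0. \<forall>x\<in>clamped. \<forall>d\<in>clamped. nrm d \<le> \<kappa> \<longrightarrow>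
    \<bar>action (x + d) - action x - bending (response (deflection x)) d\<bar> \<le> \<epsilon> * nrm d"
proof -
  define E where "E = emb * T"
  have E: "0 < E" using emb_pos T_pos by (simp add: E_def)
  have p: "0 < \<epsilon> / (2 * E)" using assms E by simp
  obtain \<kappa>1 where \<kappa>1: "\<kappa>1 > 0" "\<And>u v c. continuous_on {0..T} u \<Longrightarrow> continuous_on {0..T} v \<Longrightarrow> c \<le> \<kappa>1 \<Longrightarrow>
      \<forall>x\<in>{0..T}. \<bar>v x\<bar> \<le> c \<Longrightarrow> \<bar>potential (\<lambda>x. u x + v x) - potential u - load u v\<bar> \<le> \<epsilon> / (2 * E) * c"
    using potential_differentiable[OF p] by blast
  \<comment> \<open>Keeps the quadratic term in \<open>d\<close>, at most |\<beta>| / 2 * E * emb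
    times the squared seminorm, below half of the allowed error; adding 1 covers \<beta> =
    0.\<close>
  define \<kappa>2 where "\<kappa>2 = \<epsilon> / ((\<bar>\<beta>\<bar> + 1) * E * emb)"
  have "\<bar>\<beta>\<bar> + 1 > 0" by linarith
  then have \<kappa>2: "0 < \<kappa>2" unfolding \<kappa>2_def using assms E emb_pos by (intro divide_pos_pos mult_pos_pos)
  have "\<bar>action (x + d) - action x - bending (response (deflection x)) d\<bar> \<le> \<epsilon> * nrm d"
    if x: "x \<in> clamped" and d: "d \<in> clamped" and n: "nrm d \<le> min (\<kappa>1 / E) \<kappa>2" for x d
  proof -
    have dU: "deflection (x + d) = (\<lambda>y. deflection x y + deflection d y)"
      by (simp add: fun_eq_iff deflection_add)
    have bd: "\<bar>deflection d y\<bar> \<le> E * nrm d" if "y \<in> {0..T}" for y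
      using deflection_le[OF that] by (simp add: E_def)
    have "E * nrm d \<le> \<kappa>1" using n E by (simp add: pos_le_divide_eq mult.commute)
    then have 1: "\<bar>potential (deflection (x + d)) - potential (deflection x) - load (deflection x) (deflection d)\<bar> \<le> \<epsilon> / (2 * E) * (E * nrm d)"
      unfolding dU using bd by (intro \<kappa>1(2) deflection_continuous) auto
    let ?I = "\<lambda>a b. integral {0..T} (\<lambda>y. deflection a y * apply_bcontfun b y)"
    have int: "(\<lambda>y. deflection a y * apply_bcontfun b y) integrable_on {0..T}" for a b
      by (intro integrable_continuous_real continuous_intros deflection_continuous) auto
    have "?I (x + d) (x + d) = integral {0..T} (\<lambda>y. (deflection x y * apply_bcontfun x y + deflection x y * apply_bcontfun d y)
        + (deflection d y * apply_bcontfun x y + deflection d y * apply_bcontfun d y))"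
      by (simp add: deflection_add plus_bcontfun.rep_eq algebra_simps)
    also have "\<dots> = ?I x x + ?I x d + (?I d x + ?I d d)"
      using int by (simp add: integral_add integrable_add)
    also have "\<dots> = ?I x x + 2 * ?I x d + ?I d d" using deflection_symmetric[OF x d] by simp
    finally have 2: "?I (x + d) (x + d) = ?I x x + 2 * ?I x d + ?I d d" .
    have 3: "\<bar>?I d d\<bar> \<le> E * nrm d * (emb * nrm d)"
      using bd by (intro integral_mult_curvature_le deflection_continuous)
    have "\<bar>\<beta>\<bar> / 2 * (E * nrm d * (emb * nrm d)) \<le> \<epsilon> / 2 * nrm d"
    proof -
      have "(\<bar>\<beta>\<bar> + 1) * E * emb * nrm d \<le> \<epsilon>"
        using n E emb_pos \<open>\<bar>\<beta>\<bar> + 1 > 0\<close> by (simp add: \<kappa>2_def pos_le_divide_eq mult.commute)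
      moreover have "\<bar>\<beta>\<bar> * (E * emb * nrm d) \<le> (\<bar>\<beta>\<bar> + 1) * (E * emb * nrm d)"
        using E emb_pos by (intro mult_right_mono) auto
      ultimately have "\<bar>\<beta>\<bar> * (E * emb * nrm d) \<le> \<epsilon>" by (simp add: mult.assoc)
      from mult_right_mono[OF this, of "nrm d"] show ?thesis by (simp add: mult_ac)
    qed
    then have 4: "\<bar>\<beta> / 2 * ?I d d\<bar> \<le> \<epsilon> / 2 * nrm d"
      using mult_left_mono[OF 3, of "\<bar>\<beta>\<bar> / 2"] by (simp add: abs_mult)
    have "action (x + d) - action x - bending (response (deflection x)) d
        = (potential (deflection (x + d)) - potential (deflection x) - load (deflection x) (deflection d)) - \<beta> / 2 * ?I d d"
      unfolding action_def 2 bending_response[OF deflection_continuous d] by (simp add: algebra_simps)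
    then have "\<bar>action (x + d) - action x - bending (response (deflection x)) d\<bar> \<le> \<epsilon> / (2 * E) * (E * nrm d) + \<epsilon> / 2 * nrm d"
      using 1 4 by linarith
    also have "\<dots> = \<epsilon> * nrm d" using E by (simp add: field_simps)
    finally show ?thesis .
  qed
  then show ?thesis using \<kappa>1(1) E \<kappa>2 by (intro exI[of _ "min (\<kappa>1 / E) \<kappa>2"]) auto
qed

text \<open>The gradient depends on a curvature only through its deflection. Deflections of bounded
  seminorm are bounded and equi-Lipschitz, so Arzela--Ascoli gives uniform convergence along a
  subsequence, and \<open>response_modulus\<close> turns this into norm convergence of the
  responses.\<close>

sublocale compact_gradient bending clamped "\<lambda>z. response (deflection z)" action
proof (intro compact_gradient.intro compact_gradient_axioms.intro)
  show "semi_inner bending" by (rule semi_inner_axioms)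
  show "subspace clamped" by (rule subspace_clamped)
  show "closed clamped" by (rule closed_clamped)
  show "response (deflection x) \<in> clamped" for x
    unfolding response_def by (intro curvature_clamped response_continuous_arg deflection_continuous)
  show "response (deflection (- x)) = - response (deflection x)" for x
    unfolding deflection_uminus by (rule response_uminus[OF deflection_continuous])
  show "\<exists>\<kappa>>0. \<forall>x\<in>clamped. \<forall>y\<in>clamped. nrm (x - y) \<le> \<kappa> \<longrightarrow>
      norm (response (deflection x) - response (deflection y)) \<le> \<epsilon>" if \<epsilon>: "0 < \<epsilon>" for \<epsilon>
  proof -
    obtain \<kappa> where \<kappa>: "\<kappa> > 0" "\<And>u w. continuous_on {0..T} u \<Longrightarrow> continuous_on {0..T} w \<Longrightarrow>
        \<forall>x\<in>{0..T}. \<bar>u x - w x\<bar> \<le> \<kappa> \<Longrightarrow> norm (response u - response w) \<le> \<epsilon>"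
      using response_modulus[OF \<epsilon>] by blast
    have "norm (response (deflection x) - response (deflection y)) \<le> \<epsilon>"
      if n: "nrm (x - y) \<le> \<kappa> / (emb * T)" for x y
    proof (intro \<kappa>(2) deflection_continuous ballI)
      fix s assume s: "s \<in> {0..T}"
      have "emb * T * nrm (x - y) \<le> \<kappa>"
        using n emb_pos T_pos by (simp add: pos_le_divide_eq mult.commute)
      then show "\<bar>deflection x s - deflection y s\<bar> \<le> \<kappa>"
        using deflection_le[OF s, of "x - y"] by (simp add: deflection_diff)
    qed
    then show ?thesis
      using \<kappa>(1) emb_pos T_pos by (intro exI[of _ "\<kappa> / (emb * T)"]) auto
  qed
  show "\<exists>l k. strict_mono (k :: nat \<Rightarrow> nat) \<and> (\<lambda>n. response (deflection (f (k n)))) \<longlonglongrightarrow> l"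
    if R: "\<And>n. nrm (f n) \<le> R" for f :: "nat \<Rightarrow> real \<Rightarrow>\<^sub>C real" and R
  proof -
    have R0: "0 \<le> R" using R[of 0] nrm_ge_0[of "f 0"] by linarith
    have L: "(emb * R)-lipschitz_on {0..T} (deflection (f n))" for n
      using lipschitz_on_mono[OF deflection_lipschitz] R[of n] emb_pos by (simp add: mult_left_mono)
    obtain u k where u: "continuous_on {0..T} u" and k: "strict_mono (k :: nat \<Rightarrow> nat)"
      and lim: "\<And>e. 0 < e \<Longrightarrow> \<exists>N. \<forall>n x. n \<ge> N \<and> x \<in> {0..T} \<longrightarrow> norm (deflection (f (k n)) x - u x) < e"
    proof (rule Arzela_Ascoli[of "{0..T}" "\<lambda>n. deflection (f n)" "emb * T * R"])
      show "norm (deflection (f n) x) \<le> emb * T * R" if "x \<in> {0..T}" for n x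
      proof -
        have "emb * T * nrm (f n) \<le> emb * T * R" using R emb_pos T_pos by (intro mult_left_mono) auto
        then show ?thesis using deflection_le[OF that, of "f n"] by simp
      qed
      show "\<exists>d>0. \<forall>n y. y \<in> {0..T} \<and> norm (x - y) < d \<longrightarrow> norm (deflection (f n) x - deflection (f n) y) < e"
        if x: "x \<in> {0..T}" and e: "0 < e" for x e
      proof (intro exI[of _ "e / (emb * R + 1)"] conjI allI impI)
        have p: "0 < emb * R + 1" using emb_pos R0 by (intro add_nonneg_pos) auto
        then show "0 < e / (emb * R + 1)" using e by simp
        fix n y assume y: "y \<in> {0..T} \<and> norm (x - y) < e / (emb * R + 1)"
        have "norm (deflection (f n) x - deflection (f n) y) \<le> emb * R * norm (x - y)"
          using lipschitz_onD[OF L x, of y n] y by (simp add: dist_norm)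
        also have "\<dots> \<le> (emb * R + 1) * norm (x - y)" by (intro mult_right_mono) auto
        also have "\<dots> < e" using y p by (simp add: pos_less_divide_eq mult.commute)
        finally show "norm (deflection (f n) x - deflection (f n) y) < e" .
      qed
    qed (use that in auto)
    have "(\<lambda>n. response (deflection (f (k n)))) \<longlonglongrightarrow> response u"
    proof (rule LIMSEQ_I)
      fix e :: real assume e: "0 < e"
      obtain \<kappa> where \<kappa>: "\<kappa> > 0" "\<And>u w. continuous_on {0..T} u \<Longrightarrow> continuous_on {0..T} w \<Longrightarrow>
          \<forall>x\<in>{0..T}. \<bar>u x - w x\<bar> \<le> \<kappa> \<Longrightarrow> norm (response u - response w) \<le> e / 2"
        using response_modulus[of "e / 2"] e by auto
      obtain no where no: "\<And>n x. n \<ge> no \<Longrightarrow> x \<in> {0..T} \<Longrightarrow> norm (deflection (f (k n)) x - u x) < \<kappa>"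
        using lim[OF \<kappa>(1)] by blast
      have "norm (response (deflection (f (k n))) - response u) < e" if "n \<ge> no" for n
      proof -
        have "norm (response (deflection (f (k n))) - response u) \<le> e / 2"
          using no[OF that] by (intro \<kappa>(2) u deflection_continuous) (auto intro: less_imp_le)
        then show ?thesis using e by linarith
      qed
      then show "\<exists>no. \<forall>n\<ge>no. norm (response (deflection (f (k n))) - response u) < e" by blast
    qed
    then show ?thesis using k by blast
  qed
  have d0: "deflection 0 y = 0" for y using deflection_scaleR[of 0 0 y] by simp
  have "integral {0..T} (\<lambda>x. G x (deflection 0 x)) = integral {0..T} (\<lambda>x. 0)"
    by (intro integral_cong) (simp add: d0 G_0)
  then show "action 0 = 0"
    by (simp add: action_def potential_def d0 K_0)
  show "action (- x) = action x" for x
  proof -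
    have "integral {0..T} (\<lambda>y. G y (- deflection x y)) = integral {0..T} (\<lambda>y. G y (deflection x y))"
      by (intro integral_cong even_antiderivative_of_odd[OF G_deriv g_odd])
    moreover have "(\<Sum>i=1..N. K i (- deflection x (t i))) = (\<Sum>i=1..N. K i (deflection x (t i)))"
      by (intro sum.cong refl even_antiderivative_of_odd[OF K_deriv J_odd])
    ultimately show ?thesis
      by (simp add: action_def potential_def deflection_uminus uminus_bcontfun.rep_eq)
  qed
  show "\<exists>\<kappa>>0. \<forall>x\<in>clamped. \<forall>d\<in>clamped. nrm d \<le> \<kappa> \<longrightarrow>
      \<bar>action (x + d) - action x - bending (response (deflection x)) d\<bar> \<le> \<epsilon> * nrm d" if "0 < \<epsilon>" for \<epsilon>
    using that by (rule action_differentiable)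
qed

text \<open>The functionals are the deflections at the grid points i T / n. If they all vanish, the
  Lipschitz bound makes the deflection at most emb R' T / n, and the action, at most linear in this
  quantity within the ball, is at most D / n.\<close>

lemma action_finite_genus:
  assumes c: "0 < c"
  shows "\<exists>n (l :: nat \<Rightarrow> (real \<Rightarrow>\<^sub>C real) \<Rightarrow> real). (\<forall>i<n. bounded_linear (l i)) \<and>
      (\<forall>z\<in>clamped. nrm z \<le> R \<and> (\<forall>i<n. l i z = 0) \<longrightarrow> action z < c)"
proof -
  define R' where "R' = max R 0"
  define D where "D = (M * (T + real N) + \<bar>\<beta>\<bar> / 2 * (emb * R')) * (emb * R' * T)"
  obtain n :: nat where n: "D / c < real n" "0 < n"
    using reals_Archimedean2[of "max 1 (D / c)"] by force
  define l where "l i z = deflection z (real i * T / real n)" for i and z :: "real \<Rightarrow>\<^sub>C real"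
  have pt: "real i * T / real n \<in> {0..T}" if "i \<le> n" for i
    using that n(2) T_pos by (auto simp: field_simps)
  have "action z < c" if z: "nrm z \<le> R" "\<And>i. i \<le> n \<Longrightarrow> l i z = 0" for z
  proof -
    define \<eta> where "\<eta> = emb * R' * T / real n"
    have zR: "nrm z \<le> R'" "0 \<le> R'" using z(1) by (auto simp: R'_def)
    have small: "\<bar>deflection z y\<bar> \<le> \<eta>" if y: "y \<in> {0..T}" for y
    proof -
      \<comment> \<open>The nearest grid point to the left; the index \<open>n\<close> occurs for y
        = T, which is why n + 1 functionals are used.\<close>
      define i where "i = nat \<lfloor>y * real n / T\<rfloor>"
      have q: "0 \<le> y * real n / T" "y * real n / T \<le> real n" using y T_pos mult_right_mono[of y T "real n"] by (auto simp: pos_divide_le_eq mult.commute)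
      have i1: "real i \<le> y * real n / T" "y * real n / T < real i + 1"
        using q(1) unfolding i_def by linarith+
      then have "i \<le> n" using q(2) by linarith
      have "real i * T \<le> y * real n" "y * real n \<le> real i * T + T"
        using i1 T_pos by (simp_all add: pos_le_divide_eq pos_divide_less_eq algebra_simps)
      then have "real i * T / real n \<le> y" "y \<le> (real i * T + T) / real n"
        using n(2) by (simp_all add: pos_divide_le_eq pos_le_divide_eq)
      then have "real i * T / real n \<le> y" "y - real i * T / real n \<le> T / real n"
        by (simp_all add: add_divide_distrib)
      then have dist: "\<bar>y - real i * T / real n\<bar> \<le> T / real n" by simp
      have "\<bar>deflection z y\<bar> = \<bar>deflection z y - deflection z (real i * T / real n)\<bar>"
        using z(2)[OF \<open>i \<le> n\<close>] by (simp add: l_def)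
      also have "\<dots> \<le> emb * nrm z * \<bar>y - real i * T / real n\<bar>"
        using lipschitz_onD[OF deflection_lipschitz y pt[OF \<open>i \<le> n\<close>]] by (simp add: dist_real_def)
      also have "\<dots> \<le> emb * R' * (T / real n)"
        using dist zR emb_pos by (intro mult_mono) auto
      finally show ?thesis by (simp add: \<eta>_def)
    qed
    have \<eta>0: "0 \<le> \<eta>" unfolding \<eta>_def using emb_pos zR T_pos by simp
    have 1: "potential (deflection z) \<le> M * (T + real N) * \<eta>"
      using potential_bound[OF deflection_continuous small] by linarith
    have "\<bar>integral {0..T} (\<lambda>y. deflection z y * apply_bcontfun z y)\<bar> \<le> \<eta> * (emb * nrm z)"
      using small by (intro integral_mult_curvature_le deflection_continuous)
    also have "\<dots> \<le> \<eta> * (emb * R')" using \<eta>0 emb_pos zR by (intro mult_left_mono) auto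
    finally have "\<bar>\<beta> / 2 * integral {0..T} (\<lambda>y. deflection z y * apply_bcontfun z y)\<bar> \<le> \<bar>\<beta>\<bar> / 2 * (\<eta> * (emb * R'))"
      unfolding abs_mult by (intro mult_mono) auto
    then have "action z \<le> M * (T + real N) * \<eta> + \<bar>\<beta>\<bar> / 2 * (\<eta> * (emb * R'))"
      using 1 unfolding action_def by linarith
    also have "\<dots> = D / real n" by (simp add: D_def \<eta>_def algebra_simps add_divide_distrib)
    also have "\<dots> < c" using n c by (simp add: pos_divide_less_eq mult.commute)
    finally show ?thesis .
  qed
  moreover have "bounded_linear (l i)" if "i < Suc n" for i
    unfolding l_def[abs_def] using that by (intro bounded_linear_deflection pt) simp
  ultimately show ?thesis by (intro exI[of _ "Suc n"] exI[of _ l]) auto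
qed

end

section \<open>Spheres of negative energy and the weak equation\<close>

lemma cross_sphere_scaleR:
  assumes "x \<in> cross_sphere (\<lambda>i. c *\<^sub>R e i) n"
  obtains y where "y \<in> cross_sphere e n" "x = c *\<^sub>R y"
proof -
  obtain S where S: "S \<in> Pow {..n}" "x \<in> convex hull (set (orthant (\<lambda>i. c *\<^sub>R e i) n S))"
    using assms unfolding cross_sphere_def by blast
  have "set (orthant (\<lambda>i. c *\<^sub>R e i) n S) = (\<lambda>x. c *\<^sub>R x) ` set (orthant e n S)"
    unfolding set_orthant image_image by (intro image_cong) auto
  then obtain y where "y \<in> convex hull (set (orthant e n S))" "x = c *\<^sub>R y"
    using S(2) by (auto simp: convex_hull_scaling)
  then show thesis using that S(1) unfolding cross_sphere_def by blast
qed

context weighted_interval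
begin

lemma deflection_unique:
  assumes z: "\<And>x. x \<in> {0..T} \<Longrightarrow> (u' has_real_derivative apply_bcontfun z x) (at x within {0..T})"
    and u: "\<And>x. x \<in> {0..T} \<Longrightarrow> (u has_real_derivative u' x) (at x within {0..T})"
    and bc: "u 0 = 0" "u' 0 = 0" and y: "y \<in> {0..T}"
  shows "slope z y = u' y" "deflection z y = u y"
proof -
  have sl: "slope z x = u' x" if x: "x \<in> {0..T}" for x
  proof -
    have "(apply_bcontfun z has_integral (u' x - u' 0)) {0..x}"
      using x by (intro fundamental_theorem_of_calculus)
        (auto simp flip: has_real_derivative_iff_has_vector_derivative intro!: DERIV_subset[OF z])
    then show ?thesis by (simp add: slope_def bc integral_unique)
  qed
  show "slope z y = u' y" using sl y .
  have "(u' has_integral (u y - u 0)) {0..y}"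
    using y by (intro fundamental_theorem_of_calculus)
      (auto simp flip: has_real_derivative_iff_has_vector_derivative intro!: DERIV_subset[OF u])
  then have "(slope z has_integral (u y - u 0)) {0..y}"
    by (rule has_integral_eq[rotated]) (use sl y in auto)
  then show "deflection z y = u y" by (simp add: deflection_def bc integral_unique)
qed

text \<open>The squared quadratic factor has double zeros at 0 and T, so these polynomials and their
  slopes vanish there.\<close>

lemma clamped_polynomials:
  "\<exists>e :: nat \<Rightarrow> real \<Rightarrow>\<^sub>C real. \<forall>i. e i \<in> clamped \<and>
     (\<forall>y\<in>{0..T}. deflection (e i) y = poly (monom 1 i * ([:0, T, -1:] * [:0, T, -1:])) y)"
proof -
  have "\<exists>z. z \<in> clamped \<and> (\<forall>y\<in>{0..T}. deflection z y = poly (monom 1 i * ([:0, T, -1:] * [:0, T, -1:])) y)" for i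
  proof -
    define w where "w = [:0, T, -1:]"
    define r where "r = monom 1 i * (w * w)"
    have w: "poly w 0 = 0" "poly w T = 0" by (simp_all add: w_def algebra_simps)
    have r: "poly r 0 = 0" "poly r T = 0" "poly (pderiv r) 0 = 0" "poly (pderiv r) T = 0"
      by (simp_all add: r_def w pderiv_mult)
    have "continuous_on (cbox 0 T) (poly (pderiv (pderiv r)))" by (intro continuous_intros)
    then obtain z :: "real \<Rightarrow>\<^sub>C real" where z: "\<And>x. x \<in> cbox 0 T \<Longrightarrow> apply_bcontfun z x = poly (pderiv (pderiv r)) x"
      by (rule continuous_on_cbox_bcontfunE) blast
    have u: "slope z y = poly (pderiv r) y" "deflection z y = poly r y" if "y \<in> {0..T}" for y
    proof -
      have "(poly (pderiv r) has_real_derivative apply_bcontfun z x) (at x within {0..T})" if "x \<in> {0..T}" for x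
        using z[of x] that by (auto intro: has_field_derivative_at_within poly_DERIV)
      moreover have "(poly r has_real_derivative poly (pderiv r) x) (at x within {0..T})" for x
        by (auto intro: has_field_derivative_at_within poly_DERIV)
      ultimately show "slope z y = poly (pderiv r) y" "deflection z y = poly r y"
        using deflection_unique[of "poly (pderiv r)" z "poly r" y] r that by blast+
    qed
    have "z \<in> clamped" using u[of T] r T_pos by (simp add: clamped_def)
    then show ?thesis using u(2) unfolding r_def w_def by blast
  qed
  then show ?thesis by metis
qed

lemma deflection_sum: "y \<in> {0..T} \<Longrightarrow> deflection (\<Sum>i\<le>n. c i *\<^sub>R e i) y = (\<Sum>i\<le>n. c i * deflection (e i) y)"
  using linear_sum[OF bounded_linear.linear[OF bounded_linear_deflection], of y "\<lambda>i. c i *\<^sub>R e i" "{..n}"]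
  by (simp add: deflection_scaleR)

text \<open>A nonzero polynomial has finitely many roots, so no deflection on the sphere vanishes
  throughout {a..b}, the interval on which the force is known to be strong.\<close>

lemma clamped_spheres:
  assumes ab: "0 \<le> a" "a < b" "b \<le> T"
  shows "\<exists>e. \<forall>z\<in>cross_sphere e n. z \<in> clamped \<and> 0 < integral {a..b} (\<lambda>y. (deflection z y)\<^sup>2)"
proof -
  obtain e :: "nat \<Rightarrow> real \<Rightarrow>\<^sub>C real" where e: "\<And>i. e i \<in> clamped"
    "\<And>i y. y \<in> {0..T} \<Longrightarrow> deflection (e i) y = poly (monom 1 i * ([:0, T, -1:] * [:0, T, -1:])) y"
    using clamped_polynomials by blast
  define w where "w = [:0, T, -1:] * [:0, T, -1:]"
  have "z \<in> clamped \<and> 0 < integral {a..b} (\<lambda>y. (deflection z y)\<^sup>2)" if z_in: "z \<in> cross_sphere e n" for z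
  proof
    obtain c where c: "z = (\<Sum>i\<le>n. c i *\<^sub>R e i)" "(\<Sum>i\<le>n. \<bar>c i\<bar>) = 1"
      by (rule cross_sphereE[OF z_in])
    show "z \<in> clamped"
      unfolding c(1) using e(1) by (intro subspace_sum subspace_clamped subspace_scale)
    define q where "q = (\<Sum>i\<le>n. monom (c i) i)"
    define r where "r = q * w"
    have defl: "deflection z y = poly r y" if "y \<in> {0..T}" for y
      unfolding c(1) r_def q_def using that
      by (simp add: deflection_sum e(2) w_def[symmetric] poly_sum sum_distrib_right poly_monom mult.assoc
          del: mult_pCons_left mult_pCons_right)
    have "q \<noteq> 0"
    proof
      assume "q = 0"
      have "c i = 0" if "i \<le> n" for i
      proof -
        have "coeff q i = c i" unfolding q_def using that by (simp add: coeff_sum)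
        then show ?thesis using \<open>q = 0\<close> by simp
      qed
      then show False using c(2) by simp
    qed
    then have "r \<noteq> 0" using T_pos by (simp add: r_def w_def del: mult_pCons_left mult_pCons_right)
    then have "finite {x. poly r x = 0}" by (rule poly_roots_finite)
    moreover have "infinite {a..b}" using ab(2) by simp
    ultimately obtain y where y: "y \<in> {a..b}" "poly r y \<noteq> 0"
      by (metis (mono_tags, lifting) finite_subset mem_Collect_eq subsetI)
    have sub: "{a..b} \<subseteq> {0..T}" using ab by auto
    show "0 < integral {a..b} (\<lambda>y. (deflection z y)\<^sup>2)"
    proof (rule integral_pos_continuous[where x = y])
      show "continuous_on {a..b} (\<lambda>y. (deflection z y)\<^sup>2)"
        by (intro continuous_intros continuous_on_subset[OF deflection_continuous sub])
      show "0 < (deflection z y)\<^sup>2" using y defl[of y] sub by auto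
    qed (use ab y in auto)
  qed
  then show ?thesis by blast
qed

lemma bounded_bilinear_deflection_L2:
  assumes ab: "0 \<le> a" "a \<le> b" "b \<le> T"
  shows "bounded_bilinear (\<lambda>z w. integral {a..b} (\<lambda>y. deflection z y * deflection w y))"
proof
  have sub: "{a..b} \<subseteq> {0..T}" using ab by auto
  have int: "(\<lambda>y. deflection z y * deflection w y) integrable_on {a..b}" for z w
    by (intro integrable_continuous_real continuous_intros continuous_on_subset[OF deflection_continuous sub])
  show "integral {a..b} (\<lambda>y. deflection (z + z') y * deflection w y) =
      integral {a..b} (\<lambda>y. deflection z y * deflection w y) + integral {a..b} (\<lambda>y. deflection z' y * deflection w y)" for z z' w
    using integral_add[OF int[of z w] int[of z' w]] by (simp add: deflection_add distrib_right)
  show "integral {a..b} (\<lambda>y. deflection z y * deflection (w + w') y) =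
      integral {a..b} (\<lambda>y. deflection z y * deflection w y) + integral {a..b} (\<lambda>y. deflection z y * deflection w' y)" for z w w'
    using integral_add[OF int[of z w] int[of z w']] by (simp add: deflection_add distrib_left)
  show "integral {a..b} (\<lambda>y. deflection (r *\<^sub>R z) y * deflection w y) =
      r *\<^sub>R integral {a..b} (\<lambda>y. deflection z y * deflection w y)" for r z w
    by (simp add: deflection_scaleR mult.assoc)
  show "integral {a..b} (\<lambda>y. deflection z y * deflection (r *\<^sub>R w) y) =
      r *\<^sub>R integral {a..b} (\<lambda>y. deflection z y * deflection w y)" for r z w
    by (simp add: deflection_scaleR mult.left_commute)
  obtain k where k: "k > 0" "\<And>z. nrm z \<le> k * norm z" using nrm_le_norm by blast
  have bd: "\<bar>deflection z y\<bar> \<le> emb * T * k * norm z" if "y \<in> {0..T}" for z y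
  proof -
    have "emb * T * nrm z \<le> emb * T * (k * norm z)" using k(2) emb_pos T_pos by (intro mult_left_mono) auto
    then show ?thesis using deflection_le[OF that, of z] by (simp add: mult.assoc)
  qed
  show "\<exists>K. \<forall>z w. norm (integral {a..b} (\<lambda>y. deflection z y * deflection w y)) \<le> norm z * norm w * K"
  proof (intro exI allI)
    fix z w
    have "\<bar>integral {a..b} (\<lambda>y. deflection z y * deflection w y)\<bar>
        \<le> (emb * T * k * norm z) * (emb * T * k * norm w) * (b - a)"
    proof (rule abs_integral_le[OF ab(2)])
      fix y assume "y \<in> {a..b}"
      then have "y \<in> {0..T}" using sub by blast
      then show "\<bar>deflection z y * deflection w y\<bar> \<le> (emb * T * k * norm z) * (emb * T * k * norm w)"
        unfolding abs_mult using bd emb_pos T_pos k(1) by (intro mult_mono) auto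
    qed
    then show "norm (integral {a..b} (\<lambda>y. deflection z y * deflection w y))
        \<le> norm z * norm w * ((emb * T * k) * (emb * T * k) * (b - a))"
      by (simp add: mult_ac)
  qed
qed

end

context impulsive_beam
begin

text \<open>On a sphere scaled by s the quadratic part of the energy is at most D s^2, whereas the
  potential exceeds any multiple of the squared deflection near 0 on {a..b}.\<close>

lemma negative_spheres:
  assumes ab: "0 \<le> a" "a < b" "b \<le> T"
    and sublinear: "\<And>C. \<exists>\<rho>>0. \<forall>x\<in>{a..b}. \<forall>r. \<bar>r\<bar> \<le> \<rho> \<longrightarrow> C * r\<^sup>2 \<le> G x r"
    and nonneg_G: "0 < \<rho>0" "\<And>x r. x \<in> {0..T} \<Longrightarrow> \<bar>r\<bar> \<le> \<rho>0 \<Longrightarrow> 0 \<le> G x r"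
    and nonneg_K: "\<And>i r. i \<in> {1..N} \<Longrightarrow> \<bar>r\<bar> \<le> \<rho>0 \<Longrightarrow> 0 \<le> K i r"
    and \<rho>: "0 < \<rho>"
  shows "\<exists>e \<epsilon>. 0 < \<epsilon> \<and> (\<forall>z\<in>cross_sphere e n. z \<in> clamped \<and> nrm z \<le> \<rho> \<and> energy z \<le> - \<epsilon>)"
proof -
  have sub: "{a..b} \<subseteq> {0..T}" using ab by auto
  obtain e where e: "\<And>z. z \<in> cross_sphere e n \<Longrightarrow> z \<in> clamped"
    "\<And>z. z \<in> cross_sphere e n \<Longrightarrow> 0 < integral {a..b} (\<lambda>y. (deflection z y)\<^sup>2)"
    using clamped_spheres[OF ab, of n] by blast
  let ?X = "cross_sphere e n"
  have ne: "?X \<noteq> {}"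
    using hull_orthant_subset[of 0 n e "{0}"] by (auto simp: orthant_def)
  have "continuous_on ?X (\<lambda>z. integral {a..b} (\<lambda>y. deflection z y * deflection z y))"
    using ab by (intro bounded_bilinear.continuous_on[OF bounded_bilinear_deflection_L2] continuous_on_id) auto
  then obtain z0 where z0: "z0 \<in> ?X" "\<And>z. z \<in> ?X \<Longrightarrow>
      integral {a..b} (\<lambda>y. (deflection z0 y)\<^sup>2) \<le> integral {a..b} (\<lambda>y. (deflection z y)\<^sup>2)"
    using continuous_attains_inf[OF compact_cross_sphere ne] unfolding power2_eq_square by blast
  define m where "m = integral {a..b} (\<lambda>y. (deflection z0 y)\<^sup>2)"
  have m: "0 < m" using e(2)[OF z0(1)] by (simp add: m_def)
  obtain B0 where B0: "\<And>z. z \<in> ?X \<Longrightarrow> norm z \<le> B0"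
    using compact_imp_bounded[OF compact_cross_sphere[of e n]] unfolding bounded_iff by blast
  obtain k where k: "k > 0" "\<And>z. nrm z \<le> k * norm z" using nrm_le_norm by blast
  define R where "R = max 1 (k * B0)"
  have R: "1 \<le> R" "\<And>z. z \<in> ?X \<Longrightarrow> nrm z \<le> R"
  proof -
    fix z assume "z \<in> ?X"
    then have "k * norm z \<le> k * B0" using B0 k(1) by (intro mult_left_mono) auto
    then show "nrm z \<le> R" using k(2)[of z] by (simp add: R_def)
  qed (simp add: R_def)
  \<comment> \<open>\<open>D\<close> bounds the quadratic part on the unscaled sphere, and m > 0 is
    the least value of the squared deflection integrated over {a..b}. With C = (D + 1) / m the
    potential wins by s^2.\<close>
  define D where "D = R\<^sup>2 / 2 + \<bar>\<beta>\<bar> / 2 * (emb * T * R * (emb * R))"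
  have D: "0 \<le> D" unfolding D_def using R(1) emb_pos T_pos by (intro add_nonneg_nonneg mult_nonneg_nonneg) auto
  define C where "C = (D + 1) / m"
  obtain \<rho>1 where \<rho>1: "0 < \<rho>1" "\<And>x r. x \<in> {a..b} \<Longrightarrow> \<bar>r\<bar> \<le> \<rho>1 \<Longrightarrow> C * r\<^sup>2 \<le> G x r"
    using sublinear[of C] by blast
  \<comment> \<open>The first bound places the scaled sphere in the ball of radius \<rho>, the
    second keeps its deflections where the lower bounds on \<open>G\<close> and \<open>K\<close>
    hold.\<close>
  define s where "s = min (\<rho> / R) (min \<rho>1 \<rho>0 / (emb * T * R))"
  have pos: "0 < emb * T * R" using emb_pos T_pos R(1) by simp
  have s: "0 < s" "s * R \<le> \<rho>" "s * (emb * T * R) \<le> min \<rho>1 \<rho>0"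
  proof -
    show "0 < s" using \<rho> \<rho>1(1) nonneg_G(1) R(1) pos by (simp add: s_def)
    have "s \<le> \<rho> / R" "s \<le> min \<rho>1 \<rho>0 / (emb * T * R)" by (simp_all add: s_def)
    then show "s * R \<le> \<rho>" "s * (emb * T * R) \<le> min \<rho>1 \<rho>0"
      using R(1) pos by (simp_all add: pos_le_divide_eq del: min.bounded_iff)
  qed
  have "x \<in> clamped \<and> nrm x \<le> \<rho> \<and> energy x \<le> - s\<^sup>2" if x_in: "x \<in> cross_sphere (\<lambda>i. s *\<^sub>R e i) n" for x
  proof -
    obtain z where z: "z \<in> ?X" "x = s *\<^sub>R z" by (rule cross_sphere_scaleR[OF x_in])
    have xc: "x \<in> clamped" unfolding z(2) using e(1)[OF z(1)] by (rule V_scaleR)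
    have nx: "nrm x \<le> s * R" unfolding z(2) nrm_scaleR using R(2)[OF z(1)] s(1) by simp
    have dx: "\<bar>deflection x y\<bar> \<le> s * (emb * T * R)" if "y \<in> {0..T}" for y
    proof -
      have "emb * T * nrm x \<le> emb * T * (s * R)" using nx emb_pos T_pos by (intro mult_left_mono) auto
      then show ?thesis using deflection_le[OF that, of x] by (simp add: mult_ac)
    qed
    have small: "\<bar>deflection x y\<bar> \<le> \<rho>1" "\<bar>deflection x y\<bar> \<le> \<rho>0" if "y \<in> {0..T}" for y
      using dx[OF that] s(3) by auto
    have Gint: "(\<lambda>y. G y (deflection x y)) integrable_on {0..T}" by (rule G_integrable[OF deflection_continuous])
    have "(D + 1) * s\<^sup>2 \<le> C * (s\<^sup>2 * integral {a..b} (\<lambda>y. (deflection z y)\<^sup>2))"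
    proof -
      have "m * s\<^sup>2 \<le> s\<^sup>2 * integral {a..b} (\<lambda>y. (deflection z y)\<^sup>2)"
        using z0(2)[OF z(1)] by (simp add: m_def mult.commute mult_left_mono)
      then have "C * (m * s\<^sup>2) \<le> C * (s\<^sup>2 * integral {a..b} (\<lambda>y. (deflection z y)\<^sup>2))"
        using D m by (intro mult_left_mono) (auto simp: C_def)
      then show ?thesis using m by (simp add: C_def)
    qed
    also have "\<dots> = integral {a..b} (\<lambda>y. C * (deflection x y)\<^sup>2)"
      by (simp add: z(2) deflection_scaleR power_mult_distrib)
    also have "\<dots> \<le> integral {a..b} (\<lambda>y. G y (deflection x y))"
    proof (rule integral_le)
      show "(\<lambda>y. C * (deflection x y)\<^sup>2) integrable_on {a..b}"
        by (intro integrable_continuous_real continuous_intros continuous_on_subset[OF deflection_continuous sub])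
      show "(\<lambda>y. G y (deflection x y)) integrable_on {a..b}" by (rule integrable_on_subinterval[OF Gint sub])
      show "C * (deflection x y)\<^sup>2 \<le> G y (deflection x y)" if "y \<in> {a..b}" for y
        using \<rho>1(2)[OF that small(1)] that sub by blast
    qed
    also have "\<dots> \<le> integral {0..T} (\<lambda>y. G y (deflection x y))"
      using nonneg_G(2) small(2)
      by (intro integral_subset_le[OF sub integrable_on_subinterval[OF Gint sub] Gint]) auto
    also have "\<dots> \<le> potential (deflection x)"
    proof -
      have "0 \<le> (\<Sum>i=1..N. K i (deflection x (t i)))"
        by (intro sum_nonneg nonneg_K small(2) t_mem)
      then show ?thesis by (simp add: potential_def)
    qed
    finally have pot: "(D + 1) * s\<^sup>2 \<le> potential (deflection x)" .
    have "\<bar>integral {0..T} (\<lambda>y. deflection x y * apply_bcontfun x y)\<bar> \<le> s * (emb * T * R) * (emb * nrm x)"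
      using dx by (intro integral_mult_curvature_le deflection_continuous)
    also have "\<dots> \<le> s * (emb * T * R) * (emb * (s * R))"
      using nx s(1) pos emb_pos by (intro mult_left_mono) auto
    also have "\<dots> = s\<^sup>2 * (emb * T * R * (emb * R))" by (simp add: power2_eq_square mult_ac)
    finally have "\<bar>\<beta> / 2 * integral {0..T} (\<lambda>y. deflection x y * apply_bcontfun x y)\<bar> \<le> \<bar>\<beta>\<bar> / 2 * (s\<^sup>2 * (emb * T * R * (emb * R)))"
      unfolding abs_mult by (intro mult_mono) auto
    moreover have "bending x x \<le> s\<^sup>2 * R\<^sup>2"
      using power_mono[OF nx nrm_ge_0, of 2] by (simp add: nrm_square power_mult_distrib)
    ultimately have "energy x \<le> s\<^sup>2 * R\<^sup>2 / 2 + \<bar>\<beta>\<bar> / 2 * (s\<^sup>2 * (emb * T * R * (emb * R))) - (D + 1) * s\<^sup>2"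
      using pot unfolding energy_def action_def by linarith
    also have "\<dots> = - s\<^sup>2" by (simp add: D_def algebra_simps)
    finally show ?thesis using xc nx s(2) by simp
  qed
  then show ?thesis using s(1) by (intro exI[of _ "\<lambda>i. s *\<^sub>R e i"] exI[of _ "s\<^sup>2"]) auto
qed

text \<open>Testing the equation with \<open>z\<close> itself, every term on the right contains the
  deflection, so a vanishing deflection would force zero energy.\<close>

lemma fixed_point_nontrivial:
  assumes z: "z \<in> clamped" "response (deflection z) = z" "0 < nrm z"
  shows "\<exists>y\<in>{0..T}. deflection z y \<noteq> 0"
proof (rule ccontr)
  assume "\<not> ?thesis"
  then have 0: "\<And>y. y \<in> {0..T} \<Longrightarrow> deflection z y = 0" by blast
  have "bending z z = load (deflection z) (deflection z)
      - \<beta> * integral {0..T} (\<lambda>y. deflection z y * apply_bcontfun z y)"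
    using bending_response[OF deflection_continuous z(1), of z] z(2) by simp
  also have "integral {0..T} (\<lambda>y. deflection z y * apply_bcontfun z y) = integral {0..T} (\<lambda>y. 0)"
    by (intro integral_cong) (simp add: 0)
  also have "load (deflection z) (deflection z) = 0"
  proof -
    have "integral {0..T} (\<lambda>x. g x (deflection z x) * deflection z x) = integral {0..T} (\<lambda>y. 0)"
      by (intro integral_cong) (simp add: 0)
    then show ?thesis using 0 t_mem by (simp add: load_def)
  qed
  finally show False using z(3) by (simp add: nrm_def)
qed

text \<open>\<open>bending_response\<close> tests with continuous second derivatives only. For the
  larger test space the explicit form of \<open>W z\<close>, load moment minus \<beta> times
  deflection minus an affine function, is multiplied by d = v'' and integrated by parts
  anew.\<close>

theorem fixed_point_weak_equation:
  assumes z: "z \<in> clamped" "response (deflection z) = z"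
    and p: "absolutely_continuous_fun_on {0..T} p"
    and N: "negligible S" "\<And>x. x \<in> {0..T} - S \<Longrightarrow> (p has_real_derivative d x) (at x within {0..T})"
    and v: "\<And>x. x \<in> {0..T} \<Longrightarrow> (v has_real_derivative p x) (at x within {0..T})"
    and bc: "v 0 = 0" "v T = 0" "p 0 = 0" "p T = 0"
  shows "((\<lambda>y. W y * apply_bcontfun z y * d y) has_integral
    (load (deflection z) v + \<beta> * integral {0..T} (\<lambda>y. slope z y * p y))) {0..T}"
proof -
  let ?u = "deflection z"
  let ?h = "\<lambda>y. load_moment ?u y - \<beta> * ?u y"
  have T0: "0 \<le> T" using T_pos by simp
  have p_cont: "continuous_on {0..T} p" by (rule absolutely_continuous_fun_on_continuous[OF p])
  have L: "((\<lambda>y. load_moment ?u y * d y) has_integral load ?u v) {0..T}"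
    by (rule load_moment_represents_load[OF deflection_continuous p N v bc])
  have "((\<lambda>y. slope z y * p y + ?u y * d y) has_integral (?u T * p T - ?u 0 * p 0)) {0..T}"
  proof (rule fundamental_theorem_of_calculus_absolutely_continuous[OF T0 _ N(1)])
    show "absolutely_continuous_fun_on {0..T} (\<lambda>y. ?u y * p y)"
      by (rule absolutely_continuous_fun_on_mult_lipschitz[OF deflection_lipschitz p])
    show "((\<lambda>y. ?u y * p y) has_vector_derivative slope z x * p x + ?u x * d x) (at x within {0..T})"
      if "x \<in> {0..T} - S" for x
      unfolding has_real_derivative_iff_has_vector_derivative[symmetric]
      using that N(2)[OF that] by (auto intro!: derivative_eq_intros deflection_deriv)
  qed
  then have S: "((\<lambda>y. slope z y * p y + ?u y * d y) has_integral 0) {0..T}" using bc by simp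
  have I: "((\<lambda>y. slope z y * p y) has_integral integral {0..T} (\<lambda>y. slope z y * p y)) {0..T}"
    by (intro integrable_integral integrable_continuous_real continuous_intros slope_continuous p_cont)
  have U: "((\<lambda>y. ?u y * d y) has_integral - integral {0..T} (\<lambda>y. slope z y * p y)) {0..T}"
    using has_integral_diff[OF S I] by simp
  \<comment> \<open>By the end conditions, \<open>d\<close> annihilates 1 and, below, y - centre, so
    the affine part of \<open>W z\<close> contributes nothing.\<close>
  have "((\<lambda>y. 1 * d y - 0 * v y) has_integral (1 * p T - 0 * v T - (1 * p 0 - 0 * v 0))) {0..T}"
    by (rule integration_by_parts_absolutely_continuous[OF T0 p N v, of "\<lambda>_. 1" "\<lambda>_. 0" 0 "{}" "\<lambda>_. 0"])
      (auto intro: lipschitz_onI)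
  then have d1: "(d has_integral 0) {0..T}" using bc by simp
  have "((\<lambda>y. (y - centre) * d y - 0 * v y) has_integral
      ((T - centre) * p T - 1 * v T - ((0 - centre) * p 0 - 1 * v 0))) {0..T}"
    by (rule integration_by_parts_absolutely_continuous[OF T0 p N v, of "\<lambda>y. y - centre" "\<lambda>_. 1" 0 "{}" "\<lambda>_. 0"])
      (auto intro!: lipschitz_onI derivative_eq_intros)
  then have d2: "((\<lambda>y. (y - centre) * d y) has_integral 0) {0..T}" using bc by simp
  have "((\<lambda>y. load_moment ?u y * d y - \<beta> * (?u y * d y) - mean ?h * d y - moment ?h * ((y - centre) * d y)) has_integral
      (load ?u v - \<beta> * (- integral {0..T} (\<lambda>y. slope z y * p y)) - mean ?h * 0 - moment ?h * 0)) {0..T}"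
    by (intro has_integral_diff has_integral_mult_right L U d1 d2)
  then have "((\<lambda>y. W y * apply_bcontfun z y * d y) has_integral
      (load ?u v - \<beta> * (- integral {0..T} (\<lambda>y. slope z y * p y)) - mean ?h * 0 - moment ?h * 0)) {0..T}"
  proof (rule has_integral_eq[rotated])
    fix y assume y: "y \<in> {0..T}"
    have "apply_bcontfun z y = project ?h y"
      using curvature_eq[OF response_continuous_arg[OF deflection_continuous] y] z(2) by (metis response_def)
    then have Wz: "W y * apply_bcontfun z y = ?h y - mean ?h - moment ?h * (y - centre)"
      using W_nonzero[OF y] by (simp add: project_def)
    show "load_moment ?u y * d y - \<beta> * (?u y * d y) - mean ?h * d y - moment ?h * ((y - centre) * d y)
        = W y * apply_bcontfun z y * d y"
      unfolding Wz by algebra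
  qed
  then show ?thesis by simp
qed

end

section \<open>The space H20\<close>

lemma primitive_antiderivative:
  assumes q: "continuous_on {-d..d} q" and r: "\<bar>r\<bar> \<le> d"
    and F: "\<And>x. x \<in> {-d..d} \<Longrightarrow> (F has_real_derivative q x) (at x within {-d..d})"
  shows "primitive q r = F r - F 0"
proof -
  have sub: "{min 0 r..max 0 r} \<subseteq> {-d..d}" using r by auto
  have "(LBINT x=ereal 0..ereal r. q x) = F r - F 0"
  proof (rule interval_integral_FTC_finite)
    show "continuous_on {min 0 r..max 0 r} q" using q sub by (rule continuous_on_subset)
    show "(F has_vector_derivative q x) (at x within {min 0 r..max 0 r})"
      if "min 0 r \<le> x" "x \<le> max 0 r" for x
      unfolding has_real_derivative_iff_has_vector_derivative[symmetric]
      using that sub by (intro DERIV_subset[OF F _]) auto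
  qed
  then show ?thesis by (simp add: primitive_def zero_ereal_def)
qed

text \<open>The substitution x = s r moves the integral to a fixed interval. This removes the
  orientation for negative r and lets continuity in further parameters pass through the
  integral.\<close>

lemma primitive_eq_integral:
  assumes q: "continuous_on {-d..d} q" and r: "\<bar>r\<bar> \<le> d"
  shows "primitive q r = r * integral {0..1} (\<lambda>s. q (s * r))"
proof -
  define F where "F x = integral {-d..x} q" for x
  have F: "(F has_real_derivative q x) (at x within {-d..d})" if "x \<in> {-d..d}" for x
    unfolding F_def[abs_def] using q that by (rule integral_has_real_derivative)
  have mem: "s * r \<in> {-d..d}" if "s \<in> {0..1}" for s
  proof -
    have "\<bar>s * r\<bar> \<le> 1 * d" unfolding abs_mult using that r by (intro mult_mono) auto
    then show ?thesis by auto
  qed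
  have "((\<lambda>s. r * q (s * r)) has_integral (F (1 * r) - F (0 * r))) {0..1}"
  proof (rule fundamental_theorem_of_calculus)
    fix s :: real assume s: "s \<in> {0..1}"
    have "(F has_real_derivative q (s * r)) (at (s * r) within (\<lambda>s. s * r) ` {0..1})"
      using mem by (intro DERIV_subset[OF F[OF mem[OF s]]]) auto
    moreover have "((\<lambda>s. s * r) has_real_derivative r) (at s within {0..1})"
      by (auto intro!: derivative_eq_intros)
    ultimately have "(F \<circ> (\<lambda>s. s * r) has_real_derivative q (s * r) * r) (at s within {0..1})"
      by (rule DERIV_image_chain)
    then show "((\<lambda>s. F (s * r)) has_vector_derivative r * q (s * r)) (at s within {0..1})"
      by (simp add: has_real_derivative_iff_has_vector_derivative o_def mult.commute)
  qed simp
  from integral_unique[OF this] show ?thesis using primitive_antiderivative[OF q r F] by simp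
qed

lemma primitive_deriv:
  assumes "continuous_on UNIV q"
  shows "(primitive q has_real_derivative q r) (at r)"
proof -
  define d where "d = \<bar>r\<bar> + 1"
  define F where "F x = integral {-d..x} q" for x
  have q: "continuous_on {-d..d} q" using assms by (rule continuous_on_subset) simp
  have F: "(F has_real_derivative q x) (at x within {-d..d})" if "x \<in> {-d..d}" for x
    unfolding F_def[abs_def] using q that by (rule integral_has_real_derivative)
  have r: "r \<in> interior {-d..d}" by (auto simp: d_def)
  then have "((\<lambda>x. F x - F 0) has_real_derivative q r) (at r)"
    using F[of r] interior_subset[of "{-d..d}"] at_within_interior[OF r]
    by (auto intro!: derivative_eq_intros)
  then show ?thesis
  proof (rule has_field_derivative_transform_within_open)
    show "open {-d<..<d}" "r \<in> {-d<..<d}" by (auto simp: d_def)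
    show "F x - F 0 = primitive q x" if "x \<in> {-d<..<d}" for x
      using primitive_antiderivative[OF q _ F] that by auto
  qed
qed

lemma primitive_0 [simp]: "primitive q 0 = 0"
  by (simp add: primitive_def zero_ereal_def)

lemma continuous_primitive_Icc:
  assumes "continuous_on {0..T} h"
  shows "continuous_on {0..T} (primitive h)"
proof -
  have eq: "primitive h x = integral {0..x} h" if "x \<in> {0..T}" for x
    using interval_integral_eq_integral[of 0 x h]
      borel_integrable_atLeastAtMost'[OF continuous_on_subset[OF assms, of "{0..x}"]] that
    by (simp add: primitive_def zero_ereal_def)
  have "continuous_on {0..T} (\<lambda>x. integral {0..x} h)"
    using integral_has_real_derivative[OF assms] by (intro DERIV_continuous_on) auto
  then show ?thesis by (rule continuous_on_eq) (simp add: eq)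
qed

lemma primitive_nonneg_of_odd:
  assumes J: "\<And>r. (K has_real_derivative J r) (at r)" "\<And>r. J (- r) = - J r" and "K 0 = 0"
    and nonneg: "\<And>r. 0 \<le> r \<Longrightarrow> r \<le> \<delta> \<Longrightarrow> 0 \<le> J r" and r: "\<bar>r\<bar> \<le> \<delta>"
  shows "0 \<le> (K r :: real)"
proof -
  have *: "0 \<le> K r" if r: "0 \<le> r" "r \<le> \<delta>" for r
  proof -
    have "K 0 \<le> K r"
      using r(1)
    proof (rule DERIV_nonneg_imp_nondecreasing)
      fix x assume "0 \<le> x" "x \<le> r"
      then show "\<exists>y. (K has_real_derivative y) (at x) \<and> 0 \<le> y"
        using J(1)[of x] nonneg[of x] r by auto
    qed
    then show ?thesis using assms(3) by simp
  qed
  show ?thesis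
    using *[of r] *[of "- r"] even_antiderivative_of_odd[OF J, of r] r by (cases "0 \<le> r") auto
qed

lemma H20D:
  assumes T: "0 < T" and v: "v \<in> H20 T"
  shows "absolutely_continuous_fun_on {0..T} (D1 T v)"
    and "\<And>x. x \<in> {0..T} \<Longrightarrow> (v has_real_derivative D1 T v x) (at x within {0..T})"
    and "\<exists>S. negligible S \<and> (\<forall>x\<in>{0..T} - S. (D1 T v has_real_derivative D2 T v x) (at x within {0..T}))"
    and "v 0 = 0" "v T = 0" "D1 T v 0 = 0" "D1 T v T = 0"
    and "D2 T v absolutely_integrable_on {0..T}"
proof -
  show "absolutely_continuous_fun_on {0..T} (D1 T v)" "v 0 = 0" "v T = 0" "D1 T v 0 = 0" "D1 T v T = 0"
    using v by (auto simp: H20_def)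
  show "(v has_real_derivative D1 T v x) (at x within {0..T})" if "x \<in> {0..T}" for x
  proof -
    have "v differentiable (at x within {0..T})"
      using v that by (auto simp: H20_def differentiable_on_def)
    then show ?thesis
      by (simp add: D1_def has_real_derivative_iff_has_vector_derivative vector_derivative_works)
  qed
  have "AE x in lebesgue. x \<in> {0..T} \<longrightarrow> D1 T v differentiable (at x within {0..T})"
    using v by (simp add: H20_def)
  then obtain S where S: "S \<in> null_sets lebesgue"
    "{x. \<not> (x \<in> {0..T} \<longrightarrow> D1 T v differentiable (at x within {0..T}))} \<subseteq> S"
    by (auto simp: eventually_ae_filter)
  have "(D1 T v has_real_derivative D2 T v x) (at x within {0..T})" if "x \<in> {0..T} - S" for x
  proof -
    have "D1 T v differentiable (at x within {0..T})" using S(2) that by blast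
    then show ?thesis
      by (simp add: D2_def D1_def[of T "D1 T v"] has_real_derivative_iff_has_vector_derivative vector_derivative_works)
  qed
  then show "\<exists>S. negligible S \<and> (\<forall>x\<in>{0..T} - S. (D1 T v has_real_derivative D2 T v x) (at x within {0..T}))"
    using S(1) negligible_iff_null_sets by blast
  have L2: "set_borel_measurable lebesgue {0..T} (D2 T v)" "set_integrable lebesgue {0..T} (\<lambda>x. (D2 T v x)\<^sup>2)"
    using v by (auto simp: H20_def L2_on_def)
  have meas: "D2 T v \<in> borel_measurable (lebesgue_on {0..T})"
    using L2(1) by (simp add: set_borel_measurable_def borel_measurable_restrict_space_iff mult.commute)
  show "D2 T v absolutely_integrable_on {0..T}"
  proof (rule measurable_bounded_by_integrable_imp_absolutely_integrable[OF meas])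
    \<comment> \<open>Square integrability on a bounded interval gives integrability through |a|
      \<le> 1 + a^2.\<close>
    show "(\<lambda>x. 1 + (D2 T v x)\<^sup>2) integrable_on {0..T}"
      by (intro integrable_add integrable_const_ivl set_lebesgue_integral_eq_integral(1)[OF L2(2)])
    show "norm (D2 T v x) \<le> 1 + (D2 T v x)\<^sup>2" for x
    proof -
      have "0 \<le> (\<bar>D2 T v x\<bar> - 1)\<^sup>2" by simp
      then have "2 * \<bar>D2 T v x\<bar> \<le> 1 + (D2 T v x)\<^sup>2" by (simp add: power2_diff)
      then show ?thesis by simp
    qed
  qed simp
qed

context weighted_interval
begin

text \<open>Cut off because members of \<open>H20\<close> vanish outside {0..T}, whereas a
  deflection may continue beyond T.\<close>

definition profile :: "(real \<Rightarrow>\<^sub>C real) \<Rightarrow> real \<Rightarrow> real" where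
  "profile z y = (if y \<in> {0..T} then deflection z y else 0)"

lemma profile_deriv:
  assumes y: "y \<in> {0..T}"
  shows "(profile z has_real_derivative slope z y) (at y within {0..T})"
  by (rule has_field_derivative_transform_within[OF deflection_deriv[OF y, of z] zero_less_one y])
    (simp add: profile_def)

lemma D1_profile: "y \<in> {0..T} \<Longrightarrow> D1 T (profile z) y = slope z y"
  unfolding D1_def using profile_deriv T_pos
  by (intro vector_derivative_within_closed_interval)
    (auto simp flip: has_real_derivative_iff_has_vector_derivative)

lemma D1_profile_deriv:
  assumes y: "y \<in> {0..T}"
  shows "(D1 T (profile z) has_real_derivative apply_bcontfun z y) (at y within {0..T})"
  by (rule has_field_derivative_transform_within[OF slope_deriv[OF y, of z] zero_less_one y])
    (simp add: D1_profile)

lemma D2_profile: "y \<in> {0..T} \<Longrightarrow> D2 T (profile z) y = apply_bcontfun z y"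
  unfolding D2_def D1_def[of T "D1 T (profile z)"] using D1_profile_deriv T_pos
  by (intro vector_derivative_within_closed_interval)
    (auto simp flip: has_real_derivative_iff_has_vector_derivative)

lemma profile_H20:
  assumes "z \<in> clamped"
  shows "profile z \<in> H20 T"
proof -
  have T: "0 \<in> {0..T}" "T \<in> {0..T}" using T_pos by auto
  have "absolutely_continuous_fun_on {0..T} (profile z)"
    by (rule absolutely_continuous_fun_on_cong[OF _ absolutely_continuous_fun_on_lipschitz[OF deflection_lipschitz[of z]]])
      (simp add: profile_def)
  moreover have "profile z differentiable_on {0..T}"
    unfolding differentiable_on_def real_differentiable_def using profile_deriv by blast
  moreover have "absolutely_continuous_fun_on {0..T} (D1 T (profile z))"
    by (rule absolutely_continuous_fun_on_cong[OF _ slope_absolutely_continuous[of z]]) (simp add: D1_profile)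
  moreover have "AE x in lebesgue. x \<in> {0..T} \<longrightarrow> D1 T (profile z) differentiable (at x within {0..T})"
    unfolding real_differentiable_def using D1_profile_deriv by (intro AE_I2) blast
  moreover have "L2_on {0..T} (D2 T (profile z))"
  proof -
    have "continuous_on {0..T} (D2 T (profile z))"
      by (rule continuous_on_eq[of _ "apply_bcontfun z"]) (auto simp: D2_profile)
    moreover from this have "continuous_on {0..T} (\<lambda>x. (D2 T (profile z) x)\<^sup>2)"
      by (intro continuous_intros)
    ultimately have "D2 T (profile z) absolutely_integrable_on {0..T}"
      "(\<lambda>x. (D2 T (profile z) x)\<^sup>2) absolutely_integrable_on {0..T}"
      by (auto intro: absolutely_integrable_continuous_real)
    then show ?thesis
      by (auto simp: L2_on_def set_borel_measurable_def set_integrable_def)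
  qed
  ultimately show ?thesis
    using assms T by (auto simp: H20_def D1_profile profile_def clamped_def)
qed

lemma sup_norm_profile_le:
  assumes "\<And>y. y \<in> {0..T} \<Longrightarrow> \<bar>deflection z y\<bar> \<le> c"
  shows "sup_norm T (profile z) \<le> c"
  unfolding sup_norm_def using assms T_pos by (intro cSUP_least) (auto simp: profile_def)

lemma sup_norm_profile_ge:
  assumes "y \<in> {0..T}"
  shows "\<bar>deflection z y\<bar> \<le> sup_norm T (profile z)"
proof -
  have "bdd_above ((\<lambda>x. \<bar>profile z x\<bar>) ` {0..T})"
    using deflection_le[of _ z] by (intro bdd_aboveI[of _ "emb * T * nrm z"]) (auto simp: profile_def)
  from cSUP_upper[OF assms this] show ?thesis using assms by (simp add: sup_norm_def profile_def)
qed

end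

context impulsive_beam
begin

text \<open>The weak equation was proved for gauge integrals. Both products are absolutely
  integrable, the first as a bounded factor times an integrable second derivative, so the Lebesgue
  integrals have the same values.\<close>

lemma weak_equation_lebesgue:
  assumes z: "z \<in> clamped" "response (deflection z) = z" and v: "v \<in> H20 T"
  shows "(LINT x:{0..T}|lebesgue. W x * D2 T (profile z) x * D2 T v x)
    - \<beta> * (LINT x:{0..T}|lebesgue. D1 T (profile z) x * D1 T v x) = load (deflection z) v"
proof -
  note v' = H20D[OF T_pos v]
  obtain S where S: "negligible S" "\<And>x. x \<in> {0..T} - S \<Longrightarrow> (D1 T v has_real_derivative D2 T v x) (at x within {0..T})"
    using v'(3) by blast
  have c1: "continuous_on {0..T} (\<lambda>x. W x * D2 T (profile z) x)"
    by (rule continuous_on_eq[of _ "\<lambda>x. W x * apply_bcontfun z x"])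
      (auto simp: D2_profile intro!: continuous_intros W_cont)
  have "bounded ((\<lambda>x. W x * D2 T (profile z) x) ` {0..T})"
    by (rule compact_imp_bounded[OF compact_continuous_image[OF c1 compact_Icc]])
  then have 1: "(\<lambda>x. W x * D2 T (profile z) x * D2 T v x) absolutely_integrable_on {0..T}"
    by (intro absolutely_integrable_bounded_measurable_product_real
        continuous_imp_measurable_on_sets_lebesgue c1 v'(8)) auto
  have 2: "(\<lambda>x. D1 T (profile z) x * D1 T v x) absolutely_integrable_on {0..T}"
  proof (rule absolutely_integrable_continuous_real)
    have "continuous_on {0..T} (D1 T (profile z))"
      by (rule continuous_on_eq[OF slope_continuous[of T z]]) (simp add: D1_profile)
    then show "continuous_on {0..T} (\<lambda>x. D1 T (profile z) x * D1 T v x)"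
      by (intro continuous_on_mult absolutely_continuous_fun_on_continuous[OF v'(1)])
  qed
  have "((\<lambda>y. W y * apply_bcontfun z y * D2 T v y) has_integral
      (load (deflection z) v + \<beta> * integral {0..T} (\<lambda>y. slope z y * D1 T v y))) {0..T}"
    by (rule fixed_point_weak_equation[OF z v'(1) S v'(2) v'(4-7)])
  then have "integral {0..T} (\<lambda>x. W x * D2 T (profile z) x * D2 T v x) =
      load (deflection z) v + \<beta> * integral {0..T} (\<lambda>y. slope z y * D1 T v y)"
    by (intro integral_unique) (rule has_integral_eq[rotated], assumption, simp add: D2_profile)
  moreover have "integral {0..T} (\<lambda>x. D1 T (profile z) x * D1 T v x) = integral {0..T} (\<lambda>y. slope z y * D1 T v y)"
    by (intro integral_cong) (simp add: D1_profile)
  ultimately show ?thesis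
    using set_lebesgue_integral_eq_integral(2)[OF 1] set_lebesgue_integral_eq_integral(2)[OF 2] by simp
qed

end

section \<open>The impulsive problem\<close>

locale impulsive_data =
  fixes T \<beta> \<delta> a1 \<theta>1 astar a2 \<theta>2 :: real
    and N :: nat and s t :: "nat \<Rightarrow> real" and h :: "real \<Rightarrow> real"
    and f :: "nat \<Rightarrow> real \<Rightarrow> real \<Rightarrow> real" and I :: "nat \<Rightarrow> real \<Rightarrow> real"
  assumes T_gt_0: "0 < T" and s_0: "s 0 = 0" and t_N: "t (N + 1) = T"
    and s_less_t: "\<And>i. i \<in> {0..N} \<Longrightarrow> s i < t (i + 1)"
    and t_less_s: "\<And>i. i \<in> {1..N} \<Longrightarrow> t i < s i"
    and h_cont: "continuous_on {0..T} h" and \<delta>_pos: "0 < \<delta>"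
    and f_cont: "\<And>i. i \<in> {0..N} \<Longrightarrow> continuous_on ({s i<..t (i + 1)} \<times> {-\<delta>..\<delta>}) (\<lambda>(x, u). f i x u)"
    and I_cont: "\<And>i. i \<in> {1..N} \<Longrightarrow> continuous_on {-\<delta>..\<delta>} (I i)"
    and f_odd: "\<And>i x u. i \<in> {0..N} \<Longrightarrow> x \<in> {s i<..t (i + 1)} \<Longrightarrow> u \<in> {-\<delta>..\<delta>} \<Longrightarrow> f i x u = - f i x (- u)"
    and a1_pos: "0 < a1" and \<theta>1: "1 < \<theta>1" "\<theta>1 < 2"
    and f_bound: "\<And>i x u. i \<in> {0..N} \<Longrightarrow> x \<in> {s i<..t (i + 1)} \<Longrightarrow> u \<in> {-\<delta>..\<delta>} \<Longrightarrow>
      \<bar>f i x u\<bar> \<le> a1 * \<bar>u\<bar> powr (\<theta>1 - 1)"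
    and astar_pos: "0 < astar"
    and F_lower: "\<And>i x u. i \<in> {0..N} \<Longrightarrow> x \<in> {s i<..t (i + 1)} \<Longrightarrow> u \<in> {-\<delta>..\<delta>} \<Longrightarrow>
      astar * \<bar>u\<bar> powr \<theta>1 \<le> primitive (f i x) u"
    and I_odd: "\<And>i u. i \<in> {1..N} \<Longrightarrow> u \<in> {-\<delta>..\<delta>} \<Longrightarrow> I i u = - I i (- u)"
    and a2_pos: "0 < a2" and \<theta>2: "1 < \<theta>2"
    and I_bound: "\<And>i u. i \<in> {1..N} \<Longrightarrow> u \<in> {-\<delta>..\<delta>} \<Longrightarrow> \<bar>I i u\<bar> \<le> a2 * (\<bar>u\<bar> powr (\<theta>2 - 1) + 1)"
    and I_nonneg: "\<And>i u. i \<in> {1..N} \<Longrightarrow> u \<in> {0..\<delta>} \<Longrightarrow> 0 \<le> I i u"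
begin

lemma s_nonneg: "i \<le> N \<Longrightarrow> 0 \<le> s i"
proof (induction i)
  case (Suc i)
  then show ?case using s_less_t[of i] t_less_s[of "Suc i"] by simp
qed (simp add: s_0)

lemma t_le_T: "i \<le> N \<Longrightarrow> t (i + 1) \<le> T"
proof (induction i rule: inc_induct)
  case (step i)
  then show ?case using s_less_t[of "Suc i"] t_less_s[of "Suc i"] by simp
qed (use t_N in simp)

lemma interval_subset: "i \<in> {0..N} \<Longrightarrow> {s i<..t (i + 1)} \<subseteq> {0..T}"
  using s_nonneg[of i] t_le_T[of i] by auto

lemma t_in: "i \<in> {1..N} \<Longrightarrow> t i \<in> {0..T}"
  using s_nonneg[of "i - 1"] s_less_t[of "i - 1"] t_le_T[of "i - 1"] by (cases i) auto

text \<open>The nonlinearities are given only for \<open>\<bar>u\<bar> \<le> \<delta>\<close>; clipping the argument makes them globally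
  defined and bounded, and only solutions below \<open>\<delta>\<close> are used.\<close>

definition clip :: "real \<Rightarrow> real" where "clip r = max (- \<delta>) (min \<delta> r)"

lemma clip_mem: "clip r \<in> {-\<delta>..\<delta>}" and clip_abs: "\<bar>clip r\<bar> \<le> \<delta>"
  and clip_minus: "clip (- r) = - clip r" and clip_eq: "\<bar>r\<bar> \<le> \<delta> \<Longrightarrow> clip r = r"
  and clip_dist: "\<bar>clip r - clip r'\<bar> \<le> \<bar>r - r'\<bar>"
  using \<delta>_pos by (auto simp: clip_def)

lemma clip_continuous: "continuous_on S u \<Longrightarrow> continuous_on S (\<lambda>x. clip (u x))"
  unfolding clip_def by (intro continuous_intros)

lemma uniformly_continuous_clip:
  assumes "continuous_on {-\<delta>..\<delta>} q"
  shows "uniformly_continuous_on UNIV (\<lambda>r. q (clip r) :: real)"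
  unfolding uniformly_continuous_on_def
proof (intro allI impI)
  fix e :: real assume "0 < e"
  then obtain d where d: "d > 0" "\<And>x y. x \<in> {-\<delta>..\<delta>} \<Longrightarrow> y \<in> {-\<delta>..\<delta>} \<Longrightarrow> dist y x < d \<Longrightarrow> dist (q y) (q x) < e"
    using compact_uniformly_continuous[OF assms compact_Icc] unfolding uniformly_continuous_on_def by blast
  have "dist (q (clip x')) (q (clip x)) < e" if "dist x' x < d" for x x'
    using clip_dist[of x' x] that by (intro d(2) clip_mem) (simp add: dist_real_def)
  then show "\<exists>d>0. \<forall>x\<in>UNIV. \<forall>x'\<in>UNIV. dist x' x < d \<longrightarrow> dist (q (clip x')) (q (clip x)) < e"
    using d(1) by blast
qed

section \<open>The weighted and clipped nonlinearities\<close>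

definition weight :: "real \<Rightarrow> real" where "weight x = exp (primitive h x)"

definition piece :: "nat \<Rightarrow> real \<Rightarrow> real \<Rightarrow> real" where
  "piece i x r = (if s i < x \<and> x \<le> t (i + 1) then weight x * f i x r else 0)"

text \<open>The intervals are disjoint, so at most one summand is nonzero; the sum avoids selecting
  an interval for each x.\<close>

definition force :: "real \<Rightarrow> real \<Rightarrow> real" where
  "force x r = (\<Sum>i=0..N. piece i x (clip r))"

text \<open>The end points of all pieces, the only places where \<open>force\<close> may be
  discontinuous in x.\<close>

definition jumps :: "real set" where "jumps = s ` {0..N} \<union> t ` {1..N + 1}"

definition impulse :: "nat \<Rightarrow> real \<Rightarrow> real" where "impulse i r = weight (t i) * I i (clip r)"

definition weight_sup :: real where "weight_sup = (SUP x\<in>{0..T}. weight x)"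

text \<open>One constant for both nonlinearities: the first summand covers the force, the second the
  impulses.\<close>

definition bound :: real where
  "bound = real (N + 1) * (weight_sup * (a1 * \<delta> powr (\<theta>1 - 1))) + weight_sup * (a2 * (\<delta> powr (\<theta>2 - 1) + 1))"

lemma weight_pos: "0 < weight x"
  by (simp add: weight_def)

lemma weight_continuous: "continuous_on {0..T} weight"
  unfolding weight_def[abs_def] by (intro continuous_intros continuous_primitive_Icc h_cont)

lemma weight_le_sup: "x \<in> {0..T} \<Longrightarrow> weight x \<le> weight_sup"
  unfolding weight_sup_def
  by (intro cSUP_upper bounded_imp_bdd_above compact_imp_bounded compact_continuous_image weight_continuous compact_Icc)

lemma weight_sup_pos: "0 < weight_sup"
  using weight_le_sup[of 0] weight_pos[of 0] T_gt_0 by simp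

lemma powr_le: "\<bar>r\<bar> \<le> \<delta> \<Longrightarrow> 1 < \<theta> \<Longrightarrow> \<bar>r\<bar> powr (\<theta> - 1) \<le> \<delta> powr (\<theta> - 1)"
  by (intro powr_mono2) auto

lemma piece_bound:
  assumes "i \<in> {0..N}" "x \<in> {0..T}"
  shows "\<bar>piece i x (clip r)\<bar> \<le> weight_sup * (a1 * \<delta> powr (\<theta>1 - 1))"
proof (cases "s i < x \<and> x \<le> t (i + 1)")
  case True
  have "\<bar>f i x (clip r)\<bar> \<le> a1 * \<bar>clip r\<bar> powr (\<theta>1 - 1)"
    using True assms clip_mem by (intro f_bound) auto
  also have "\<dots> \<le> a1 * \<delta> powr (\<theta>1 - 1)"
    using a1_pos \<theta>1 by (intro mult_left_mono powr_le clip_abs) auto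
  finally show ?thesis
    using True weight_le_sup[OF assms(2)] weight_pos[of x] weight_sup_pos
    by (auto simp: piece_def abs_mult intro!: mult_mono)
next
  case False
  show ?thesis unfolding piece_def if_not_P[OF False] using weight_sup_pos a1_pos by simp
qed

lemma force_bound:
  assumes "x \<in> {0..T}" shows "\<bar>force x r\<bar> \<le> bound"
proof -
  have "\<bar>force x r\<bar> \<le> (\<Sum>i=0..N. weight_sup * (a1 * \<delta> powr (\<theta>1 - 1)))"
    unfolding force_def using piece_bound assms by (intro order_trans[OF sum_abs] sum_mono)
  also have "\<dots> \<le> bound" using weight_sup_pos a2_pos by (simp add: bound_def)
  finally show ?thesis .
qed

lemma impulse_bound:
  assumes i: "i \<in> {1..N}" shows "\<bar>impulse i r\<bar> \<le> bound"
proof -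
  have "\<bar>I i (clip r)\<bar> \<le> a2 * (\<bar>clip r\<bar> powr (\<theta>2 - 1) + 1)" using i clip_mem by (intro I_bound)
  also have "\<dots> \<le> a2 * (\<delta> powr (\<theta>2 - 1) + 1)"
    using a2_pos \<theta>2 by (intro mult_left_mono add_right_mono powr_le clip_abs) auto
  finally have "\<bar>impulse i r\<bar> \<le> weight_sup * (a2 * (\<delta> powr (\<theta>2 - 1) + 1))"
    using weight_le_sup[OF t_in[OF i]] weight_pos[of "t i"] weight_sup_pos
    by (auto simp: impulse_def abs_mult intro!: mult_mono)
  also have "\<dots> \<le> bound" using weight_sup_pos a1_pos by (simp add: bound_def)
  finally show ?thesis .
qed

text \<open>With the end points removed, the inside and the outside of the interval are relatively
  open, so the two branches can be glued.\<close>

lemma piece_jointly_continuous: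
  assumes i: "i \<in> {0..N}"
  shows "continuous_on (({0..T} - jumps) \<times> {-\<delta>..\<delta>}) (\<lambda>p. piece i (fst p) (snd p))"
proof -
  define A where "A = (({0..T} - jumps) \<inter> {s i<..<t (i + 1)}) \<times> {-\<delta>..\<delta>}"
  define B where "B = (({0..T} - jumps) \<inter> - {s i..t (i + 1)}) \<times> {-\<delta>..\<delta>}"
  have "s i \<in> jumps" "t (i + 1) \<in> jumps" using i by (auto simp: jumps_def)
  then have AB: "({0..T} - jumps) \<times> {-\<delta>..\<delta>} = A \<union> B"
    unfolding A_def B_def by (auto simp: less_le)
  have "A = (A \<union> B) \<inter> ({s i<..<t (i + 1)} \<times> UNIV)" unfolding A_def B_def by auto
  then have opA: "openin (top_of_set (A \<union> B)) A"
    by (metis openin_open_Int open_Times open_UNIV open_greaterThanLessThan)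
  have "B = (A \<union> B) \<inter> ((- {s i..t (i + 1)}) \<times> UNIV)" unfolding A_def B_def by auto
  then have opB: "openin (top_of_set (A \<union> B)) B"
    by (metis openin_open_Int open_Times open_UNIV open_Compl closed_atLeastAtMost)
  have "continuous_on A (\<lambda>p. (\<lambda>(x, u). f i x u) p)"
    by (rule continuous_on_subset[OF f_cont[OF i]]) (auto simp: A_def)
  moreover have "continuous_on A (\<lambda>p. weight (fst p))"
    by (rule continuous_on_compose2[OF weight_continuous]) (auto simp: A_def intro!: continuous_intros)
  ultimately have "continuous_on A (\<lambda>p. weight (fst p) * f i (fst p) (snd p))"
    by (auto simp: split_def intro!: continuous_on_mult)
  then have "continuous_on (A \<union> B) (\<lambda>p. if s i < fst p \<and> fst p \<le> t (i + 1) then weight (fst p) * f i (fst p) (snd p) else 0)"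
  proof (rule continuous_on_cases_local_open[OF opA opB _ continuous_on_const])
    fix p
    assume "p \<in> A \<and> \<not> (s i < fst p \<and> fst p \<le> t (i + 1)) \<or> p \<in> B \<and> s i < fst p \<and> fst p \<le> t (i + 1)"
    then show "weight (fst p) * f i (fst p) (snd p) = 0" by (auto simp: A_def B_def)
  qed
  then show ?thesis unfolding AB piece_def .
qed

lemma piece_continuous_comp:
  assumes i: "i \<in> {0..N}" and \<phi>: "continuous_on S \<phi>" "\<phi> ` S \<subseteq> {0..T} - jumps" and \<psi>: "continuous_on S \<psi>"
  shows "continuous_on S (\<lambda>x. piece i (\<phi> x) (clip (\<psi> x)))"
proof -
  have "continuous_on S (\<lambda>x. (\<lambda>p. piece i (fst p) (snd p)) (\<phi> x, clip (\<psi> x)))"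
  proof (rule continuous_on_compose2[OF piece_jointly_continuous[OF i]])
    show "continuous_on S (\<lambda>x. (\<phi> x, clip (\<psi> x)))"
      by (intro continuous_on_Pair \<phi> clip_continuous \<psi>)
    show "(\<lambda>x. (\<phi> x, clip (\<psi> x))) ` S \<subseteq> ({0..T} - jumps) \<times> {-\<delta>..\<delta>}"
      using \<phi>(2) clip_mem by (auto simp del: atLeastAtMost_iff)
  qed
  then show ?thesis by simp
qed

lemma force_continuous_comp:
  assumes "continuous_on S \<phi>" "\<phi> ` S \<subseteq> {0..T} - jumps" "continuous_on S \<psi>"
  shows "continuous_on S (\<lambda>x. force (\<phi> x) (\<psi> x))"
  unfolding force_def by (intro continuous_on_sum piece_continuous_comp assms)

lemma piece_continuous:
  assumes i: "i \<in> {0..N}"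
  shows "continuous_on {-\<delta>..\<delta>} (piece i x)"
proof (cases "s i < x \<and> x \<le> t (i + 1)")
  case True
  have "continuous_on {-\<delta>..\<delta>} (\<lambda>r. (\<lambda>(x, u). f i x u) (x, r))"
    by (rule continuous_on_compose2[OF f_cont[OF i]]) (use True in \<open>auto intro!: continuous_intros\<close>)
  then show ?thesis unfolding piece_def[abs_def] if_P[OF True] by (simp add: continuous_on_mult_left)
next
  case False
  show ?thesis unfolding piece_def[abs_def] if_not_P[OF False] by (rule continuous_on_const)
qed

lemma force_unif: "uniformly_continuous_on UNIV (force x)"
proof -
  have "continuous_on {-\<delta>..\<delta>} (\<lambda>r. \<Sum>i=0..N. piece i x r)"
    by (intro continuous_on_sum piece_continuous)
  from uniformly_continuous_clip[OF this] show ?thesis unfolding force_def[abs_def] .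
qed

lemma impulse_unif: "i \<in> {1..N} \<Longrightarrow> uniformly_continuous_on UNIV (impulse i)"
  unfolding impulse_def[abs_def]
  by (rule uniformly_continuous_clip[where q = "\<lambda>r. weight (t i) * I i r"]) (intro continuous_intros I_cont)

lemma force_odd: "x \<in> {0..T} \<Longrightarrow> force x (- r) = - force x r"
  unfolding force_def sum_negf[symmetric]
  using f_odd clip_mem by (intro sum.cong) (auto simp: piece_def clip_minus)

lemma impulse_odd: "i \<in> {1..N} \<Longrightarrow> impulse i (- r) = - impulse i r"
  using I_odd[of i "clip r"] clip_mem by (simp add: impulse_def clip_minus)

text \<open>As \<open>u x\<close> times an integral over {0..1}, the potential inherits continuity
  from an integrand that is jointly continuous off the jumps.\<close>

lemma force_potential_continuous:
  assumes u: "continuous_on {0..T} u"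
  shows "continuous_on ({0..T} - jumps) (\<lambda>x. primitive (force x) (u x))"
proof -
  have u': "continuous_on ({0..T} - jumps) u" using u by (rule continuous_on_subset) auto
  have "continuous_on (({0..T} - jumps) \<times> cbox 0 1) (\<lambda>p. force (fst p) (snd p * u (fst p)))"
    by (intro force_continuous_comp continuous_intros continuous_on_compose2[OF u']) auto
  then have "continuous_on ({0..T} - jumps) (\<lambda>x. integral (cbox 0 1) (\<lambda>\<sigma>. force x (\<sigma> * u x)))"
    by (intro integral_continuous_on_param) (simp add: split_def)
  then have "continuous_on ({0..T} - jumps) (\<lambda>x. u x * integral {0..1} (\<lambda>\<sigma>. force x (\<sigma> * u x)))"
    using u' by (intro continuous_on_mult) auto
  then show ?thesis
  proof (rule continuous_on_eq)
    fix x assume "x \<in> {0..T} - jumps"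
    then have "continuous_on UNIV (force x)" using force_unif by (intro uniformly_continuous_imp_continuous) auto
    then show "u x * integral {0..1} (\<lambda>\<sigma>. force x (\<sigma> * u x)) = primitive (force x) (u x)"
      using primitive_eq_integral[OF continuous_on_subset[of UNIV "force x"], of "\<bar>u x\<bar>"] by simp
  qed
qed

sublocale impulsive_beam T weight \<beta> bound force "\<lambda>x. primitive (force x)" jumps N t impulse "\<lambda>i. primitive (impulse i)"
proof (intro impulsive_beam.intro impulsive_beam_axioms.intro weighted_interval.intro)
  show "continuous_on ({0..T} - jumps) (\<lambda>x. force x (u x))" if "continuous_on {0..T} u" for u
    using continuous_on_subset[OF that, of "{0..T} - jumps"]
    by (intro force_continuous_comp continuous_on_id) auto
  show "(primitive (force x) has_real_derivative force x r) (at r)" for x r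
    using force_unif by (intro primitive_deriv uniformly_continuous_imp_continuous)
  show "(primitive (impulse i) has_real_derivative impulse i r) (at r)" if "i \<in> {1..N}" for i r
    using impulse_unif[OF that] by (intro primitive_deriv uniformly_continuous_imp_continuous)
  show "finite jumps" by (simp add: jumps_def)
qed (use T_gt_0 weight_continuous weight_pos force_potential_continuous force_bound force_unif force_odd
    impulse_bound impulse_unif impulse_odd t_in in auto)

text \<open>The segment from 0 to \<open>r\<close> stays where clipping changes nothing, so the
  potential is that of the given nonlinearities.\<close>

lemma force_potential:
  assumes r: "\<bar>r\<bar> \<le> \<delta>"
  shows "primitive (force x) r =
    (\<Sum>i=0..N. if s i < x \<and> x \<le> t (i + 1) then weight x * primitive (f i x) r else 0)"
proof -
  have mem: "\<bar>\<sigma> * r\<bar> \<le> \<delta>" if "\<sigma> \<in> {0..1}" for \<sigma>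
  proof -
    have "\<bar>\<sigma> * r\<bar> \<le> 1 * \<delta>" unfolding abs_mult using that r by (intro mult_mono) auto
    then show ?thesis by simp
  qed
  then have mem': "\<sigma> * r \<in> {-\<delta>..\<delta>}" if "\<sigma> \<in> {0..1}" for \<sigma>
    using that by (auto simp: abs_le_iff minus_le_iff)
  have int: "(\<lambda>\<sigma>. piece i x (\<sigma> * r)) integrable_on {0..1}" if "i \<in> {0..N}" for i
    by (intro integrable_continuous_real continuous_on_compose2[OF piece_continuous[OF that]]
        continuous_intros image_subsetI mem')
  have "continuous_on {-\<delta>..\<delta>} (force x)"
    using uniformly_continuous_imp_continuous[OF force_unif] by (rule continuous_on_subset) simp
  then have "primitive (force x) r = r * integral {0..1} (\<lambda>\<sigma>. force x (\<sigma> * r))"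
    using r by (rule primitive_eq_integral)
  also have "integral {0..1} (\<lambda>\<sigma>. force x (\<sigma> * r)) = integral {0..1} (\<lambda>\<sigma>. \<Sum>i=0..N. piece i x (\<sigma> * r))"
    unfolding force_def using mem by (intro integral_cong) (simp add: clip_eq)
  also have "\<dots> = (\<Sum>i=0..N. integral {0..1} (\<lambda>\<sigma>. piece i x (\<sigma> * r)))"
    using int by (intro integral_sum) auto
  also have "r * \<dots> = (\<Sum>i=0..N. if s i < x \<and> x \<le> t (i + 1) then weight x * primitive (f i x) r else 0)"
    unfolding sum_distrib_left
  proof (rule sum.cong[OF refl])
    fix i assume i: "i \<in> {0..N}"
    show "r * integral {0..1} (\<lambda>\<sigma>. piece i x (\<sigma> * r)) =
        (if s i < x \<and> x \<le> t (i + 1) then weight x * primitive (f i x) r else 0)"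
    proof (cases "s i < x \<and> x \<le> t (i + 1)")
      case True
      have "continuous_on {-\<delta>..\<delta>} (\<lambda>r. (\<lambda>(x, u). f i x u) (x, r))"
        by (rule continuous_on_compose2[OF f_cont[OF i]]) (use True in \<open>auto intro!: continuous_intros\<close>)
      then have "continuous_on {-\<delta>..\<delta>} (f i x)" by simp
      from primitive_eq_integral[OF this r] show ?thesis
        unfolding piece_def if_P[OF True] by simp
    next
      case False
      show ?thesis unfolding piece_def if_not_P[OF False] by simp
    qed
  qed
  finally show ?thesis .
qed

lemma force_potential_lower:
  assumes r: "\<bar>r\<bar> \<le> \<delta>"
  shows "0 \<le> primitive (force x) r"
    and "j \<in> {0..N} \<Longrightarrow> x \<in> {s j<..t (j + 1)} \<Longrightarrow> weight x * (astar * \<bar>r\<bar> powr \<theta>1) \<le> primitive (force x) r"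
proof -
  have r': "r \<in> {-\<delta>..\<delta>}" using r by auto
  define a where "a i = (if s i < x \<and> x \<le> t (i + 1) then weight x * primitive (f i x) r else 0)" for i
  have low: "weight x * (astar * \<bar>r\<bar> powr \<theta>1) \<le> a i" if "i \<in> {0..N}" "s i < x \<and> x \<le> t (i + 1)" for i
    using F_lower[OF that(1) _ r', of x] that(2) weight_pos[of x] by (simp add: a_def)
  have pos: "0 \<le> weight x * (astar * \<bar>r\<bar> powr \<theta>1)" using weight_pos[of x] astar_pos by simp
  have a: "0 \<le> a i" if "i \<in> {0..N}" for i
  proof (cases "s i < x \<and> x \<le> t (i + 1)")
    case True
    then show ?thesis using low[OF that True] pos by linarith
  next
    case False
    show ?thesis unfolding a_def if_not_P[OF False] by simp
  qed
  have eq: "primitive (force x) r = (\<Sum>i=0..N. a i)" unfolding a_def by (rule force_potential[OF r])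
  show "0 \<le> primitive (force x) r" unfolding eq using a by (intro sum_nonneg)
  assume j: "j \<in> {0..N}" "x \<in> {s j<..t (j + 1)}"
  then have "weight x * (astar * \<bar>r\<bar> powr \<theta>1) \<le> a j" by (intro low) auto
  also have "\<dots> \<le> (\<Sum>i=0..N. a i)" using j a by (intro member_le_sum) auto
  finally show "weight x * (astar * \<bar>r\<bar> powr \<theta>1) \<le> primitive (force x) r" unfolding eq .
qed

text \<open>The power \<theta>1 < 2 dominates every quadratic near 0. The interval starts at
  \<open>t 1 / 2\<close> because the first piece is open at \<open>s 0 = 0\<close>.\<close>

lemma force_potential_sublinear:
  "\<exists>\<rho>>0. \<forall>x\<in>{t 1 / 2..t 1}. \<forall>r. \<bar>r\<bar> \<le> \<rho> \<longrightarrow> C * r\<^sup>2 \<le> primitive (force x) r"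
proof -
  obtain w0 where w0: "0 < w0" "\<And>x. x \<in> {0..T} \<Longrightarrow> w0 \<le> weight x" using W_bounds by blast
  have t1: "0 < t 1" "t 1 \<le> T" using s_less_t[of 0] t_le_T[of 0] s_0 by auto
  define c where "c = w0 * astar"
  have c: "0 < c" using w0(1) astar_pos by (simp add: c_def)
  define C' where "C' = max C 1"
  have C': "0 < C'" "C \<le> C'" by (auto simp: C'_def)
  \<comment> \<open>The second entry is the radius at which C' r^2 and c times the power \<theta>1
    of r are equal.\<close>
  define \<rho> where "\<rho> = min \<delta> ((c / C') powr (1 / (2 - \<theta>1)))"
  have "0 < \<rho>" using \<delta>_pos c C' by (simp add: \<rho>_def)
  moreover have "C * r\<^sup>2 \<le> primitive (force x) r" if x: "x \<in> {t 1 / 2..t 1}" and r: "\<bar>r\<bar> \<le> \<rho>" for x r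
  proof -
    have xT: "x \<in> {0..T}" "x \<in> {s 0<..t (0 + 1)}" using x t1 s_0 by auto
    have r\<delta>: "\<bar>r\<bar> \<le> \<delta>" using r by (simp add: \<rho>_def)
    have "\<bar>r\<bar> powr (2 - \<theta>1) \<le> ((c / C') powr (1 / (2 - \<theta>1))) powr (2 - \<theta>1)"
      using r \<theta>1 by (intro powr_mono2) (auto simp: \<rho>_def)
    also have "\<dots> = c / C'" using \<theta>1 c C' by (simp add: powr_powr)
    finally have p: "\<bar>r\<bar> powr (2 - \<theta>1) \<le> c / C'" .
    have "C * r\<^sup>2 \<le> C' * r\<^sup>2" using C'(2) by (intro mult_right_mono) auto
    also have "C' * r\<^sup>2 = C' * (\<bar>r\<bar> powr (2 - \<theta>1) * \<bar>r\<bar> powr \<theta>1)"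
      by (cases "r = 0") (simp_all add: powr_add[symmetric] powr_numeral)
    also have "\<dots> \<le> C' * (c / C' * \<bar>r\<bar> powr \<theta>1)"
      using p C'(1) by (intro mult_left_mono mult_right_mono) auto
    also have "\<dots> = w0 * (astar * \<bar>r\<bar> powr \<theta>1)" using C'(1) by (simp add: c_def)
    also have "\<dots> \<le> weight x * (astar * \<bar>r\<bar> powr \<theta>1)"
      using w0(2)[OF xT(1)] astar_pos by (intro mult_right_mono) auto
    also have "\<dots> \<le> primitive (force x) r"
      using force_potential_lower(2)[OF r\<delta>, of 0 x] xT(2) by simp
    finally show ?thesis .
  qed
  ultimately show ?thesis by blast
qed

lemma impulse_potential_nonneg:
  assumes i: "i \<in> {1..N}" and r: "\<bar>r\<bar> \<le> \<delta>"
  shows "0 \<le> primitive (impulse i) r"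
proof (rule primitive_nonneg_of_odd[where K = "primitive (impulse i)" and J = "impulse i" and \<delta> = \<delta>])
  show "0 \<le> impulse i r" if "0 \<le> r" "r \<le> \<delta>" for r
    using I_nonneg[OF i, of r] that weight_pos[of "t i"] by (simp add: impulse_def clip_eq)
qed (use K_deriv[OF i] impulse_odd[OF i] r in auto)

text \<open>Below \<delta> clipping is invisible, and each piece vanishes outside its interval, so
  its integral over {0..T} reduces to that interval.\<close>

lemma load_eq:
  assumes small: "\<And>y. y \<in> {0..T} \<Longrightarrow> \<bar>deflection z y\<bar> \<le> \<delta>" and v: "v \<in> H20 T"
  shows "load (deflection z) v =
    (\<Sum>i=0..N. LINT x:{s i<..t (i + 1)}|lebesgue. exp (primitive h x) * f i x (profile z x) * v x)
    + (\<Sum>i=1..N. exp (primitive h (t i)) * I i (profile z (t i)) * v (t i))"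
proof -
  define \<phi> where "\<phi> i x = piece i x (clip (deflection z x)) * v x" for i x
  have vc: "continuous_on {0..T} v" using H20D(2)[OF T_gt_0 v] by (intro DERIV_continuous_on) auto
  obtain V where V: "\<And>x. x \<in> {0..T} \<Longrightarrow> \<bar>v x\<bar> \<le> V"
    using compact_imp_bounded[OF compact_continuous_image[OF vc compact_Icc]]
    unfolding bounded_iff real_norm_def by blast
  have \<phi>_int: "\<phi> i absolutely_integrable_on {0..T}" if i: "i \<in> {0..N}" for i
  proof (rule absolutely_integrable_finite_discontinuities[OF finite_P])
    have "{0..T} - jumps \<subseteq> {0..T}" by blast
    then show "continuous_on ({0..T} - jumps) (\<phi> i)"
      unfolding \<phi>_def[abs_def]
      by (intro continuous_on_mult piece_continuous_comp[OF i] continuous_on_id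
          continuous_on_subset[OF vc] continuous_on_subset[OF deflection_continuous]) auto
    show "\<bar>\<phi> i x\<bar> \<le> weight_sup * (a1 * \<delta> powr (\<theta>1 - 1)) * V" if "x \<in> {0..T}" for x
      unfolding \<phi>_def abs_mult using piece_bound[OF i that] V[OF that] weight_sup_pos a1_pos
      by (intro mult_mono) auto
  qed
  have 1: "integral {0..T} (\<phi> i) = (LINT x:{s i<..t (i + 1)}|lebesgue. exp (primitive h x) * f i x (profile z x) * v x)"
    if i: "i \<in> {0..N}" for i
  proof -
    let ?S = "{s i<..t (i + 1)}"
    have sub: "?S \<subseteq> {0..T}" using interval_subset[OF i] .
    have S_int: "set_integrable lebesgue ?S (\<phi> i)"
      using set_integrable_subset[OF \<phi>_int[OF i] _ sub] by simp
    have eq: "exp (primitive h x) * f i x (profile z x) * v x = \<phi> i x" if "x \<in> ?S" for x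
    proof -
      have "x \<in> {0..T}" using that sub by blast
      then show ?thesis using that small[of x] by (auto simp: \<phi>_def piece_def weight_def clip_eq profile_def)
    qed
    have "(LINT x:?S|lebesgue. exp (primitive h x) * f i x (profile z x) * v x) = (LINT x:?S|lebesgue. \<phi> i x)"
      by (intro set_lebesgue_integral_cong) (auto simp: eq)
    moreover have "(\<phi> i has_integral (LINT x:?S|lebesgue. \<phi> i x)) {0..T}"
      by (rule has_integral_on_superset[OF has_integral_set_lebesgue[OF S_int] _ sub])
        (auto simp: \<phi>_def piece_def)
    ultimately show ?thesis by (simp add: integral_unique)
  qed
  have "integral {0..T} (\<lambda>x. force x (deflection z x) * v x) = integral {0..T} (\<lambda>x. \<Sum>i=0..N. \<phi> i x)"
    by (simp add: force_def \<phi>_def sum_distrib_right)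
  also have "\<dots> = (\<Sum>i=0..N. integral {0..T} (\<phi> i))"
    using \<phi>_int by (intro integral_sum) (auto intro: set_lebesgue_integral_eq_integral(1))
  also have "\<dots> = (\<Sum>i=0..N. LINT x:{s i<..t (i + 1)}|lebesgue. exp (primitive h x) * f i x (profile z x) * v x)"
    using 1 by (intro sum.cong) auto
  finally have A: "integral {0..T} (\<lambda>x. force x (deflection z x) * v x) =
    (\<Sum>i=0..N. LINT x:{s i<..t (i + 1)}|lebesgue. exp (primitive h x) * f i x (profile z x) * v x)" .
  have "(\<Sum>i=1..N. impulse i (deflection z (t i)) * v (t i))
      = (\<Sum>i=1..N. exp (primitive h (t i)) * I i (profile z (t i)) * v (t i))"
  proof (rule sum.cong[OF refl])
    fix i assume i: "i \<in> {1..N}"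
    show "impulse i (deflection z (t i)) * v (t i) = exp (primitive h (t i)) * I i (profile z (t i)) * v (t i)"
      using small[OF t_in[OF i]] t_in[OF i] by (simp add: impulse_def weight_def profile_def clip_eq)
  qed
  then show ?thesis unfolding load_def A by simp
qed

theorem infinitely_many_weak_solutions:
  "infinite {u. weak_solution T N s t h \<beta> \<delta> f I u \<and> sup_norm T u < \<delta> / 2}"
proof
  define \<S> where "\<S> = {u. weak_solution T N s t h \<beta> \<delta> f I u \<and> sup_norm T u < \<delta> / 2}"
  assume "finite {u. weak_solution T N s t h \<beta> \<delta> f I u \<and> sup_norm T u < \<delta> / 2}"
  then have fin: "finite \<S>" by (simp add: \<S>_def)
  have t1: "0 < t 1" "t 1 \<le> T" using s_less_t[of 0] t_le_T[of 0] s_0 by auto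
  \<comment> \<open>Finitely many solutions have a least positive norm; inserting \<delta> / 2
    covers the case that there is none and gives the required bound.\<close>
  define \<mu> where "\<mu> = Min (insert (\<delta> / 2) (sup_norm T ` {u \<in> \<S>. 0 < sup_norm T u}))"
  have \<mu>: "0 < \<mu>" unfolding \<mu>_def using fin \<delta>_pos by (subst Min_gr_iff) auto
  have \<mu>_le: "\<mu> \<le> \<delta> / 2" "\<And>u. u \<in> \<S> \<Longrightarrow> 0 < sup_norm T u \<Longrightarrow> \<mu> \<le> sup_norm T u"
    unfolding \<mu>_def using fin by (intro Min_le; simp)+
  \<comment> \<open>By the embedding constant, deflections in this ball are at most \<mu> / 2, too
    small for any nontrivial solution in the finite set.\<close>
  define r where "r = \<mu> / (2 * (emb * T))"
  have r: "0 < r" using \<mu> emb_pos T_gt_0 by (simp add: r_def)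
  have "\<exists>z\<in>clamped. 0 < nrm z \<and> nrm z \<le> r \<and> response (deflection z) = z"
  proof (rule small_fixed_point[OF action_finite_genus _ r])
    show "\<exists>e \<epsilon>. 0 < \<epsilon> \<and> (\<forall>x\<in>cross_sphere e n. x \<in> clamped \<and> nrm x \<le> \<rho> \<and> energy x \<le> - \<epsilon>)"
      if "0 < \<rho>" for n \<rho>
      using t1 \<delta>_pos that
      by (intro negative_spheres[of "t 1 / 2" "t 1" \<delta>] force_potential_sublinear
          force_potential_lower(1) impulse_potential_nonneg) auto
  qed
  then obtain z where z: "z \<in> clamped" "0 < nrm z" "nrm z \<le> r" "response (deflection z) = z" by blast
  have small: "\<bar>deflection z y\<bar> \<le> \<mu> / 2" if "y \<in> {0..T}" for y
  proof -
    have "\<bar>deflection z y\<bar> \<le> emb * T * nrm z" by (rule deflection_le[OF that])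
    also have "\<dots> \<le> emb * T * r" using z(3) emb_pos T_gt_0 by (intro mult_left_mono) auto
    also have "\<dots> = \<mu> / 2" using emb_pos T_gt_0 by (simp add: r_def)
    finally show ?thesis .
  qed
  then have norm_le: "sup_norm T (profile z) \<le> \<mu> / 2" by (rule sup_norm_profile_le)
  have small': "\<bar>deflection z y\<bar> \<le> \<delta>" if "y \<in> {0..T}" for y
    using small[OF that] \<mu>_le(1) \<mu> \<delta>_pos by linarith
  have "weak_solution T N s t h \<beta> \<delta> f I (profile z)"
    unfolding weak_solution_def
  proof (intro conjI ballI)
    show "profile z \<in> H20 T" by (rule profile_H20[OF z(1)])
    show "sup_norm T (profile z) \<le> \<delta>" using norm_le \<mu>_le(1) \<mu> \<delta>_pos by linarith
    fix v assume v: "v \<in> H20 T"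
    show "(LINT x:{0..T}|lebesgue. exp (primitive h x) * D2 T (profile z) x * D2 T v x)
        - \<beta> * (LINT x:{0..T}|lebesgue. D1 T (profile z) x * D1 T v x)
        - (\<Sum>i=0..N. LINT x:{s i<..t (i+1)}|lebesgue. exp (primitive h x) * f i x (profile z x) * v x)
        - (\<Sum>i=1..N. exp (primitive h (t i)) * I i (profile z (t i)) * v (t i)) = 0"
      using weak_equation_lebesgue[OF z(1,4) v] load_eq[OF small' v] by (simp add: weight_def)
  qed
  moreover have "sup_norm T (profile z) < \<delta> / 2" using norm_le \<mu>_le(1) \<mu> by linarith
  ultimately have in_S: "profile z \<in> \<S>" by (simp add: \<S>_def)
  obtain y where "y \<in> {0..T}" "deflection z y \<noteq> 0"
    using fixed_point_nontrivial[OF z(1,4,2)] by blast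
  then have "0 < sup_norm T (profile z)" using sup_norm_profile_ge[of y z] by linarith
  then show False using \<mu>_le(2)[OF in_S] norm_le \<mu> by linarith
qed

end

theorem corollary1p1:
  fixes T \<beta> \<delta> a1 \<theta>1 astar a2 \<theta>2 :: real
    and N :: nat
    and s t :: "nat \<Rightarrow> real"
    and h :: "real \<Rightarrow> real"
    and f :: "nat \<Rightarrow> real \<Rightarrow> real \<Rightarrow> real"
    and I :: "nat \<Rightarrow> real \<Rightarrow> real"
  assumes "T > 0" and "N \<ge> 1"
    and "s 0 = 0" and "t (N+1) = T"
    and "\<forall>i\<in>{0..N}. s i < t (i+1)"
    and "\<forall>i\<in>{1..N}. t i < s i"
    and "C1_on {0..T} h"
    and "\<delta> > 0"
    \<comment> \<open>1\<close>
    and "\<forall>i\<in>{0..N}. continuous_on ({s i<..t (i+1)} \<times> {-\<delta>..\<delta>}) (\<lambda>(x, u). f i x u)"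
    and "\<forall>i\<in>{1..N}. continuous_on {-\<delta>..\<delta>} (I i)"
    \<comment> \<open>2\<close>
    and "\<forall>i\<in>{0..N}. \<forall>x\<in>{s i<..t (i+1)}. \<forall>u\<in>{-\<delta>..\<delta>}. f i x u = - f i x (-u)"
    \<comment> \<open>3\<close>
    and "\<forall>i\<in>{0..N}. \<forall>x\<in>{s i<..t (i+1)}. \<forall>u. 0 < \<bar>u\<bar> \<and> \<bar>u\<bar> \<le> \<delta> \<longrightarrow>
           primitive (f i x) u \<ge> 0 \<and> u * f i x u - 2 * primitive (f i x) u < 0"
    \<comment> \<open>4\<close>
    and "\<forall>i\<in>{0..N}. filterlim
           (\<lambda>u. INF x\<in>{s i<..t (i+1)}. primitive (f i x) u / \<bar>u\<bar>\<^sup>2) at_top (at 0)"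
    \<comment> \<open>5\<close>
    and "a1 > 0" and "1 < \<theta>1" and "\<theta>1 < 2"
    and "\<forall>i\<in>{0..N}. \<forall>x\<in>{s i<..t (i+1)}. \<forall>u\<in>{-\<delta>..\<delta>}. \<bar>f i x u\<bar> \<le> a1 * \<bar>u\<bar> powr (\<theta>1 - 1)"
    \<comment> \<open>6\<close>
    and "0 < astar" and "astar < a1 / \<theta>1"
    and "\<forall>i\<in>{0..N}. \<forall>x\<in>{s i<..t (i+1)}. \<forall>u\<in>{-\<delta>..\<delta>}.
           primitive (f i x) u \<ge> astar * \<bar>u\<bar> powr \<theta>1"
    \<comment> \<open>7\<close>
    and "\<forall>i\<in>{1..N}. \<forall>u\<in>{-\<delta>..\<delta>}. I i u = - I i (-u)"
    \<comment> \<open>8\<close>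
    and "a2 > 0" and "1 < \<theta>2" and "\<theta>2 < 2"
    and "\<forall>i\<in>{1..N}. \<forall>u\<in>{-\<delta>..\<delta>}. \<bar>I i u\<bar> \<le> a2 * (\<bar>u\<bar> powr (\<theta>2 - 1) + 1)"
    \<comment> \<open>9\<close>
    and "\<forall>i\<in>{1..N}. \<forall>u\<in>{0..\<delta>}. I i u \<ge> 0"
    and "\<forall>u\<in>{-\<delta>..\<delta>}.
           2 * (\<Sum>i=1..N. primitive (\<lambda>r. exp (primitive h (t i)) * I i r) u)
             \<ge> (\<Sum>i=1..N. exp (primitive h (t i)) * I i u * u)"
    \<comment> \<open>10\<close>
    and "2 * exp (INF x\<in>{0..T}. primitive h x) / T\<^sup>2 > \<beta>"
  shows "infinite {u. weak_solution T N s t h \<beta> \<delta> f I u \<and> sup_norm T u < \<delta> / 2}"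
proof -
  have h: "continuous_on {0..T} h"
    using assms(7) unfolding C1_on_def by (auto intro: DERIV_continuous_on)
  interpret impulsive_data T \<beta> \<delta> a1 \<theta>1 astar a2 \<theta>2 N s t h f I
  proof (rule impulsive_data.intro)
    show "0 < T" "s 0 = 0" "t (N + 1) = T" "continuous_on {0..T} h" "0 < \<delta>" "0 < a1" "1 < \<theta>1" "\<theta>1 < 2"
      "0 < astar" "0 < a2" "1 < \<theta>2"
      by (fact assms h)+
  qed (use assms(5,6,9-11,17,20,21,25,26) in blast)+
  show ?thesis by (rule infinitely_many_weak_solutions)
qed

end
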